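(* Let $s\in[0.5,1)$, let $\Omega\subset\mathbb{R}^n$ be a bounded domain, let $A:\mathbb{R}^n\to\mathbb{R}^{n\times n}$ be a bounded, measurable, symmetric and elliptic tensor, let $\lambda_{\min}$ be the smallest eigenvalue of $A$ over $\mathbb{R}^n$, and let $$\omega(x,y)=C_\omega|x-y|^{-(n+s)},\qquad \alpha(x,y)=\frac{y-x}{|y-x|}.$$ If the advection field $\mathbf{v}$ is bounded and solenoidal, i.e. $\|\mathbf{v}\|_{L^\infty(\Omega)}\le C_v<\infty$ and $\nabla\cdot\mathbf{v}=0$, then the bilinear form $\mathcal{B}'(u,w)=\mathcal{B}_{\omega;A}(u,w)+(\mathbf{v}\cdot\nabla u,w)$ is coercive on $H^s_\Omega(\mathbb{R}^n)$. In particular, for all $u\in H^s_\Omega(\mathbb{R}^n)$, $$\mathcal{B}'(u,u)=\mathcal{B}_{\omega;A}(u,u)\ge\frac{C_{n,s}}{2}\lambda_{\min}\|u\|_{H^s_\Omega}^2 .$$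
   Context: Here $n\in\{1,2,3\}$. Elliptic: there exist $0<\lambda_{\min}\le\lambda_{\max}<\infty$ with $\lambda_{\min}|\xi|^2\le \xi\cdot A(x)\xi\le\lambda_{\max}|\xi|^2$ for all $\xi,x\in\mathbb{R}^n$; the smallest and largest eigenvalues of $A$ over $\mathbb{R}^n$ are such constants. $\mathcal{G}_\omega u(x)=\int_{\mathbb{R}^n}\omega(x,y)(u(y)-u(x))\alpha(x,y)\,dy$ (understood, for $u\in H^s(\mathbb{R}^n)$, as the $L^2$-continuous extension from smooth functions), $\mathcal{D}_\omega\mathbf{w}(x)=\int_{\mathbb{R}^n}\omega(x,y)(\mathbf{w}(x)+\mathbf{w}(y))\cdot\alpha(x,y)\,dy$ (principal value), and $\mathcal{B}_{\omega;A}(u,w)=\int_{\mathbb{R}^n}\mathcal{G}_\omega u\cdot A\,\mathcal{G}_\omega w\,dx$. The constants are $C_{n,s}=\frac{4^s\Gamma(s+\frac n2)}{\pi^{n/2}|\Gamma(-s)|}$ and $C_\omega>0$ the normalization for which $\mathcal{D}_\omega\mathcal{G}_\omega u=-(-\Delta)^su$ with $(-\Delta)^su(x)=C_{n,s}\,\mathrm{p.v.}\int_{\mathbb{R}^n}\frac{u(x)-u(y)}{|x-y|^{n+2s}}dy$; explicitly $C_\omega=\frac{s}{2\,\Gamma(1-s)\sin(\pi s/2)}\Big(\int_{|\theta|=1,\ \theta_1\ge0}|\theta_1|^{s+1}d\theta\Big)^{-1}$. $H^s_\Omega(\mathbb{R}^n)=\{u\in H^s(\mathbb{R}^n):u=0\text{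 on }\mathbb{R}^n\setminus\Omega\}$ and $\|u\|_{H^s_\Omega}^2=\int_{\mathbb{R}^n}\int_{\mathbb{R}^n}\frac{|u(x)-u(y)|^2}{|x-y|^{n+2s}}dy\,dx$. $(\mathbf{v}\cdot\nabla u,w)$ is $\int_\Omega(\mathbf{v}\cdot\nabla u)\,w\,dx$ for $u,w\in C_c^\infty(\Omega)$, and is understood in the sense of the duality extension of this pairing for $u,w\in H^s_\Omega(\mathbb{R}^n)$. *)

theory Defs
  imports "HOL-Analysis.Analysis"
begin

section \<open>Test functions\<close>

fun Ck :: "nat \<Rightarrow> ('a::euclidean_space \<Rightarrow> real) \<Rightarrow> bool" where
  "Ck 0 f \<longleftrightarrow> continuous_on UNIV f"
| "Ck (Suc k) f \<longleftrightarrow>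
     (\<forall>x. f differentiable (at x)) \<and> (\<forall>h. Ck k (\<lambda>x. frechet_derivative f (at x) h))"

text \<open>The elements of \<open>C\<^sub>c\<^sup>\<infinity>(\<Omega>)\<close>, extended by zero to the whole space.\<close>

definition test_functions :: "'a::euclidean_space set \<Rightarrow> ('a \<Rightarrow> real) set" where
  "test_functions \<Omega> =
     {f. (\<forall>k. Ck k f) \<and> (\<exists>K. compact K \<and> K \<subseteq> \<Omega> \<and> (\<forall>x. x \<notin> K \<longrightarrow> f x = 0))}"

definition grad :: "(real^'n \<Rightarrow> real) \<Rightarrow> real^'n \<Rightarrow> real^'n" where
  "grad f x = (\<chi> i. frechet_derivative f (at x) (axis i 1))"

section \<open>Fractional Sobolev spaces\<close>

text \<open>Squared norms take values in \<^typ>\<open>ennreal\<close>, so that finiteness and convergence are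
  meaningful without a separate integrability condition (a Bochner integral would be \<open>0\<close> for a
  function that is not integrable). Elements of \<open>L\<^sup>2\<close> and \<open>H\<^sup>s\<close> are represented by
  Lebesgue measurable functions, not by equivalence classes.\<close>

definition L2_sq :: "('a::euclidean_space \<Rightarrow> 'b::euclidean_space) \<Rightarrow> ennreal" where
  "L2_sq f = (\<integral>\<^sup>+x. ennreal ((norm (f x))\<^sup>2) \<partial>lebesgue)"

definition gagliardo_sq :: "real \<Rightarrow> ('a::euclidean_space \<Rightarrow> real) \<Rightarrow> ennreal" where
  "gagliardo_sq s u =
     (\<integral>\<^sup>+x. (\<integral>\<^sup>+y. ennreal (\<bar>u x - u y\<bar>\<^sup>2 / norm (x - y) powr (real DIM('a) + 2 * s)) \<partial>lebesgue) \<partial>lebesgue)"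

definition Hs :: "real \<Rightarrow> ('a::euclidean_space \<Rightarrow> real) set" where
  "Hs s = {u \<in> borel_measurable lebesgue. L2_sq u < \<infinity> \<and> gagliardo_sq s u < \<infinity>}"

definition Hs_Omega :: "real \<Rightarrow> 'a::euclidean_space set \<Rightarrow> ('a \<Rightarrow> real) set" where
  "Hs_Omega s \<Omega> = {u \<in> Hs s. AE x in lebesgue. x \<notin> \<Omega> \<longrightarrow> u x = 0}"

definition Hs_Omega_norm :: "real \<Rightarrow> ('a::euclidean_space \<Rightarrow> real) \<Rightarrow> real" where
  "Hs_Omega_norm s u = sqrt (enn2real (gagliardo_sq s u))"

text \<open>Convergence of a sequence from \<open>C\<^sub>c\<^sup>\<infinity>(\<Omega>)\<close> to \<open>u\<close> in the norm of \<open>H\<^sup>s\<close> on the whole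
  space. For bounded \<open>\<Omega>\<close> and \<open>u \<in> Hs_Omega s \<Omega>\<close> this is, by the fractional Poincare inequality,
  the same as convergence in \<^const>\<open>Hs_Omega_norm\<close>.\<close>

definition Hs_approx ::
  "real \<Rightarrow> 'a::euclidean_space set \<Rightarrow> (nat \<Rightarrow> 'a \<Rightarrow> real) \<Rightarrow> ('a \<Rightarrow> real) \<Rightarrow> bool" where
  "Hs_approx s \<Omega> \<phi> u \<longleftrightarrow> (\<forall>k. \<phi> k \<in> test_functions \<Omega>) \<and>
     (\<lambda>k. L2_sq (\<lambda>x. \<phi> k x - u x) + gagliardo_sq s (\<lambda>x. \<phi> k x - u x)) \<longlonglongrightarrow> 0"

section \<open>Constants\<close>

definition C_ns :: "nat \<Rightarrow> real \<Rightarrow> real" where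
  "C_ns n s = 4 powr s * Gamma (s + real n / 2) / (pi powr (real n / 2) * \<bar>Gamma (- s)\<bar>)"

text \<open>Surface measure on the unit sphere through polar coordinates: a set \<open>E\<close> has mass \<open>n\<close> times
  the Lebesgue measure of the cone \<open>{r \<theta> | 0 < r < 1, \<theta> \<in> E}\<close>. In dimension one this is the
  counting measure on \<open>{-1, 1}\<close>.\<close>

definition sphere_measure :: "'a::euclidean_space measure" where
  "sphere_measure =
     distr (density lborel (\<lambda>x. ennreal (real DIM('a)) * indicator (ball 0 1) x)) borel sgn"

text \<open>The index \<open>i\<close> is the coordinate that is called the first one; by rotation invariance the
  value does not depend on it.\<close>

definition C_omega :: "'n::finite \<Rightarrow> real \<Rightarrow> real" where
  "C_omega i s = s / (2 * Gamma (1 - s) * sin (pi * s / 2)) *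
     inverse (LINT \<theta>:{\<theta>::real^'n. \<theta> $ i \<ge> 0}|sphere_measure. \<bar>\<theta> $ i\<bar> powr (s + 1))"

section \<open>Tensors\<close>

definition elliptic :: "(real^'n \<Rightarrow> real^'n^'n) \<Rightarrow> bool" where
  "elliptic A \<longleftrightarrow> (\<exists>a b. 0 < a \<and> a \<le> b \<and>
     (\<forall>\<xi> x. a * (norm \<xi>)\<^sup>2 \<le> \<xi> \<bullet> (A x *v \<xi>) \<and> \<xi> \<bullet> (A x *v \<xi>) \<le> b * (norm \<xi>)\<^sup>2))"

text \<open>An infimum, since over the whole space the smallest eigenvalue need not be attained.\<close>

definition smallest_eigenvalue :: "(real^'n \<Rightarrow> real^'n^'n) \<Rightarrow> real" where
  "smallest_eigenvalue A = Inf {\<mu>. \<exists>x \<xi>. \<xi> \<noteq> 0 \<and> A x *v \<xi> = \<mu> *\<^sub>R \<xi>}"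

section \<open>The nonlocal gradient and diffusion form\<close>

definition nl_grad_smooth ::
  "('a \<Rightarrow> 'a \<Rightarrow> real) \<Rightarrow> ('a \<Rightarrow> 'a \<Rightarrow> 'a) \<Rightarrow> ('a::euclidean_space \<Rightarrow> real) \<Rightarrow> 'a \<Rightarrow> 'a" where
  "nl_grad_smooth \<omega> \<alpha> u x = (LINT y|lebesgue. (\<omega> x y * (u y - u x)) *\<^sub>R \<alpha> x y)"

text \<open>The \<open>L\<^sup>2\<close>-continuous extension from \<open>C\<^sub>c\<^sup>\<infinity>\<close> to \<open>H\<^sup>s\<close>, which determines \<open>g\<close> up to a null set.\<close>

definition nl_grad ::
  "real \<Rightarrow> ('a \<Rightarrow> 'a \<Rightarrow> real) \<Rightarrow> ('a \<Rightarrow> 'a \<Rightarrow> 'a) \<Rightarrow> ('a::euclidean_space \<Rightarrow> real) \<Rightarrow> 'a \<Rightarrow> 'a" where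
  "nl_grad s \<omega> \<alpha> u = (SOME g. g \<in> borel_measurable lebesgue \<and> L2_sq g < \<infinity> \<and>
     (\<exists>\<phi>. Hs_approx s UNIV \<phi> u \<and>
          (\<lambda>k. L2_sq (\<lambda>x. nl_grad_smooth \<omega> \<alpha> (\<phi> k) x - g x)) \<longlonglongrightarrow> 0))"

definition diffusion_form ::
  "real \<Rightarrow> (real^'n \<Rightarrow> real^'n \<Rightarrow> real) \<Rightarrow> (real^'n \<Rightarrow> real^'n \<Rightarrow> real^'n) \<Rightarrow>
   (real^'n \<Rightarrow> real^'n^'n) \<Rightarrow> (real^'n \<Rightarrow> real) \<Rightarrow> (real^'n \<Rightarrow> real) \<Rightarrow> real" where
  "diffusion_form s \<omega> \<alpha> A u w =
     (LINT x|lebesgue. nl_grad s \<omega> \<alpha> u x \<bullet> (A x *v nl_grad s \<omega> \<alpha> w x))"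

section \<open>Advection\<close>

text \<open>The divergence of an essentially bounded field is taken in the sense of distributions.\<close>

definition solenoidal :: "(real^'n) set \<Rightarrow> (real^'n \<Rightarrow> real^'n) \<Rightarrow> bool" where
  "solenoidal \<Omega> v \<longleftrightarrow> (\<forall>\<phi>\<in>test_functions \<Omega>. (LINT x|lebesgue_on \<Omega>. v x \<bullet> grad \<phi> x) = 0)"

definition advection_pairing ::
  "(real^'n) set \<Rightarrow> (real^'n \<Rightarrow> real^'n) \<Rightarrow> (real^'n \<Rightarrow> real) \<Rightarrow> (real^'n \<Rightarrow> real) \<Rightarrow> real" where
  "advection_pairing \<Omega> v u w = (LINT x|lebesgue_on \<Omega>. (v x \<bullet> grad u x) * w x)"

text \<open>\<open>adv\<close> is the extension by continuity of \<^const>\<open>advection_pairing\<close> from \<open>C\<^sub>c\<^sup>\<infinity>(\<Omega>)\<close> to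
  \<open>H\<^sup>s\<^sub>\<Omega>\<close>: every element of \<open>H\<^sup>s\<^sub>\<Omega>\<close> is a limit of test functions, and the pairings converge to
  \<open>adv u w\<close> along every choice of approximating sequences. On \<open>H\<^sup>s\<^sub>\<Omega>\<close> there is at most one
  such \<open>adv\<close>, and it is automatically bilinear and bounded.\<close>

definition duality_extension ::
  "real \<Rightarrow> (real^'n) set \<Rightarrow> (real^'n \<Rightarrow> real^'n) \<Rightarrow>
   ((real^'n \<Rightarrow> real) \<Rightarrow> (real^'n \<Rightarrow> real) \<Rightarrow> real) \<Rightarrow> bool" where
  "duality_extension s \<Omega> v adv \<longleftrightarrow>
     (\<forall>u\<in>Hs_Omega s \<Omega>. \<exists>\<phi>. Hs_approx s \<Omega> \<phi> u) \<and>
     (\<forall>u\<in>Hs_Omega s \<Omega>. \<forall>w\<in>Hs_Omega s \<Omega>. \<forall>\<phi> \<psi>.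
        Hs_approx s \<Omega> \<phi> u \<longrightarrow> Hs_approx s \<Omega> \<psi> w \<longrightarrow>
        (\<lambda>k. advection_pairing \<Omega> v (\<phi> k) (\<psi> k)) \<longlonglongrightarrow> adv u w)"

definition coercive_on :: "'f set \<Rightarrow> ('f \<Rightarrow> real) \<Rightarrow> ('f \<Rightarrow> 'f \<Rightarrow> real) \<Rightarrow> bool" where
  "coercive_on V nrm b \<longleftrightarrow> (\<exists>c>0. \<forall>u\<in>V. b u u \<ge> c * (nrm u)\<^sup>2)"

end

theory Submission
  imports Defs "HOL-Probability.Characteristic_Functions"
begin

text \<open>On the Fourier side the nonlocal gradient of a test function \<open>\<phi>\<close> is multiplication by
  \<open>- i |\<xi>|\<^sup>s\<^sup>-\<^sup>1 \<xi>\<close>, which is what the choice of \<open>C_omega\<close> achieves, while the Gagliardo seminorm is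
  \<open>2 / C_ns\<close> times the integral of \<open>|\<xi>|\<^sup>2\<^sup>s |fourier \<phi>|\<^sup>2\<close>. By Plancherel both quadratic forms agree up to the
  factor \<open>C_ns / 2\<close>. Both symbols are computed by writing a power of \<open>|z|\<close> as a Gamma integral of
  Gaussians. The identity extends to \<open>H\<^sup>s\<close> by mollification, and ellipticity turns it into the lower
  bound for the diffusion form. The advection term vanishes on the diagonal, because
  \<open>(v \<bullet> grad \<phi>) \<phi>\<close> is half of \<open>v \<bullet> grad (\<phi>\<^sup>2)\<close> and \<open>\<phi>\<^sup>2\<close> is a test function.\<close>

section \<open>Radial integrals and Gaussians\<close>

text \<open>\<open>nl_grad\<close> is a choice among the L^2 limits along approximating test
  functions. Hence a limit has to be constructed first, by approximation and completeness, and the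
  bound has to hold for whichever function was chosen; the energy identity for test functions serves
  both purposes. \<open>fourier\<close> is a pointwise integral, so the Fourier arguments take place
  among functions that are integrable and square integrable. Boundedness of \<Omega> puts the
  elements of \<open>Hs_Omega\<close> there. The approximants for the gradient live on the whole
  space, where mollification may enlarge the support, whereas approximation inside \<Omega> is a
  clause of \<open>duality_extension\<close> and enters through the advection term only. Since
  \<open>fourier\<close> is not normalized, both quadratic forms carry a power of
  \<open>2 * pi\<close> in the denominator, which cancels. The 2 in \<open>2 / C_ns\<close> comes
  from \<open>(norm (cis \<theta> - 1))\<^sup>2 = 2 * (1 - cos \<theta>)\<close>, the multiplier of
  a squared difference.\<close>

lemma nn_integral_lborel_affine:
  fixes f :: "'a::euclidean_space \<Rightarrow> ennreal"
  assumes [measurable]: "f \<in> borel_measurable borel" and c: "c \<noteq> 0"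
  shows "(\<integral>\<^sup>+x. f x \<partial>lborel) = ennreal (\<bar>c\<bar> ^ DIM('a)) * (\<integral>\<^sup>+x. f (t + c *\<^sub>R x) \<partial>lborel)"
  by (subst lborel_affine[OF c, of t])
     (simp add: nn_integral_density nn_integral_distr nn_integral_cmult)

lemma lborel_distr_reflect:
  fixes t :: "'a::euclidean_space"
  assumes "\<bar>c\<bar> = 1"
  shows "distr lborel borel (\<lambda>x. t + c *\<^sub>R x) = lborel"
  using lborel_affine[of c t] assms by (auto simp: density_1)

lemma integrable_lborel_translate_iff:
  fixes f :: "'a::euclidean_space \<Rightarrow> 'b::{banach, second_countable_topology}"
  assumes "f \<in> borel_measurable borel"
  shows "integrable lborel (\<lambda>x. f (x + t)) \<longleftrightarrow> integrable lborel f"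
  using integrable_distr_eq[of "\<lambda>x. t + 1 *\<^sub>R x" lborel borel f] assms lborel_distr_reflect[of 1 t]
  by (simp add: add.commute)

lemma integral_lborel_translate:
  fixes f :: "'a::euclidean_space \<Rightarrow> 'b::{banach, second_countable_topology}"
  assumes "f \<in> borel_measurable borel"
  shows "(LINT x|lborel. f (x + t)) = (LINT x|lborel. f x)"
  using integral_distr[of "\<lambda>x. t + 1 *\<^sub>R x" lborel borel f] assms lborel_distr_reflect[of 1 t]
  by (simp add: add.commute)

lemma integral_lborel_reflect:
  fixes f :: "'a::euclidean_space \<Rightarrow> 'b::{banach, second_countable_topology}"
  assumes "f \<in> borel_measurable borel"
  shows "(LINT x|lborel. f (t - x)) = (LINT x|lborel. f x)"
  using integral_distr[of "\<lambda>x. t + (-1) *\<^sub>R x" lborel borel f] assms lborel_distr_reflect[of "-1" t]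
  by simp

lemma nn_integral_lborel_translate:
  fixes f :: "'a::euclidean_space \<Rightarrow> ennreal"
  assumes "f \<in> borel_measurable borel"
  shows "(\<integral>\<^sup>+x. f (x + t) \<partial>lborel) = (\<integral>\<^sup>+x. f x \<partial>lborel)"
  using nn_integral_lborel_affine[OF assms, of 1 t] by (simp add: add.commute)

lemma nn_integral_lborel_reflect:
  fixes f :: "'a::euclidean_space \<Rightarrow> ennreal"
  assumes "f \<in> borel_measurable borel"
  shows "(\<integral>\<^sup>+x. f (t - x) \<partial>lborel) = (\<integral>\<^sup>+x. f x \<partial>lborel)"
  using nn_integral_lborel_affine[OF assms, of "-1" t] by simp

lemma integral_lborel_scale:
  fixes f :: "'a::euclidean_space \<Rightarrow> 'b::{banach, second_countable_topology}"
  assumes "f \<in> borel_measurable borel" "c \<noteq> 0"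
  shows "(LINT x|lborel. f x) = (\<bar>c\<bar> ^ DIM('a)) *\<^sub>R (LINT x|lborel. f (c *\<^sub>R x))"
proof -
  have "(LINT x|lborel. f x) = (LINT x|density (distr lborel borel (\<lambda>x. 0 + c *\<^sub>R x)) (\<lambda>_. ennreal (\<bar>c\<bar> ^ DIM('a))). f x)"
    by (rule arg_cong[where f="\<lambda>M. integral\<^sup>L M f", OF lborel_affine[OF assms(2)]])
  also have "\<dots> = (LINT x|lborel. (\<bar>c\<bar> ^ DIM('a)) *\<^sub>R f (c *\<^sub>R x))"
    using assms by (subst integral_density) (auto simp: integral_distr)
  finally show ?thesis by simp
qed

section \<open>Power integrals and radial change of variables\<close>

lemma nn_integral_powr_from_0:
  assumes "p > 0" "a \<ge> 0"
  shows "(\<integral>\<^sup>+t. ennreal (indicator {0<..a} t * t powr (p - 1)) \<partial>lborel) = ennreal (a powr p / p)"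
proof -
  have "((\<lambda>t. t powr (p - 1)) has_integral (a powr p / p)) {0..a}"
    using has_integral_powr_from_0[of "p - 1" a] assms by simp
  then have "(\<integral>\<^sup>+t. ennreal (indicator {0..a} t * t powr (p - 1)) \<partial>lborel) = ennreal (a powr p / p)"
    by (intro nn_integral_has_integral_lebesgue) auto
  moreover have "(\<integral>\<^sup>+t. ennreal (indicator {0<..a} t * t powr (p - 1)) \<partial>lborel)
     = (\<integral>\<^sup>+t. ennreal (indicator {0..a} t * t powr (p - 1)) \<partial>lborel)"
    using AE_lborel_singleton[of 0]
    by (intro nn_integral_cong_AE) (auto simp: indicator_def elim!: eventually_mono)
  ultimately show ?thesis by simp
qed

lemma nn_integral_powr_to_inf:
  assumes "p > 0" "a > 0"
  shows "(\<integral>\<^sup>+t. ennreal (indicator {a..} t * t powr (- p - 1)) \<partial>lborel) = ennreal (a powr (- p) / p)"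
proof -
  have "((\<lambda>t. t powr (- p - 1)) has_integral (a powr (- p) / p)) {a..}"
    using has_integral_powr_to_inf[of "- p - 1" a] assms by simp
  then show ?thesis
    by (intro nn_integral_has_integral_lebesgue) auto
qed

text \<open>Pushes a measure forward along a function whose sublevel sets have measure \<open>c * r\<^sup>p\<close>. With
  \<open>N = norm\<close> this is integration in polar coordinates; with \<open>N\<close> a power of \<open>t\<close> it replaces
  substitution on the half line.\<close>

lemma nn_integral_homogeneous:
  fixes N :: "'a \<Rightarrow> real"
  assumes N[measurable]: "N \<in> borel_measurable M" and h[measurable]: "h \<in> borel_measurable borel"
    and pos: "AE x in M. N x > 0" and p: "p > 0" "c \<ge> 0"
    and level: "\<And>r. r > 0 \<Longrightarrow> emeasure M {x \<in> space M. N x \<le> r} = ennreal (c * r powr p)"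
  shows "(\<integral>\<^sup>+x. h (N x) \<partial>M)
       = (\<integral>\<^sup>+r. h r * ennreal (indicator {0<..} r * (c * p * r powr (p - 1))) \<partial>lborel)"
proof -
  define D where "D = density lborel (\<lambda>r. ennreal (indicator {0<..} r * (c * p * r powr (p - 1))))"
  \<comment> \<open>The generating half lines include those with \<open>r \<le> 0\<close>, about
    which \<open>level\<close> is silent.\<close>
  have neg: "emeasure M {x \<in> space M. N x \<le> r} = 0" if "r \<le> 0" for r
  proof -
    have "AE x in M. x \<notin> {x \<in> space M. N x \<le> r}"
      using pos that by (auto elim!: eventually_mono)
    then show ?thesis by (subst AE_iff_measurable[symmetric]) auto
  qed
  have D: "emeasure D {..r} = (if r \<le> 0 then 0 else ennreal (c * r powr p))" for r :: real
  proof -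
    have "emeasure D {..r} = (\<integral>\<^sup>+t. ennreal (c * p) * ennreal (indicator {0<..r} t * t powr (p - 1)) \<partial>lborel)"
      unfolding D_def using p
      by (subst emeasure_density) (auto intro!: nn_integral_cong simp: indicator_def ennreal_mult''[symmetric] algebra_simps)
    also have "\<dots> = ennreal (c * p) * (\<integral>\<^sup>+t. ennreal (indicator {0<..r} t * t powr (p - 1)) \<partial>lborel)"
      by (rule nn_integral_cmult) auto
    also have "\<dots> = (if r \<le> 0 then 0 else ennreal (c * r powr p))"
    proof (cases "r \<le> 0")
      case True
      then have "{0<..r} = {}" by auto
      then show ?thesis using True by simp
    next
      case False
      then show ?thesis
        using p nn_integral_powr_from_0[of p r] by (simp add: ennreal_mult''[symmetric])
    qed
    finally show ?thesis .
  qed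
  \<comment> \<open>Half lines are closed under intersection and generate the Borel sets, so
    agreement on them determines a measure that is finite on each of them.\<close>
  have "distr M borel N = D"
  proof (rule measure_eqI_generator_eq[where E="range atMost" and A="\<lambda>i. {..real i}" and \<Omega>=UNIV])
    show "Int_stable (range (atMost :: real \<Rightarrow> _))" by (auto simp: Int_stable_def Int_atMost)
    show "sets (distr M borel N) = sigma_sets UNIV (range atMost)" "sets D = sigma_sets UNIV (range atMost)"
      by (simp_all add: D_def borel_eq_atMost)
    fix X :: "real set" assume "X \<in> range atMost"
    then obtain r where X: "X = {..r}" by auto
    have "emeasure (distr M borel N) X = emeasure M {x \<in> space M. N x \<le> r}"
      unfolding X by (subst emeasure_distr) (auto intro!: arg_cong[where f="emeasure M"])
    then show "emeasure (distr M borel N) X = emeasure D X"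
      using neg[of r] level[of r] by (simp add: X D)
  next
    show "(\<Union>i. {..real i}) = UNIV" by (auto simp: real_arch_simple)
    show "emeasure (distr M borel N) {..real i} \<noteq> \<infinity>" for i
    proof -
      have "emeasure (distr M borel N) {..real i} = emeasure M {x \<in> space M. N x \<le> real i}"
        by (subst emeasure_distr) (auto intro!: arg_cong[where f="emeasure M"])
      then show ?thesis using neg[of "real i"] level[of "real i"] by (cases "i = 0") auto
    qed
  qed auto
  then have "(\<integral>\<^sup>+x. h (N x) \<partial>M) = (\<integral>\<^sup>+r. h r \<partial>D)"
    by (subst nn_integral_distr[symmetric, of N M borel]) auto
  then show ?thesis
    unfolding D_def by (subst (asm) nn_integral_density) (auto simp: mult.commute)
qed

section \<open>Gamma integrals on the half line\<close>

lemma nn_integral_Gamma: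
  assumes a: "a > 0" and c: "c > (0::real)"
  shows "(\<integral>\<^sup>+t. ennreal (indicator {0<..} t * (t powr (a - 1) * exp (- c * t))) \<partial>lborel) = ennreal (Gamma a * c powr (- a))"
proof -
  have "(\<integral>\<^sup>+t. ennreal (indicator {0<..} t * (t powr (a - 1) / exp t)) \<partial>lborel)
     = (\<integral>\<^sup>+t. ennreal (indicator {0..} t * t powr (a - 1) / exp t) \<partial>lborel)"
    using AE_lborel_singleton[of 0]
    by (intro nn_integral_cong_AE) (auto simp: indicator_def elim!: eventually_mono)
  then have "ennreal (Gamma a) = (\<integral>\<^sup>+t. ennreal (indicator {0<..} t * (t powr (a - 1) / exp t)) \<partial>lborel)"
    using Gamma_conv_nn_integral_real[OF a] by simp
  also have "\<dots> = ennreal \<bar>c\<bar> * (\<integral>\<^sup>+t. ennreal (indicator {0<..} (0 + c * t) * ((0 + c * t) powr (a - 1) / exp (0 + c * t))) \<partial>lborel)"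
    using c by (intro nn_integral_real_affine) auto
  also have "\<dots> = ennreal c * (\<integral>\<^sup>+t. ennreal (c powr (a - 1)) * ennreal (indicator {0<..} t * (t powr (a - 1) * exp (- c * t))) \<partial>lborel)"
    using c by (intro arg_cong2[where f="(*)"] nn_integral_cong)
       (auto simp: indicator_def powr_mult exp_minus field_simps zero_less_mult_iff ennreal_mult''[symmetric])
  also have "\<dots> = ennreal (c powr a) * (\<integral>\<^sup>+t. ennreal (indicator {0<..} t * (t powr (a - 1) * exp (- c * t))) \<partial>lborel)"
    using c powr_add[of c 1 "a - 1"]
    by (subst nn_integral_cmult) (auto simp: mult.assoc[symmetric] ennreal_mult''[symmetric])
  finally have *: "ennreal (Gamma a) = ennreal (c powr a) * (\<integral>\<^sup>+t. ennreal (indicator {0<..} t * (t powr (a - 1) * exp (- c * t))) \<partial>lborel)" .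
  have "ennreal (c powr (- a)) * ennreal (Gamma a) = ennreal (c powr (- a)) * ennreal (c powr a) * (\<integral>\<^sup>+t. ennreal (indicator {0<..} t * (t powr (a - 1) * exp (- c * t))) \<partial>lborel)"
    unfolding * by (simp add: mult.assoc)
  also have "ennreal (c powr (- a)) * ennreal (c powr a) = 1"
    using c by (simp add: ennreal_mult''[symmetric] powr_add[symmetric])
  finally show ?thesis using a by (simp add: ennreal_mult''[symmetric] mult.commute)
qed

text \<open>This is \<open>nn_integral_Gamma\<close> under \<open>r = 1 / t\<close>. The
  substitution is \<open>nn_integral_homogeneous\<close> for \<open>N t = 1 / t\<close> and the
  density \<open>t powr (- a - 1)\<close>, which gives the half line from \<open>1 / r\<close> the
  mass \<open>r powr a / a\<close>.\<close>

lemma nn_integral_Gamma_inverse: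
  assumes a: "a > 0" and c: "c > (0::real)"
  shows "(\<integral>\<^sup>+t. ennreal (indicator {0<..} t * (t powr (- a - 1) * exp (- c / t))) \<partial>lborel) = ennreal (Gamma a * c powr (- a))"
proof -
  let ?M = "density lborel (\<lambda>t::real. ennreal (indicator {0<..} t * t powr (- a - 1)))"
  have "(\<integral>\<^sup>+t. ennreal (exp (- c * (1 / t))) \<partial>?M)
      = (\<integral>\<^sup>+r. ennreal (exp (- c * r)) * ennreal (indicator {0<..} r * (1 / a * a * r powr (a - 1))) \<partial>lborel)"
  proof (rule nn_integral_homogeneous)
    show "AE t in ?M. 1 / t > 0" by (subst AE_density) (auto simp: indicator_def)
    show "emeasure ?M {t \<in> space ?M. 1 / t \<le> r} = ennreal (1 / a * r powr a)" if "r > 0" for r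
    proof -
      have "emeasure ?M {t \<in> space ?M. 1 / t \<le> r} = (\<integral>\<^sup>+t. ennreal (indicator {1 / r..} t * t powr (- a - 1)) \<partial>lborel)"
      proof -
        have "1 / t \<le> r \<longleftrightarrow> 1 / r \<le> t" if "t > 0" for t
          using that \<open>r > 0\<close> by (simp add: field_simps)
        moreover have "t > 0" if "1 / r \<le> t" for t
          using that \<open>r > 0\<close> by (meson less_le_trans zero_less_divide_1_iff)
        ultimately show ?thesis
          by (subst emeasure_density) (auto intro!: nn_integral_cong simp: indicator_def)
      qed
      then show ?thesis using nn_integral_powr_to_inf[of a "1 / r"] a that
        by (simp add: powr_minus powr_divide)
    qed
  qed (use a in auto)
  also have "\<dots> = (\<integral>\<^sup>+t. ennreal (indicator {0<..} t * (t powr (a - 1) * exp (- c * t))) \<partial>lborel)"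
    using a by (intro nn_integral_cong) (simp add: ennreal_mult''[symmetric] mult_ac)
  also have "\<dots> = ennreal (Gamma a * c powr (- a))" by (rule nn_integral_Gamma[OF a c])
  finally show ?thesis
    by (subst (asm) nn_integral_density) (auto simp: ennreal_mult''[symmetric] mult_ac)
qed

text \<open>The substitution \<open>r = t\<^sup>2\<close>, again through
  \<open>nn_integral_homogeneous\<close>: the density \<open>t powr (p - 1)\<close> gives the
  interval up to \<open>sqrt r\<close> the mass \<open>r powr (p / 2) / p\<close>.\<close>

lemma nn_integral_powr_exp_square:
  assumes p: "p > 0"
  shows "(\<integral>\<^sup>+t. ennreal (indicator {0<..} t * (t powr (p - 1) * exp (- t\<^sup>2))) \<partial>lborel) = ennreal (Gamma (p / 2) / 2)"
proof -
  let ?M = "density lborel (\<lambda>t::real. ennreal (indicator {0<..} t * t powr (p - 1)))"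
  have "(\<integral>\<^sup>+t. ennreal (exp (- (t\<^sup>2))) \<partial>?M)
      = (\<integral>\<^sup>+r. ennreal (exp (- r)) * ennreal (indicator {0<..} r * (1 / p * (p / 2) * r powr (p / 2 - 1))) \<partial>lborel)"
  proof (rule nn_integral_homogeneous)
    show "AE t in ?M. t\<^sup>2 > 0" by (subst AE_density) (auto simp: indicator_def)
    show "emeasure ?M {t \<in> space ?M. t\<^sup>2 \<le> r} = ennreal (1 / p * r powr (p / 2))" if "r > 0" for r
    proof -
      have "emeasure ?M {t \<in> space ?M. t\<^sup>2 \<le> r} = (\<integral>\<^sup>+t. ennreal (indicator {0<..sqrt r} t * t powr (p - 1)) \<partial>lborel)"
      proof -
        have "t\<^sup>2 \<le> r \<longleftrightarrow> t \<le> sqrt r" if "t > 0" for t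
          using that \<open>r > 0\<close> by (metis abs_of_pos real_sqrt_abs real_sqrt_le_iff)
        then show ?thesis
          by (subst emeasure_density) (auto intro!: nn_integral_cong simp: indicator_def)
      qed
      then show ?thesis using nn_integral_powr_from_0[of p "sqrt r"] p that
        by (simp add: powr_half_sqrt[symmetric] powr_powr)
    qed
  qed (use p in auto)
  also have "\<dots> = (\<integral>\<^sup>+t. ennreal (1 / 2) * ennreal (indicator {0<..} t * (t powr (p / 2 - 1) * exp (- 1 * t))) \<partial>lborel)"
    using p by (intro nn_integral_cong) (subst (1 2) ennreal_mult''[symmetric], auto simp: mult_ac)
  also have "\<dots> = ennreal (1 / 2) * ennreal (Gamma (p / 2) * 1 powr (- (p / 2)))"
    using nn_integral_Gamma[of "p / 2" 1] p by (subst nn_integral_cmult) auto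
  also have "\<dots> = ennreal (Gamma (p / 2) / 2)"
    using p by (subst ennreal_mult''[symmetric]) auto
  finally show ?thesis
    by (subst (asm) nn_integral_density) (auto simp: ennreal_mult''[symmetric] mult_ac)
qed

section \<open>Gaussian integrals against a character\<close>

lemma borel_measurable_cis [measurable (raw)]:
  assumes "f \<in> borel_measurable M"
  shows "(\<lambda>x. cis (f x)) \<in> borel_measurable M"
  by (rule measurable_compose[OF assms borel_measurable_continuous_onI]) (auto intro!: continuous_intros)

lemma has_bochner_integral_gaussian:
  fixes t a :: real
  assumes t: "t > 0"
  shows "has_bochner_integral lborel (\<lambda>x. exp (- t * x\<^sup>2) *\<^sub>R cis (a * x))
           (of_real (sqrt (pi / t) * exp (- a\<^sup>2 / (4 * t))))"
proof -
  \<comment> \<open>Replacing \<open>x\<close> by \<open>c * x\<close> turns the exponent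
    \<open>x\<^sup>2 / 2\<close> of the standard normal density into \<open>t * x\<^sup>2\<close>,
    so the value is its characteristic function at \<open>a / c\<close>, up to scaling.\<close>
  define c where "c = sqrt (2 * t)"
  have c: "c > 0" "c\<^sup>2 = 2 * t" using t by (auto simp: c_def)
  have 1: "integrable lborel (\<lambda>x. std_normal_density x *\<^sub>R iexp (a / c * x))"
    using integrable_std_normal_moment[of 0]
    by (rule Bochner_Integration.integrable_bound) (auto simp: norm_mult)
  have "char std_normal_distribution (a / c) = (LINT x|lborel. std_normal_density x *\<^sub>R iexp (a / c * x))"
    unfolding char_def by (subst integral_density) auto
  then have "has_bochner_integral lborel (\<lambda>x. std_normal_density x *\<^sub>R iexp (a / c * x)) (of_real (exp (- (a / c)\<^sup>2 / 2)))"
    using 1 by (simp add: has_bochner_integral_iff char_std_normal_distribution)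
  then have "has_bochner_integral lborel (\<lambda>x. std_normal_density (0 + c * x) *\<^sub>R iexp (a / c * (0 + c * x)))
     (of_real (exp (- (a / c)\<^sup>2 / 2)) /\<^sub>R \<bar>c\<bar>)"
    using c by (subst (asm) lborel_has_bochner_integral_real_affine_iff[where c=c and t=0]) auto
  then have "has_bochner_integral lborel (\<lambda>x. sqrt (2 * pi) *\<^sub>R (std_normal_density (0 + c * x) *\<^sub>R iexp (a / c * (0 + c * x))))
     (sqrt (2 * pi) *\<^sub>R (of_real (exp (- (a / c)\<^sup>2 / 2)) /\<^sub>R \<bar>c\<bar>))"
    by (rule has_bochner_integral_scaleR_right)
  moreover have "sqrt (2 * pi) *\<^sub>R (std_normal_density (0 + c * x) *\<^sub>R iexp (a / c * (0 + c * x)))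
      = exp (- t * x\<^sup>2) *\<^sub>R cis (a * x)" for x
    using c by (simp add: std_normal_density_def cis_conv_exp power_mult_distrib)
  moreover have "sqrt (2 * pi) *\<^sub>R (of_real (exp (- (a / c)\<^sup>2 / 2)) /\<^sub>R \<bar>c\<bar>)
      = complex_of_real (sqrt (pi / t) * exp (- a\<^sup>2 / (4 * t)))"
    using c t by (simp add: scaleR_conv_of_real power_divide c_def real_sqrt_mult real_sqrt_divide)
      (simp add: field_simps)
  ultimately show ?thesis by simp
qed

text \<open>Integration by parts: the derivative of \<open>?F\<close> is \<open>- 2 * t\<close>
  times \<open>?G\<close> plus \<open>\<i> * a\<close> times \<open>?F\<close>, and its integral
  vanishes because \<open>?F\<close> does at both ends of the line. This expresses the first moment
  by the integral of \<open>has_bochner_integral_gaussian\<close>.\<close>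

lemma has_bochner_integral_gaussian_moment:
  fixes t a :: real
  assumes t: "t > 0"
  shows "has_bochner_integral lborel (\<lambda>x. (x * exp (- t * x\<^sup>2)) *\<^sub>R cis (a * x))
           (\<i> * of_real (a / (2 * t) * (sqrt (pi / t) * exp (- a\<^sup>2 / (4 * t)))))"
proof -
  define c where "c = sqrt (2 * t)"
  have c: "c > 0" "c\<^sup>2 = 2 * t" using t by (auto simp: c_def)
  define I where "I = complex_of_real (sqrt (pi / t) * exp (- a\<^sup>2 / (4 * t)))"
  let ?F = "\<lambda>x. exp (- t * x\<^sup>2) *\<^sub>R cis (a * x)" and ?G = "\<lambda>x. (x * exp (- t * x\<^sup>2)) *\<^sub>R cis (a * x)"
  have F: "has_bochner_integral lborel ?F I"
    unfolding I_def by (rule has_bochner_integral_gaussian[OF t])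
  have "integrable lborel (\<lambda>x. std_normal_density (0 + c * x) * (0 + c * x) ^ 1)"
    using lborel_integrable_real_affine[OF integrable_std_normal_moment[of 1], of c 0] c by simp
  then have "integrable lborel (\<lambda>x. (sqrt (2 * pi) / c) * (std_normal_density (0 + c * x) * (0 + c * x) ^ 1))"
    by (rule integrable_mult_right)
  moreover have "(sqrt (2 * pi) / c) * (std_normal_density (0 + c * x) * (0 + c * x) ^ 1) = x * exp (- t * x\<^sup>2)" for x
    using c by (simp add: std_normal_density_def power_mult_distrib)
  ultimately have "integrable lborel (\<lambda>x. x * exp (- t * x\<^sup>2))" by simp
  then have G: "integrable lborel ?G"
    by (rule Bochner_Integration.integrable_bound) (auto simp: norm_mult)
  let ?D = "\<lambda>x. (- 2 * t) *\<^sub>R ?G x + (\<i> * of_real a) * ?F x"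
  have D: "integrable lborel ?D"
    by (intro Bochner_Integration.integrable_add integrable_scaleR_right integrable_mult_right G integrable.intros[OF F])
  have lim: "((\<lambda>x. exp (- t * x\<^sup>2) *\<^sub>R cis (a * x)) \<longlongrightarrow> 0) F" if "F = at_top \<or> F = at_bot" for F
  proof (rule tendsto_norm_zero_cancel)
    have "((\<lambda>x. exp (- t * x\<^sup>2)) \<longlongrightarrow> 0) F"
      using that t by (elim disjE; hypsubst) real_asymp+
    then show "((\<lambda>x. norm (exp (- t * x\<^sup>2) *\<^sub>R cis (a * x))) \<longlongrightarrow> 0) F" by simp
  qed
  have "(LBINT x=-\<infinity>..\<infinity>. ?D x) = 0 - 0"
  proof (rule interval_integral_FTC_integrable[where F="?F"])
    show "(?F has_vector_derivative ?D x) (at x)" for x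
    proof -
      \<comment> \<open>The product is a single exponential of a complex quadratic, so its
        derivative along the reals is that of a holomorphic function.\<close>
      let ?E = "\<lambda>z::complex. exp (- of_real t * z\<^sup>2 + \<i> * of_real a * z)"
      have E: "?F = (\<lambda>x. ?E (of_real x))"
        by (simp add: fun_eq_iff cis_conv_exp scaleR_conv_of_real exp_of_real[symmetric] mult_ac flip: exp_add)
      have "(?E has_field_derivative ?E (of_real x) * (- of_real t * (2 * of_real x) + \<i> * of_real a)) (at (of_real x))"
        by (auto intro!: derivative_eq_intros)
      then have "((\<lambda>x. ?E (of_real x)) has_vector_derivative ?E (of_real x) * (- of_real t * (2 * of_real x) + \<i> * of_real a)) (at x)"
        by (rule has_vector_derivative_real_field)
      moreover have "?D x = ?E (of_real x) * (- of_real t * (2 * of_real x) + \<i> * of_real a)"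
      proof -
        have "?D x = (- 2 * t) *\<^sub>R (of_real x * ?F x) + (\<i> * of_real a) * ?F x"
          by (simp add: scaleR_conv_of_real)
        also have "\<dots> = (- 2 * t) *\<^sub>R (of_real x * ?E (of_real x)) + (\<i> * of_real a) * ?E (of_real x)"
          by (subst (1 2) fun_cong[OF E, of x]) simp
        finally show ?thesis by (simp add: scaleR_conv_of_real algebra_simps)
      qed
      ultimately show ?thesis using E by simp
    qed
    show "((?F \<circ> real_of_ereal) \<longlongrightarrow> 0) (at_right (- \<infinity>))" "((?F \<circ> real_of_ereal) \<longlongrightarrow> 0) (at_left \<infinity>)"
      unfolding ereal_tendsto_simps using lim by blast+
    show "isCont ?D x" for x
    proof -
      have "continuous_on UNIV ?D" by (intro continuous_intros)
      then show ?thesis by (simp only: continuous_on_eq_continuous_at open_UNIV) blast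
    qed
    show "set_integrable lborel (einterval (- \<infinity>) \<infinity>) ?D"
      using D by (simp add: set_integrable_def einterval_def)
  qed simp
  then have "0 = (LINT x|lborel. ?D x)"
    by (simp add: interval_lebesgue_integral_def set_lebesgue_integral_def einterval_def)
  also have "\<dots> = (- 2 * t) *\<^sub>R (LINT x|lborel. ?G x) + (\<i> * of_real a) * (LINT x|lborel. ?F x)"
    apply (subst Bochner_Integration.integral_add)
      apply (rule integrable_scaleR_right, rule G)
     apply (rule integrable_mult_right, rule integrable.intros[OF F])
    apply (simp only: integral_scaleR_right integral_mult_right_zero)
    done
  also have "(LINT x|lborel. ?F x) = I"
    using F by (simp add: has_bochner_integral_iff)
  finally have "(LINT x|lborel. ?G x) = \<i> * of_real (a / (2 * t)) * I"
    using t by (simp add: scaleR_conv_of_real field_simps)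
  with G show ?thesis
    by (simp add: has_bochner_integral_iff I_def)
qed

lemma has_bochner_integral_lborel_prod:
  fixes f :: "'a::euclidean_space \<Rightarrow> real \<Rightarrow> 'b::{real_normed_field,banach,second_countable_topology}"
  assumes "\<And>b. b \<in> Basis \<Longrightarrow> has_bochner_integral lborel (f b) (I b)"
  shows "has_bochner_integral lborel (\<lambda>x::'a. \<Prod>b\<in>Basis. f b (x \<bullet> b)) (\<Prod>b\<in>Basis. I b)"
proof -
  interpret product_sigma_finite "\<lambda>_::'a. lborel :: real measure"
    by standard
  have f: "integrable lborel (f b)" "integral\<^sup>L lborel (f b) = I b" if "b \<in> Basis" for b
    using assms[OF that] by (auto simp: has_bochner_integral_iff)
  have [measurable]: "f b \<in> borel_measurable borel" if "b \<in> Basis" for b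
    using borel_measurable_integrable[OF f(1)[OF that]] by simp
  have eq: "(\<Prod>b\<in>Basis. f b ((\<Sum>c\<in>Basis. g c *\<^sub>R c) \<bullet> b)) = (\<Prod>b\<in>Basis. f b (g b))" for g :: "'a \<Rightarrow> real"
    by (intro prod.cong refl) simp
  have [measurable]: "(\<lambda>x::'a. \<Prod>b\<in>Basis. f b (x \<bullet> b)) \<in> borel_measurable borel"
    by measurable
  have "has_bochner_integral (\<Pi>\<^sub>M b\<in>Basis. lborel) (\<lambda>g. \<Prod>b\<in>Basis. f b (g b)) (\<Prod>b\<in>Basis. I b)"
    using product_integrable_prod[of Basis f] product_integral_prod[of Basis f] f
    by (simp add: has_bochner_integral_iff)
  then show ?thesis
    unfolding has_bochner_integral_iff
    by (subst (1 2) lborel_eq) (simp add: integrable_distr_eq integral_distr eq)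
qed

lemma norm_sq_eq_sum_Basis: "(norm (x::'a::euclidean_space))\<^sup>2 = (\<Sum>b\<in>Basis. (x \<bullet> b)\<^sup>2)"
  unfolding power2_norm_eq_inner by (subst euclidean_inner) (simp add: power2_eq_square)

lemma gaussian_prod:
  fixes x \<xi> :: "'a::euclidean_space"
  shows "(\<Prod>b\<in>Basis. exp (- t * (x \<bullet> b)\<^sup>2) *\<^sub>R cis ((\<xi> \<bullet> b) * (x \<bullet> b))) = exp (- t * (norm x)\<^sup>2) *\<^sub>R cis (\<xi> \<bullet> x)"
proof -
  have "(\<Prod>b\<in>Basis. exp (- t * (x \<bullet> b)\<^sup>2)) = exp (- t * (norm x)\<^sup>2)"
    by (simp add: exp_sum[symmetric] norm_sq_eq_sum_Basis sum_distrib_left flip: sum_negf)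
  moreover have "(\<Prod>b\<in>Basis. cis ((\<xi> \<bullet> b) * (x \<bullet> b))) = cis (\<xi> \<bullet> x)"
    by (simp add: cis_conv_exp exp_sum[symmetric] sum_distrib_left[symmetric] euclidean_inner[of \<xi> x])
  ultimately show ?thesis
    by (simp add: scaleR_conv_of_real prod.distrib flip: of_real_prod)
qed

lemma gaussian_prod_real:
  fixes \<xi> :: "'a::euclidean_space"
  assumes "t > 0"
  shows "(\<Prod>b\<in>Basis. sqrt (pi / t) * exp (- (\<xi> \<bullet> b)\<^sup>2 / (4 * t)))
     = (pi / t) powr (DIM('a) / 2) * exp (- (norm \<xi>)\<^sup>2 / (4 * t))"
proof -
  have "(\<Prod>b\<in>(Basis::'a set). sqrt (pi / t)) = (pi / t) powr (DIM('a) / 2)"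
    using assms by (simp add: powr_half_sqrt[symmetric] powr_powr flip: powr_realpow)
  moreover have "(\<Prod>b\<in>Basis. exp (- (\<xi> \<bullet> b)\<^sup>2 / (4 * t))) = exp (- (norm \<xi>)\<^sup>2 / (4 * t))"
    by (simp add: exp_sum[symmetric] norm_sq_eq_sum_Basis sum_divide_distrib flip: sum_negf)
  ultimately show ?thesis by (simp add: prod.distrib)
qed

lemma has_bochner_integral_gaussian_euclidean:
  fixes \<xi> :: "'a::euclidean_space"
  assumes t: "t > 0"
  shows "has_bochner_integral lborel (\<lambda>x. exp (- t * (norm x)\<^sup>2) *\<^sub>R cis (\<xi> \<bullet> x))
           (of_real ((pi / t) powr (DIM('a) / 2) * exp (- (norm \<xi>)\<^sup>2 / (4 * t))))"
  using has_bochner_integral_lborel_prod[OF has_bochner_integral_gaussian[OF t], of "\<lambda>b. \<xi> \<bullet> b"]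
  unfolding gaussian_prod of_real_prod[symmetric] gaussian_prod_real[OF t] .

lemma has_bochner_integral_gaussian_moment_euclidean:
  fixes \<xi> b :: "'a::euclidean_space"
  assumes t: "t > 0" and b: "b \<in> Basis"
  shows "has_bochner_integral lborel (\<lambda>x. ((x \<bullet> b) * exp (- t * (norm x)\<^sup>2)) *\<^sub>R cis (\<xi> \<bullet> x))
           (\<i> * of_real ((\<xi> \<bullet> b) / (2 * t) * ((pi / t) powr (DIM('a) / 2) * exp (- (norm \<xi>)\<^sup>2 / (4 * t)))))"
proof -
  let ?f = "\<lambda>b x. exp (- t * x\<^sup>2) *\<^sub>R cis (\<xi> \<bullet> b * x)"
  let ?J = "\<lambda>b. complex_of_real (sqrt (pi / t) * exp (- (\<xi> \<bullet> b)\<^sup>2 / (4 * t)))"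
  \<comment> \<open>Only the factor of direction \<open>b\<close> carries a moment; the other
    coordinates keep the plain Gaussian, so both the integrand and the value change by one scalar
    factor.\<close>
  define f where "f c x = (if c = b then of_real x * ?f c x else ?f c x)" for c x
  define I where "I c = (if c = b then \<i> * of_real ((\<xi> \<bullet> c) / (2 * t)) * ?J c else ?J c)" for c
  have "has_bochner_integral lborel (f c) (I c)" for c
    using has_bochner_integral_gaussian[OF t, of "\<xi> \<bullet> c"] has_bochner_integral_gaussian_moment[OF t, of "\<xi> \<bullet> c"]
    by (auto simp: f_def[abs_def] I_def scaleR_conv_of_real mult_ac)
  then have *: "has_bochner_integral lborel (\<lambda>x. \<Prod>b\<in>Basis. f b (x \<bullet> b)) (\<Prod>b\<in>Basis. I b)"
    by (rule has_bochner_integral_lborel_prod)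
  have "(\<Prod>c\<in>Basis. f c (x \<bullet> c)) = of_real (x \<bullet> b) * (\<Prod>c\<in>Basis. ?f c (x \<bullet> c))" for x
    using b by (subst (1 2) prod.remove[of _ b]) (auto simp: f_def intro!: prod.cong)
  moreover have "(\<Prod>c\<in>Basis. I c) = \<i> * of_real ((\<xi> \<bullet> b) / (2 * t)) * (\<Prod>c\<in>Basis. ?J c)"
    using b by (subst (1 2) prod.remove[of _ b]) (auto simp: I_def intro!: prod.cong)
  ultimately show ?thesis
    using * unfolding gaussian_prod of_real_prod[symmetric] gaussian_prod_real[OF t]
    by (simp add: scaleR_conv_of_real mult_ac)
qed

lemma nn_integral_powr_exp_square_abs:
  assumes "p > 0"
  shows "(\<integral>\<^sup>+x. ennreal (\<bar>x\<bar> powr (p - 1) * exp (- x\<^sup>2)) \<partial>lborel) = ennreal (Gamma (p / 2))"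
proof -
  let ?g = "\<lambda>x::real. ennreal (indicator {0<..} x * (x powr (p - 1) * exp (- x\<^sup>2)))"
  have "(\<integral>\<^sup>+x. ennreal (\<bar>x\<bar> powr (p - 1) * exp (- x\<^sup>2)) \<partial>lborel) = (\<integral>\<^sup>+x. ?g x + ?g (0 - x) \<partial>lborel)"
    using AE_lborel_singleton[of 0]
    by (intro nn_integral_cong_AE) (auto simp: indicator_def elim!: eventually_mono)
  also have "\<dots> = (\<integral>\<^sup>+x. ?g x \<partial>lborel) + (\<integral>\<^sup>+x. ?g (0 - x) \<partial>lborel)"
    by (rule nn_integral_add) auto
  also have "(\<integral>\<^sup>+x. ?g (0 - x) \<partial>lborel) = (\<integral>\<^sup>+x. ?g x \<partial>lborel)"
    by (rule nn_integral_lborel_reflect) auto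
  finally show ?thesis
    unfolding nn_integral_powr_exp_square[OF assms] using assms by (simp add: ennreal_plus[symmetric] del: ennreal_plus)
qed

text \<open>The Cartesian side of a computation done twice:
  \<open>nn_integral_ball_sgn_component\<close> evaluates the same integral in polar coordinates and
  reads off a moment of the unit sphere. Here the integrand factorizes over the coordinates.\<close>

lemma nn_integral_powr_component_gaussian:
  fixes b :: "'a::euclidean_space"
  assumes b: "b \<in> Basis" and p: "p > 0"
  shows "(\<integral>\<^sup>+x. ennreal (\<bar>x \<bullet> b\<bar> powr (p - 1) * exp (- (norm x)\<^sup>2)) \<partial>lborel)
     = ennreal (Gamma (p / 2) * pi powr ((DIM('a) - 1) / 2))"
proof -
  define f :: "'a \<Rightarrow> real \<Rightarrow> ennreal" where "f c x = ennreal (if c = b then \<bar>x\<bar> powr (p - 1) * exp (- x\<^sup>2) else exp (- x\<^sup>2))" for c x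
  have "(\<integral>\<^sup>+x. f c x \<partial>lborel) = ennreal (if c = b then Gamma (p / 2) else sqrt pi)" for c
  proof (cases "c = b")
    case True
    then show ?thesis using nn_integral_powr_exp_square_abs[OF p] by (simp add: f_def)
  next
    case False
    have "(\<integral>\<^sup>+x. ennreal (exp (- x\<^sup>2)) \<partial>lborel) = (\<integral>\<^sup>+x. ennreal (\<bar>x\<bar> powr (1 - 1) * exp (- x\<^sup>2)) \<partial>lborel)"
      \<comment> \<open>\<open>0 powr 0\<close> is 0 and not 1, hence the equality holds only almost
        everywhere.\<close>
      using AE_lborel_singleton[of 0]
      by (intro nn_integral_cong_AE) (auto elim!: eventually_mono)
    also have "\<dots> = ennreal (sqrt pi)"
      using nn_integral_powr_exp_square_abs[of 1] by (simp add: Gamma_one_half_real)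
    finally show ?thesis using False by (simp add: f_def)
  qed
  moreover have "(\<integral>\<^sup>+x. (\<Prod>c\<in>Basis. f c (x \<bullet> c)) \<partial>lborel) = (\<Prod>c\<in>Basis. (\<integral>\<^sup>+x. f c x \<partial>lborel))"
    by (rule nn_integral_lborel_prod) (auto simp: f_def)
  ultimately have "(\<integral>\<^sup>+x. (\<Prod>c\<in>Basis. f c (x \<bullet> c)) \<partial>lborel) = ennreal (\<Prod>c\<in>(Basis::'a set). (if c = b then Gamma (p / 2) else sqrt pi))"
    using p by (simp add: prod_ennreal)
  also have "(\<Prod>c\<in>(Basis::'a set). (if c = b then Gamma (p / 2) else sqrt pi)) = Gamma (p / 2) * sqrt pi ^ (DIM('a) - 1)"
    using b by (subst prod.remove[of _ b]) (auto simp: card_Diff_singleton_if)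
  also have "sqrt pi ^ (DIM('a) - 1) = pi powr ((DIM('a) - 1) / 2)"
    by (simp add: powr_half_sqrt[symmetric] powr_powr flip: powr_realpow)
  also have "(\<lambda>x. \<Prod>c\<in>Basis. f c (x \<bullet> c)) = (\<lambda>x. ennreal (\<bar>x \<bullet> b\<bar> powr (p - 1) * exp (- (norm x)\<^sup>2)))"
  proof
    fix x :: 'a
    have "(\<Prod>c\<in>Basis. exp (- (x \<bullet> c)\<^sup>2)) = exp (- (norm x)\<^sup>2)"
      by (simp add: exp_sum[symmetric] norm_sq_eq_sum_Basis flip: sum_negf)
    moreover have "(\<Prod>c\<in>Basis. f c (x \<bullet> c)) = ennreal (\<bar>x \<bullet> b\<bar> powr (p - 1) * (\<Prod>c\<in>Basis. exp (- (x \<bullet> c)\<^sup>2)))"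
      using b by (subst (1 2) prod.remove[of _ b]) (auto simp: f_def prod_ennreal ennreal_mult''[symmetric] mult_ac prod_nonneg intro!: prod.cong)
    ultimately show "(\<Prod>c\<in>Basis. f c (x \<bullet> c)) = ennreal (\<bar>x \<bullet> b\<bar> powr (p - 1) * exp (- (norm x)\<^sup>2))" by simp
  qed
  finally show ?thesis using b by (simp add: DIM_ge_Suc0 of_nat_diff)
qed

section \<open>Plancherel's theorem\<close>

lemma ennreal_square_add_le: "ennreal ((a + b)\<^sup>2) \<le> 2 * ennreal (a\<^sup>2) + 2 * ennreal (b\<^sup>2)"
proof -
  have "(a + b)\<^sup>2 \<le> 2 * a\<^sup>2 + 2 * b\<^sup>2"
    using sum_squares_bound[of a b] by (simp add: power2_sum)
  then have "ennreal ((a + b)\<^sup>2) \<le> ennreal (2 * a\<^sup>2 + 2 * b\<^sup>2)" by (rule ennreal_leI)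
  then show ?thesis by (simp add: ennreal_plus ennreal_mult)
qed

lemma L2_add_le:
  fixes f g :: "'a \<Rightarrow> real"
  assumes [measurable]: "f \<in> borel_measurable M" "g \<in> borel_measurable M"
  shows "(\<integral>\<^sup>+x. ennreal ((f x + g x)\<^sup>2) \<partial>M) \<le> 2 * (\<integral>\<^sup>+x. ennreal ((f x)\<^sup>2) \<partial>M) + 2 * (\<integral>\<^sup>+x. ennreal ((g x)\<^sup>2) \<partial>M)"
proof -
  have "(\<integral>\<^sup>+x. ennreal ((f x + g x)\<^sup>2) \<partial>M) \<le> (\<integral>\<^sup>+x. 2 * ennreal ((f x)\<^sup>2) + 2 * ennreal ((g x)\<^sup>2) \<partial>M)"
    by (intro nn_integral_mono ennreal_square_add_le)
  also have "\<dots> = 2 * (\<integral>\<^sup>+x. ennreal ((f x)\<^sup>2) \<partial>M) + 2 * (\<integral>\<^sup>+x. ennreal ((g x)\<^sup>2) \<partial>M)"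
    by (subst nn_integral_add) (auto simp: nn_integral_cmult)
  finally show ?thesis .
qed

lemma nn_integral_cball_const_less_top:
  fixes C R :: real
  shows "(\<integral>\<^sup>+x. ennreal (C * indicator (cball (0::'a::euclidean_space) R) x) \<partial>lborel) < \<infinity>"
proof -
  have "(\<integral>\<^sup>+x. ennreal (C * indicator (cball (0::'a) R) x) \<partial>lborel) = (\<integral>\<^sup>+x. ennreal C * indicator (cball (0::'a) R) x \<partial>lborel)"
    by (intro nn_integral_cong) (auto simp: indicator_def)
  also have "\<dots> = ennreal C * emeasure lborel (cball (0::'a) R)"
    by (subst nn_integral_cmult_indicator) auto
  also have "\<dots> < \<infinity>"
    using emeasure_lborel_cball_finite[of "0::'a" R] by (simp add: ennreal_mult_less_top)
  finally show ?thesis .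
qed

definition clamp_real :: "real \<Rightarrow> real \<Rightarrow> real" where
  "clamp_real k y = max (- k) (min k y)"

lemma clamp_real_bound: "k \<ge> 0 \<Longrightarrow> \<bar>clamp_real k y\<bar> \<le> k"
  and abs_clamp_real_diff_le: "k \<ge> 0 \<Longrightarrow> \<bar>y - clamp_real k y\<bar> \<le> \<bar>y\<bar>"
  and clamp_real_eq: "\<bar>y\<bar> \<le> k \<Longrightarrow> clamp_real k y = y"
  by (simp_all add: clamp_real_def max_def min_def abs_real_def split: if_splits)

text \<open>Two dominated convergences. First \<open>f\<close> is clamped in value and restricted to
  a ball. The result is then replaced by continuous functions converging to it almost everywhere,
  which are clamped and cut off in turn, so that one bounded function of compact support dominates
  them.\<close>

lemma ex_continuous_L2_approx:
  fixes f :: "'a::euclidean_space \<Rightarrow> real"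
  assumes f[measurable]: "f \<in> borel_measurable borel" and L2: "(\<integral>\<^sup>+x. ennreal ((f x)\<^sup>2) \<partial>lborel) < \<infinity>"
    and e: "(e::ennreal) > 0"
  obtains g R where "continuous_on UNIV g" "\<And>x. norm x > R \<Longrightarrow> g x = 0"
    "(\<integral>\<^sup>+x. ennreal ((f x - g x)\<^sup>2) \<partial>lborel) < e"
proof -
  define c where "c k = clamp_real (real k)" for k
  define F where "F k x = c k (f x) * indicator (ball 0 (real k)) x" for k x
  have [measurable]: "c k \<in> borel_measurable borel" for k
    unfolding c_def clamp_real_def[abs_def] by measurable
  have F[measurable]: "F k \<in> borel_measurable borel" for k
    unfolding F_def[abs_def] by (intro borel_measurable_times borel_measurable_indicator measurable_compose[OF f]) auto
  \<comment> \<open>\<open>L2_add_le\<close> doubles each of the two errors, so each gets a quarter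
    of \<open>e\<close>.\<close>
  have e4: "e / 4 > 0" using e by (simp add: ennreal_zero_less_divide)
  have "(\<lambda>k. \<integral>\<^sup>+x. ennreal ((f x - F k x)\<^sup>2) \<partial>lborel) \<longlonglongrightarrow> (\<integral>\<^sup>+x. 0 \<partial>(lborel::'a measure))"
  proof (rule nn_integral_dominated_convergence[where w="\<lambda>x. ennreal ((f x)\<^sup>2)"])
    have "\<bar>f x - F k x\<bar> \<le> \<bar>f x\<bar>" for k x
      unfolding F_def c_def using abs_clamp_real_diff_le[of "real k" "f x"] by (auto simp: indicator_def)
    then show "AE x in lborel. ennreal ((f x - F k x)\<^sup>2) \<le> ennreal ((f x)\<^sup>2)" for k
      by (intro AE_I2 ennreal_leI) (simp add: abs_le_square_iff)
    have "(\<lambda>k. ennreal ((f x - F k x)\<^sup>2)) \<longlonglongrightarrow> 0" for x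
    proof (rule tendsto_eventually)
      obtain n where n: "max \<bar>f x\<bar> (norm x) < real n" using reals_Archimedean2 by blast
      show "eventually (\<lambda>k. ennreal ((f x - F k x)\<^sup>2) = 0) sequentially"
        using eventually_ge_at_top[of n]
      proof eventually_elim
        case (elim k)
        then have "real n \<le> real k" by simp
        then have "F k x = f x" using n unfolding F_def c_def by (subst clamp_real_eq) (auto simp: indicator_def)
        then show ?case by simp
      qed
    qed
    then show "AE x in lborel. (\<lambda>k. ennreal ((f x - F k x)\<^sup>2)) \<longlonglongrightarrow> 0" by simp
  qed (use L2 in auto)
  then have "eventually (\<lambda>k. (\<integral>\<^sup>+x. ennreal ((f x - F k x)\<^sup>2) \<partial>lborel) < e / 4) sequentially"
    using e4 by (intro order_tendstoD) auto
  then obtain k where k: "(\<integral>\<^sup>+x. ennreal ((f x - F k x)\<^sup>2) \<partial>lborel) < e / 4"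
    by (auto simp: eventually_sequentially)
  \<comment> \<open>\<open>measurable_on\<close> unfolds to the required sequence of continuous
    functions with limits off a negligible set.\<close>
  have "F k measurable_on UNIV"
    using F[of k] by (intro lebesgue_measurable_imp_measurable_on_real measurable_completion) auto
  then obtain N G where N: "negligible N" and G: "\<And>n. continuous_on UNIV (G n)"
    and lim: "\<And>x. x \<notin> N \<Longrightarrow> (\<lambda>n. G n x) \<longlonglongrightarrow> F k x"
    by (auto simp: measurable_on_def)
  \<comment> \<open>A continuous cutoff: 1 on the ball where \<open>F k\<close> lives, 0 beyond
    radius \<open>k + 1\<close>.\<close>
  define cut where "cut x = max 0 (min 1 (real k + 1 - norm x))" for x :: 'a
  define H where "H n x = c k (G n x) * cut x" for n x
  have H_cont: "continuous_on UNIV (H n)" for n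
    unfolding H_def[abs_def] c_def clamp_real_def cut_def
    by (intro continuous_intros G)
  then have [measurable]: "H n \<in> borel_measurable borel" for n by (rule borel_measurable_continuous_onI)
  have cut: "\<bar>cut x\<bar> \<le> 1" "norm x > real k + 1 \<Longrightarrow> cut x = 0" "norm x < real k \<Longrightarrow> cut x = 1" for x
    by (auto simp: cut_def)
  have "(\<lambda>n. \<integral>\<^sup>+x. ennreal ((F k x - H n x)\<^sup>2) \<partial>lborel) \<longlonglongrightarrow> (\<integral>\<^sup>+x. 0 \<partial>(lborel::'a measure))"
  proof (rule nn_integral_dominated_convergence[where w="\<lambda>x. ennreal ((2 * real k)\<^sup>2 * indicator (cball 0 (real k + 1)) x)"])
    have "(F k x - H n x)\<^sup>2 \<le> (2 * real k)\<^sup>2 * indicator (cball 0 (real k + 1)) x" for n x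
    proof (cases "norm x > real k + 1")
      case True
      then show ?thesis using cut(2)[of x] by (simp add: F_def H_def)
    next
      case False
      have "\<bar>F k x\<bar> \<le> real k" unfolding F_def c_def using clamp_real_bound[of "real k" "f x"] by (auto simp: indicator_def)
      moreover have "\<bar>H n x\<bar> \<le> real k * 1"
        unfolding H_def c_def abs_mult using cut(1)[of x] by (intro mult_mono clamp_real_bound) auto
      ultimately have "\<bar>F k x - H n x\<bar> \<le> 2 * real k" by linarith
      from power_mono[OF this, of 2] show ?thesis using False by (simp add: indicator_def)
    qed
    then show "AE x in lborel. ennreal ((F k x - H n x)\<^sup>2) \<le> ennreal ((2 * real k)\<^sup>2 * indicator (cball 0 (real k + 1)) x)" for n
      by (intro AE_I2 ennreal_leI)
    have "AE x in lebesgue. x \<notin> N"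
      using N by (simp add: negligible_iff_null_sets AE_not_in)
    then have "AE x in lborel. x \<notin> N" by (simp add: AE_completion_iff)
    then show "AE x in lborel. (\<lambda>n. ennreal ((F k x - H n x)\<^sup>2)) \<longlonglongrightarrow> 0"
    proof eventually_elim
      case (elim x)
      have "(\<lambda>n. c k (G n x) * cut x) \<longlonglongrightarrow> c k (F k x) * cut x"
        unfolding c_def clamp_real_def by (intro tendsto_intros lim elim)
      moreover have "c k (F k x) * cut x = F k x"
        unfolding F_def c_def using cut(3)[of x] clamp_real_bound[of "real k" "f x"] by (auto simp: indicator_def clamp_real_eq)
      ultimately have "(\<lambda>n. (F k x - H n x)\<^sup>2) \<longlonglongrightarrow> (F k x - F k x)\<^sup>2"
        unfolding H_def by (intro tendsto_intros) simp
      then show ?case using tendsto_ennrealI by fastforce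
    qed
  qed (use nn_integral_cball_const_less_top in \<open>auto intro!: borel_measurable_times borel_measurable_indicator measurable_compose[OF _ measurable_ennreal]\<close>)
  then have "eventually (\<lambda>n. (\<integral>\<^sup>+x. ennreal ((F k x - H n x)\<^sup>2) \<partial>lborel) < e / 4) sequentially"
    using e4 by (intro order_tendstoD) auto
  then obtain n where n: "(\<integral>\<^sup>+x. ennreal ((F k x - H n x)\<^sup>2) \<partial>lborel) < e / 4"
    by (auto simp: eventually_sequentially)
  have "(\<integral>\<^sup>+x. ennreal ((f x - H n x)\<^sup>2) \<partial>lborel) = (\<integral>\<^sup>+x. ennreal (((f x - F k x) + (F k x - H n x))\<^sup>2) \<partial>lborel)"
    by simp
  also have "\<dots> \<le> 2 * (\<integral>\<^sup>+x. ennreal ((f x - F k x)\<^sup>2) \<partial>lborel) + 2 * (\<integral>\<^sup>+x. ennreal ((F k x - H n x)\<^sup>2) \<partial>lborel)"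
    by (rule L2_add_le) auto
  also have "\<dots> < 2 * (e / 4) + 2 * (e / 4)"
    using k n by (intro add_strict_mono ennreal_mult_strict_left_mono) auto
  also have "\<dots> = e"
  proof -
    have "2 * (e / 4) + 2 * (e / 4) = 4 * (e / 4)"
      by (simp add: distrib_right[symmetric])
    also have "\<dots> = e" by (simp add: ennreal_times_divide ennreal_mult_divide_eq mult.commute)
    finally show ?thesis .
  qed
  finally have "(\<integral>\<^sup>+x. ennreal ((f x - H n x)\<^sup>2) \<partial>lborel) < e" .
  then show thesis
    using that[of "H n" "real k + 1"] H_cont cut(2) by (auto simp: H_def)
qed

lemma continuous_compact_support_bounded:
  fixes g :: "'a::euclidean_space \<Rightarrow> 'b::real_normed_vector"
  assumes "continuous_on UNIV g" "\<And>x. norm x > R \<Longrightarrow> g x = 0"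
  obtains B where "B \<ge> 0" "\<And>x. norm (g x) \<le> B"
proof -
  have "bounded (g ` cball 0 R)"
    using assms(1) by (intro compact_imp_bounded compact_continuous_image) (auto intro: continuous_on_subset)
  then obtain B where "\<And>x. x \<in> cball 0 R \<Longrightarrow> norm (g x) \<le> B" by (force simp: bounded_iff)
  then have "norm (g x) \<le> max B 0" for x
    using assms(2)[of x] by (cases "norm x > R") (auto simp: le_max_iff_disj)
  then show thesis by (intro that[of "max B 0"]) auto
qed

text \<open>For a continuous function of compact support this is dominated convergence. Translation
  invariance keeps the approximation error \<open>f - g\<close> the same at every
  \<open>z k\<close>, so density carries the claim over to \<open>f\<close>.\<close>

lemma L2_translate_tendsto_0:
  fixes f :: "'a::euclidean_space \<Rightarrow> real"
  assumes f[measurable]: "f \<in> borel_measurable borel" and L2: "(\<integral>\<^sup>+x. ennreal ((f x)\<^sup>2) \<partial>lborel) < \<infinity>"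
    and z: "z \<longlonglongrightarrow> 0"
  shows "(\<lambda>k::nat. \<integral>\<^sup>+x. ennreal ((f (x + z k) - f x)\<^sup>2) \<partial>lborel) \<longlonglongrightarrow> 0"
proof (rule order_tendstoI)
  fix e :: ennreal assume e: "e > 0"
  \<comment> \<open>Splitting into three terms by two uses of \<open>L2_add_le\<close> gives the
    weights 2, 4 and 4. The first is raised to 4, so three errors below \<open>e / 12\<close> stay
    below \<open>e\<close> in total.\<close>
  have e12: "e / 12 > 0" using e by (simp add: ennreal_zero_less_divide)
  obtain g R where g: "continuous_on UNIV g" and R: "\<And>x. norm x > R \<Longrightarrow> g x = 0"
    and fg: "(\<integral>\<^sup>+x. ennreal ((f x - g x)\<^sup>2) \<partial>lborel) < e / 12"
    using ex_continuous_L2_approx[OF f L2 e12] by blast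
  have [measurable]: "g \<in> borel_measurable borel" using g by (rule borel_measurable_continuous_onI)
  obtain B where B: "B \<ge> 0" "\<And>x. norm (g x) \<le> B"
    using continuous_compact_support_bounded[OF g R] by blast
  obtain Z where Z: "\<And>k. norm (z k) \<le> Z"
    using z Bseq_def convergent_imp_Bseq convergentI by metis
  have "(\<lambda>k. \<integral>\<^sup>+x. ennreal ((g (x + z k) - g x)\<^sup>2) \<partial>lborel) \<longlonglongrightarrow> (\<integral>\<^sup>+x. 0 \<partial>(lborel::'a measure))"
  proof (rule nn_integral_dominated_convergence[where w="\<lambda>x. ennreal ((2 * B)\<^sup>2 * indicator (cball 0 (R + Z)) x)"])
    have "(g (x + z k) - g x)\<^sup>2 \<le> (2 * B)\<^sup>2 * indicator (cball 0 (R + Z)) x" for k x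
    proof (cases "norm x > R + Z")
      case True
      have "norm x \<le> norm (x + z k) + norm (z k)" by (metis add_diff_cancel_right' norm_triangle_ineq4)
      with True Z[of k] have "norm (x + z k) > R" by linarith
      moreover have "norm x > R" using True Z[of k] norm_ge_zero[of "z k"] by linarith
      ultimately show ?thesis using R by simp
    next
      case False
      have "\<bar>g (x + z k) - g x\<bar> \<le> 2 * B" using B(2)[of x] B(2)[of "x + z k"] by simp
      from power_mono[OF this, of 2] show ?thesis using False by (simp add: indicator_def)
    qed
    then show "AE x in lborel. ennreal ((g (x + z k) - g x)\<^sup>2) \<le> ennreal ((2 * B)\<^sup>2 * indicator (cball 0 (R + Z)) x)" for k
      by (intro AE_I2 ennreal_leI)
    have "(\<lambda>k. ennreal ((g (x + z k) - g x)\<^sup>2)) \<longlonglongrightarrow> 0" for x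
    proof -
      have "(\<lambda>k. x + z k) \<longlonglongrightarrow> x + 0" by (intro tendsto_intros z)
      then have "(\<lambda>k. g (x + z k)) \<longlonglongrightarrow> g x"
        using g by (auto simp: continuous_on_eq_continuous_at intro: isCont_tendsto_compose)
      then have "(\<lambda>k. (g (x + z k) - g x)\<^sup>2) \<longlonglongrightarrow> (g x - g x)\<^sup>2" by (intro tendsto_intros)
      then show ?thesis using tendsto_ennrealI by fastforce
    qed
    then show "AE x in lborel. (\<lambda>k. ennreal ((g (x + z k) - g x)\<^sup>2)) \<longlonglongrightarrow> 0" by simp
  qed (use nn_integral_cball_const_less_top in \<open>auto intro!: borel_measurable_times borel_measurable_indicator measurable_compose[OF _ measurable_ennreal]\<close>)
  then have "eventually (\<lambda>k. (\<integral>\<^sup>+x. ennreal ((g (x + z k) - g x)\<^sup>2) \<partial>lborel) < e / 12) sequentially"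
    using e12 by (intro order_tendstoD) auto
  then show "eventually (\<lambda>k. (\<integral>\<^sup>+x. ennreal ((f (x + z k) - f x)\<^sup>2) \<partial>lborel) < e) sequentially"
  proof eventually_elim
    case (elim k)
    let ?I = "\<lambda>h. \<integral>\<^sup>+x. ennreal ((h x)\<^sup>2) \<partial>lborel"
    have tr: "?I (\<lambda>x. f (x + z k) - g (x + z k)) = ?I (\<lambda>x. f x - g x)"
      by (rule nn_integral_lborel_translate[of "\<lambda>x. ennreal ((f x - g x)\<^sup>2)"]) auto
    have sy: "?I (\<lambda>x. g x - f x) = ?I (\<lambda>x. f x - g x)"
      by (simp add: power2_commute)
    have "?I (\<lambda>x. f (x + z k) - f x) = ?I (\<lambda>x. (f (x + z k) - g (x + z k)) + ((g (x + z k) - g x) + (g x - f x)))"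
      by simp
    also have "\<dots> \<le> 2 * ?I (\<lambda>x. f (x + z k) - g (x + z k)) + 2 * ?I (\<lambda>x. (g (x + z k) - g x) + (g x - f x))"
      by (rule L2_add_le) auto
    also have "\<dots> \<le> 2 * ?I (\<lambda>x. f (x + z k) - g (x + z k)) + 2 * (2 * ?I (\<lambda>x. g (x + z k) - g x) + 2 * ?I (\<lambda>x. g x - f x))"
      by (intro add_left_mono mult_left_mono L2_add_le) auto
    also have "\<dots> = 2 * ?I (\<lambda>x. f x - g x) + (4 * ?I (\<lambda>x. g (x + z k) - g x) + 4 * ?I (\<lambda>x. f x - g x))"
      unfolding tr sy by (simp add: distrib_left mult.assoc[symmetric])
    also have "\<dots> \<le> 4 * ?I (\<lambda>x. f x - g x) + (4 * ?I (\<lambda>x. g (x + z k) - g x) + 4 * ?I (\<lambda>x. f x - g x))"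
      by (intro add_right_mono mult_right_mono) auto
    also have "\<dots> < 4 * (e / 12) + (4 * (e / 12) + 4 * (e / 12))"
      using fg elim by (intro add_strict_mono ennreal_mult_strict_left_mono) auto
    also have "\<dots> = 12 * (e / 12)"
      by (simp add: distrib_right[symmetric])
    also have "\<dots> = e" by (simp add: ennreal_times_divide ennreal_mult_divide_eq mult.commute)
    finally show ?case .
  qed
qed simp

section \<open>The Fourier transform of integrable functions\<close>

lemma has_bochner_integral_gaussian_real:
  assumes "t > 0"
  shows "has_bochner_integral lborel (\<lambda>x::'a::euclidean_space. exp (- t * (norm x)\<^sup>2)) ((pi / t) powr (DIM('a) / 2))"
  using has_bochner_integral_bounded_linear[OF bounded_linear_Re has_bochner_integral_gaussian_euclidean[OF assms, of "0::'a"]]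
  by simp

lemma square_powr_half:
  fixes x :: real
  assumes "x > 0"
  shows "(x\<^sup>2) powr (real n / 2) = x ^ n"
proof -
  have "x\<^sup>2 = x powr 2" using assms by simp
  then have "(x\<^sup>2) powr (real n / 2) = x powr (2 * (real n / 2))" by (simp only: powr_powr)
  then show ?thesis using powr_realpow[OF assms, of n] by simp
qed

text \<open>The sign in the exponent is that of \<open>char\<close>, and there is no normalizing
  factor, so \<open>plancherel\<close> carries \<open>(2 * pi) ^ DIM('a)\<close>. As a pointwise
  Bochner integral it is meaningful for integrable \<open>f\<close>.\<close>

definition fourier :: "('a::euclidean_space \<Rightarrow> real) \<Rightarrow> 'a \<Rightarrow> complex" where
  "fourier f \<xi> = (LINT x|lborel. f x *\<^sub>R cis (\<xi> \<bullet> x))"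

lemma integrable_cis:
  assumes "integrable M f" "g \<in> borel_measurable M"
  shows "integrable M (\<lambda>x. (f x :: real) *\<^sub>R cis (g x))"
  using borel_measurable_integrable[OF assms(1)] assms(2)
  by (intro Bochner_Integration.integrable_bound[OF assms(1)]) auto

lemma borel_measurable_fourier [measurable]:
  assumes [measurable]: "f \<in> borel_measurable borel"
  shows "fourier f \<in> borel_measurable borel"
  unfolding fourier_def[abs_def] by measurable

lemma norm_fourier_le: "norm (fourier f \<xi>) \<le> (LINT x|lborel. \<bar>f x\<bar>)"
  unfolding fourier_def by (rule order_trans[OF integral_norm_bound]) simp

lemma borel_measurable_cnj_fourier:
  assumes [measurable]: "f \<in> borel_measurable borel"
  shows "(\<lambda>\<xi>. cnj (fourier f \<xi>)) \<in> borel_measurable borel"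
  by (rule measurable_compose[OF borel_measurable_fourier[OF assms] borel_measurable_continuous_onI]) (intro continuous_intros)

lemma fourier_diff:
  assumes "integrable lborel f" "integrable lborel g"
  shows "fourier (\<lambda>x. f x - g x) \<xi> = fourier f \<xi> - fourier g \<xi>"
  unfolding fourier_def using assms
  by (simp add: scaleR_diff_left integrable_cis)

lemma fourier_translate:
  assumes [measurable]: "f \<in> borel_measurable borel"
  shows "fourier (\<lambda>x. f (x + z)) \<xi> = cis (- (\<xi> \<bullet> z)) * fourier f \<xi>"
proof -
  have "fourier (\<lambda>x. f (x + z)) \<xi> = (LINT x|lborel. cis (- (\<xi> \<bullet> z)) * (f (x + z) *\<^sub>R cis (\<xi> \<bullet> (x + z))))"
    unfolding fourier_def
    by (intro Bochner_Integration.integral_cong refl) (simp add: scaleR_conv_of_real cis_mult inner_add_right)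
  also have "\<dots> = cis (- (\<xi> \<bullet> z)) * (LINT x|lborel. f (x + z) *\<^sub>R cis (\<xi> \<bullet> (x + z)))"
    by (rule integral_mult_right_zero)
  also have "(LINT x|lborel. f (x + z) *\<^sub>R cis (\<xi> \<bullet> (x + z))) = fourier f \<xi>"
    unfolding fourier_def by (rule integral_lborel_translate[where f="\<lambda>x. f x *\<^sub>R cis (\<xi> \<bullet> x)"]) measurable
  finally show ?thesis .
qed

lemma integrable_prod_bound:
  fixes h :: "'a \<times> 'b \<Rightarrow> 'c::{banach, second_countable_topology}"
  assumes "sigma_finite_measure M" "sigma_finite_measure N"
  assumes f: "integrable M (f :: 'a \<Rightarrow> real)" and g: "integrable N (g :: 'b \<Rightarrow> real)"
    and h[measurable]: "h \<in> borel_measurable (M \<Otimes>\<^sub>M N)" and le: "\<And>x y. norm (h (x, y)) \<le> \<bar>f x * g y\<bar>"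
  shows "integrable (M \<Otimes>\<^sub>M N) h"
proof -
  interpret M: sigma_finite_measure M by fact
  interpret N: sigma_finite_measure N by fact
  interpret pair_sigma_finite M N ..
  have [measurable]: "f \<in> borel_measurable M" "g \<in> borel_measurable N" using f g by auto
  have "integrable (M \<Otimes>\<^sub>M N) (\<lambda>p. f (fst p) * g (snd p))"
  proof (rule Fubini_integrable)
    show "integrable M (\<lambda>x. LINT y|N. norm (f (fst (x, y)) * g (snd (x, y))))"
      using f by (simp add: abs_mult)
    show "AE x in M. integrable N (\<lambda>y. f (fst (x, y)) * g (snd (x, y)))"
      using g by simp
  qed measurable
  then show ?thesis
  proof (rule Bochner_Integration.integrable_bound)
    show "AE p in M \<Otimes>\<^sub>M N. norm (h p) \<le> norm (f (fst p) * g (snd p))"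
      using le by (intro AE_I2) (metis prod.collapse real_norm_def)
  qed (rule h)
qed

text \<open>The \<open>L\<^sup>2\<close> theory goes through the autocorrelation \<open>R\<close> of \<open>f\<close>: it is continuous at \<open>0\<close> and the
  Gaussian means of \<open>|fourier f|\<^sup>2\<close> are Gaussian means of \<open>R\<close> around \<open>0\<close>.\<close>

definition autocorr :: "('a::euclidean_space \<Rightarrow> real) \<Rightarrow> 'a \<Rightarrow> real" where
  "autocorr f z = (LINT x|lborel. f x * f (x + z))"

context
  fixes f :: "'a::euclidean_space \<Rightarrow> real"
  assumes f[measurable]: "f \<in> borel_measurable borel" and L2: "integrable lborel (\<lambda>x. (f x)\<^sup>2)"
begin

lemma integrable_square_translate: "integrable lborel (\<lambda>x. (f (x + z))\<^sup>2)"
  using L2 by (subst integrable_lborel_translate_iff[of "\<lambda>x. (f x)\<^sup>2"]) auto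

lemma integral_square_translate: "(LINT x|lborel. (f (x + z))\<^sup>2) = (LINT x|lborel. (f x)\<^sup>2)"
  by (rule integral_lborel_translate[of "\<lambda>x. (f x)\<^sup>2"]) auto

lemma integrable_autocorr: "integrable lborel (\<lambda>x. f x * f (x + z))"
proof (rule Bochner_Integration.integrable_bound)
  show "integrable lborel (\<lambda>x. (f x)\<^sup>2 + (f (x + z))\<^sup>2)"
    using L2 integrable_square_translate by (rule Bochner_Integration.integrable_add)
  have "\<bar>f x * f (x + z)\<bar> \<le> (f x)\<^sup>2 + (f (x + z))\<^sup>2" for x
  proof -
    have "0 \<le> \<bar>f x\<bar> * \<bar>f (x + z)\<bar>" by simp
    then show ?thesis
      using sum_squares_bound[of "\<bar>f x\<bar>" "\<bar>f (x + z)\<bar>"] unfolding abs_mult power2_abs by linarith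
  qed
  then show "AE x in lborel. norm (f x * f (x + z)) \<le> norm ((f x)\<^sup>2 + (f (x + z))\<^sup>2)"
    by simp
qed measurable

text \<open>The inequality of arithmetic and geometric means in place of Cauchy-Schwarz: both
  squares have the same integral by translation invariance.\<close>

lemma integral_abs_autocorr_le: "(LINT x|lborel. \<bar>f x * f (x + z)\<bar>) \<le> (LINT x|lborel. (f x)\<^sup>2)"
proof -
  have "(LINT x|lborel. \<bar>f x * f (x + z)\<bar>) \<le> (LINT x|lborel. (1/2) * ((f x)\<^sup>2 + (f (x + z))\<^sup>2))"
  proof (rule integral_mono)
    show "\<bar>f x * f (x + z)\<bar> \<le> (1/2) * ((f x)\<^sup>2 + (f (x + z))\<^sup>2)" for x
      using sum_squares_bound[of "\<bar>f x\<bar>" "\<bar>f (x + z)\<bar>"] by (simp add: abs_mult)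
    show "integrable lborel (\<lambda>x. (1/2) * ((f x)\<^sup>2 + (f (x + z))\<^sup>2))"
      using L2 integrable_square_translate by auto
  qed (use integrable_autocorr in auto)
  also have "\<dots> = (LINT x|lborel. (f x)\<^sup>2)"
    using L2 integrable_square_translate[of z] integral_square_translate[of z] by simp
  finally show ?thesis .
qed

lemma abs_autocorr_le: "\<bar>autocorr f z\<bar> \<le> (LINT x|lborel. (f x)\<^sup>2)"
  unfolding autocorr_def by (rule order_trans[OF integral_abs_bound integral_abs_autocorr_le])

lemma autocorr_0: "autocorr f 0 = (LINT x|lborel. (f x)\<^sup>2)"
  by (simp add: autocorr_def power2_eq_square)

lemma autocorr_measurable [measurable]: "autocorr f \<in> borel_measurable borel"
  unfolding autocorr_def[abs_def] by measurable

lemma nn_integral_L2: "(\<integral>\<^sup>+x. ennreal ((f x)\<^sup>2) \<partial>lborel) = ennreal (LINT x|lborel. (f x)\<^sup>2)"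
  using L2 by (rule nn_integral_eq_integral) auto

text \<open>Expanding the square, the squared L^2 distance of \<open>f\<close> and its translate by
  \<open>z\<close> is \<open>2 * (autocorr f 0 - autocorr f z)\<close>, so
  \<open>L2_translate_tendsto_0\<close> applies.\<close>

lemma autocorr_tendsto:
  assumes z: "z \<longlonglongrightarrow> 0"
  shows "(\<lambda>k::nat. autocorr f (z k)) \<longlonglongrightarrow> autocorr f 0"
proof -
  have eq: "(\<integral>\<^sup>+x. ennreal ((f (x + z k) - f x)\<^sup>2) \<partial>lborel) = ennreal (2 * (autocorr f 0 - autocorr f (z k)))" for k
  proof -
    have eq: "(f (x + z k) - f x)\<^sup>2 = ((f (x + z k))\<^sup>2 + (f x)\<^sup>2) - 2 * (f x * f (x + z k))" for x
      by (simp add: power2_diff)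
    have *: "integrable lborel (\<lambda>x. (f (x + z k) - f x)\<^sup>2)"
      unfolding eq using L2 integrable_square_translate integrable_autocorr by (intro Bochner_Integration.integrable_diff Bochner_Integration.integrable_add integrable_mult_right)
    have "(LINT x|lborel. (f (x + z k) - f x)\<^sup>2) = 2 * (autocorr f 0 - autocorr f (z k))"
      unfolding eq autocorr_0 using L2 integrable_square_translate integrable_autocorr integral_square_translate
      by (simp add: autocorr_def)
    then show ?thesis using nn_integral_eq_integral[OF *] by simp
  qed
  have "(\<lambda>k. ennreal (2 * (autocorr f 0 - autocorr f (z k)))) \<longlonglongrightarrow> 0"
    unfolding eq[symmetric] by (rule L2_translate_tendsto_0[OF f _ z]) (simp add: nn_integral_L2)
  moreover have "2 * (autocorr f 0 - autocorr f (z k)) \<ge> 0" for k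
    using abs_autocorr_le[of "z k"] by (simp add: autocorr_0)
  ultimately have "(\<lambda>k. 2 * (autocorr f 0 - autocorr f (z k))) \<longlonglongrightarrow> 0"
    by (simp add: ennreal_tendsto_0_iff)
  then have "(\<lambda>k. autocorr f 0 - (1/2) * (2 * (autocorr f 0 - autocorr f (z k)))) \<longlonglongrightarrow> autocorr f 0 - (1/2) * 0"
    by (intro tendsto_intros)
  then show ?thesis by (simp add: diff_divide_distrib)
qed

context
  assumes L1: "integrable lborel f"
begin

text \<open>The Gaussian weight makes Fubini applicable, as \<open>norm (fourier f \<xi>)\<close> is
  at this point only known to be bounded. With the square written as a double integral over
  \<open>x\<close> and \<open>y\<close>, integrating over \<open>\<xi>\<close> first leaves the
  transform of the Gaussian at \<open>x - y\<close>; putting \<open>y = x + z\<close> yields a mean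
  of the autocorrelation.\<close>

lemma fourier_gaussian_mean:
  assumes e: "e > 0"
  shows "(LINT \<xi>|lborel. exp (- e * (norm \<xi>)\<^sup>2) * (norm (fourier f \<xi>))\<^sup>2)
     = (LINT z|lborel. (pi / e) powr (DIM('a) / 2) * exp (- (norm z)\<^sup>2 / (4 * e)) * autocorr f z)"
proof -
  let ?g = "\<lambda>\<xi>::'a. exp (- e * (norm \<xi>)\<^sup>2)"
  define K where "K z = (pi / e) powr (DIM('a) / 2) * exp (- (norm z)\<^sup>2 / (4 * e))" for z :: 'a
  define B where "B = (LINT x|lborel. \<bar>f x\<bar>)"
  have sf: "sigma_finite_measure (lborel :: 'a measure)" by (rule sigma_finite_lborel)
  note borel_measurable_cnj_fourier[OF f, measurable]
  have [measurable]: "K \<in> borel_measurable borel" unfolding K_def[abs_def] by measurable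
  have gint: "integrable lborel ?g"
    by (rule integrable.intros[OF has_bochner_integral_gaussian_real[OF e]])
  have Kint: "integrable lborel K"
    using integrable.intros[OF has_bochner_integral_gaussian_real[of "1 / (4 * e)"]] e unfolding K_def
    by (intro integrable_mult_right) simp
  have K: "(LINT \<xi>|lborel. ?g \<xi> *\<^sub>R cis (u \<bullet> \<xi>)) = of_real (K u)" for u
    using has_bochner_integral_gaussian_euclidean[OF e, of u] by (simp add: has_bochner_integral_iff K_def)
  have inner: "(LINT \<xi>|lborel. (?g \<xi> *\<^sub>R cis (\<xi> \<bullet> x)) * cnj (fourier f \<xi>)) = (LINT z|lborel. of_real (f (x + z) * K z))" for x
  proof -
    have "(LINT \<xi>|lborel. (?g \<xi> *\<^sub>R cis (\<xi> \<bullet> x)) * cnj (fourier f \<xi>))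
        = (LINT \<xi>|lborel. (LINT y|lborel. (?g \<xi> * f y) *\<^sub>R cis (\<xi> \<bullet> (x - y))))"
    proof (intro Bochner_Integration.integral_cong refl)
      fix \<xi> :: 'a
      have "cnj (fourier f \<xi>) = (LINT y|lborel. f y *\<^sub>R cis (- (\<xi> \<bullet> y)))"
        unfolding fourier_def by (subst Bochner_Integration.integral_cnj[symmetric]) (simp add: cis_cnj)
      then have "(?g \<xi> *\<^sub>R cis (\<xi> \<bullet> x)) * cnj (fourier f \<xi>) = (LINT y|lborel. (?g \<xi> *\<^sub>R cis (\<xi> \<bullet> x)) * (f y *\<^sub>R cis (- (\<xi> \<bullet> y))))"
        by (simp only: integral_mult_right_zero)
      also have "\<dots> = (LINT y|lborel. (?g \<xi> * f y) *\<^sub>R cis (\<xi> \<bullet> (x - y)))"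
        by (intro Bochner_Integration.integral_cong refl) (simp add: scaleR_conv_of_real cis_mult inner_diff_right mult_ac)
      finally show "(?g \<xi> *\<^sub>R cis (\<xi> \<bullet> x)) * cnj (fourier f \<xi>) = (LINT y|lborel. (?g \<xi> * f y) *\<^sub>R cis (\<xi> \<bullet> (x - y)))" .
    qed
    also have "\<dots> = (LINT y|lborel. (LINT \<xi>|lborel. (?g \<xi> * f y) *\<^sub>R cis (\<xi> \<bullet> (x - y))))"
    proof (rule lborel_pair.Fubini_integral[symmetric])
      show "integrable (lborel \<Otimes>\<^sub>M lborel) (\<lambda>(\<xi>, y). (?g \<xi> * f y) *\<^sub>R cis (\<xi> \<bullet> (x - y)))"
        by (rule integrable_prod_bound[OF sf sf gint L1]) auto
    qed
    also have "\<dots> = (LINT y|lborel. of_real (f y * K (x - y)))"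
    proof (intro Bochner_Integration.integral_cong refl)
      fix y
      have "(LINT \<xi>|lborel. (?g \<xi> * f y) *\<^sub>R cis (\<xi> \<bullet> (x - y))) = (LINT \<xi>|lborel. f y *\<^sub>R (?g \<xi> *\<^sub>R cis ((x - y) \<bullet> \<xi>)))"
        by (simp add: mult.commute inner_commute)
      also have "\<dots> = of_real (f y * K (x - y))"
        by (simp only: integral_scaleR_right K) (simp add: scaleR_conv_of_real)
      finally show "(LINT \<xi>|lborel. (?g \<xi> * f y) *\<^sub>R cis (\<xi> \<bullet> (x - y))) = complex_of_real (f y * K (x - y))" .
    qed
    also have "\<dots> = (LINT z|lborel. of_real (f (z + x) * K (x - (z + x))))"
      by (rule integral_lborel_translate[symmetric, of "\<lambda>y. complex_of_real (f y * K (x - y))" x]) measurable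
    also have "\<dots> = (LINT z|lborel. of_real (f (x + z) * K z))"
      by (simp add: add.commute K_def)
    finally show ?thesis .
  qed
  have "complex_of_real (LINT \<xi>|lborel. ?g \<xi> * (norm (fourier f \<xi>))\<^sup>2)
      = (LINT \<xi>|lborel. of_real (?g \<xi> * (norm (fourier f \<xi>))\<^sup>2))"
    by (rule integral_complex_of_real[symmetric])
  also have "\<dots> = (LINT \<xi>|lborel. (LINT x|lborel. (?g \<xi> *\<^sub>R (f x *\<^sub>R cis (\<xi> \<bullet> x))) * cnj (fourier f \<xi>)))"
  proof (intro Bochner_Integration.integral_cong refl)
    fix \<xi> :: 'a
    have "of_real (?g \<xi> * (norm (fourier f \<xi>))\<^sup>2) = (?g \<xi> *\<^sub>R fourier f \<xi>) * cnj (fourier f \<xi>)"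
      unfolding of_real_mult complex_norm_square scaleR_conv_of_real by (simp only: mult.assoc)
    also have "\<dots> = (LINT x|lborel. (?g \<xi> *\<^sub>R (f x *\<^sub>R cis (\<xi> \<bullet> x))) * cnj (fourier f \<xi>))"
      unfolding fourier_def[of f \<xi>] by (simp only: integral_mult_left_zero integral_scaleR_right)
    finally show "complex_of_real (?g \<xi> * (norm (fourier f \<xi>))\<^sup>2) = (LINT x|lborel. (?g \<xi> *\<^sub>R (f x *\<^sub>R cis (\<xi> \<bullet> x))) * cnj (fourier f \<xi>))" .
  qed
  also have "\<dots> = (LINT x|lborel. (LINT \<xi>|lborel. (?g \<xi> *\<^sub>R (f x *\<^sub>R cis (\<xi> \<bullet> x))) * cnj (fourier f \<xi>)))"
  proof (rule lborel_pair.Fubini_integral[symmetric])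
    show "integrable (lborel \<Otimes>\<^sub>M lborel) (\<lambda>(\<xi>, x). (?g \<xi> *\<^sub>R (f x *\<^sub>R cis (\<xi> \<bullet> x))) * cnj (fourier f \<xi>))"
    proof (rule integrable_prod_bound[OF sf sf _ L1])
      show "integrable lborel (\<lambda>\<xi>. B * ?g \<xi>)" using gint by simp
      show "norm (case (\<xi>, x) of (\<xi>, x) \<Rightarrow> (?g \<xi> *\<^sub>R (f x *\<^sub>R cis (\<xi> \<bullet> x))) * cnj (fourier f \<xi>)) \<le> \<bar>B * ?g \<xi> * f x\<bar>" for \<xi> x
        using mult_left_mono[OF norm_fourier_le[of f \<xi>], of "?g \<xi> * \<bar>f x\<bar>"]
        by (simp add: norm_mult abs_mult B_def mult_ac)
    qed measurable
  qed
  also have "\<dots> = (LINT x|lborel. f x *\<^sub>R (LINT \<xi>|lborel. (?g \<xi> *\<^sub>R cis (\<xi> \<bullet> x)) * cnj (fourier f \<xi>)))"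
    by (intro Bochner_Integration.integral_cong refl) (simp flip: integral_scaleR_right, simp add: mult_ac)
  also have "\<dots> = (LINT x|lborel. (LINT z|lborel. of_real (f x * f (x + z) * K z)))"
    unfolding inner by (simp flip: integral_scaleR_right, simp add: scaleR_conv_of_real mult_ac)
  also have "\<dots> = (LINT z|lborel. (LINT x|lborel. of_real (f x * f (x + z) * K z)))"
  proof (rule lborel_pair.Fubini_integral)
    show "integrable (lborel \<Otimes>\<^sub>M lborel) (\<lambda>(z, x). complex_of_real (f x * f (x + z) * K z))"
    \<comment> \<open>\<open>f x * f (x + z)\<close> is not bounded by a product as in
      \<open>integrable_prod_bound\<close>. Its absolute integral over \<open>x\<close> is bounded
      uniformly in \<open>z\<close>, and \<open>K\<close> is integrable.\<close>
    proof (rule lborel_pair.Fubini_integrable)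
      show "AE z in lborel. integrable lborel (\<lambda>x. case (z, x) of (z, x) \<Rightarrow> complex_of_real (f x * f (x + z) * K z))"
        using integrable_autocorr by (auto simp: complex_of_real_integrable_eq simp del: of_real_mult)
      show "integrable lborel (\<lambda>z. LINT x|lborel. norm (case (z, x) of (z, x) \<Rightarrow> complex_of_real (f x * f (x + z) * K z)))"
      proof (rule Bochner_Integration.integrable_bound)
        show "integrable lborel (\<lambda>z. (LINT x|lborel. (f x)\<^sup>2) * K z)" using Kint by simp
        have "(LINT x|lborel. \<bar>f x * f (x + z) * K z\<bar>) \<le> \<bar>(LINT x|lborel. (f x)\<^sup>2) * K z\<bar>" for z
          using mult_right_mono[OF integral_abs_autocorr_le[of z], of "\<bar>K z\<bar>"]
          by (simp add: abs_mult[of _ "K z"] abs_mult[of "integral\<^sup>L _ _"])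
        then show "AE z in lborel. norm (LINT x|lborel. norm (case (z, x) of (z, x) \<Rightarrow> complex_of_real (f x * f (x + z) * K z)))
            \<le> norm ((LINT x|lborel. (f x)\<^sup>2) * K z)"
          by (simp add: norm_of_real del: of_real_mult)
      qed measurable
    qed measurable
  qed
  also have "\<dots> = of_real (LINT z|lborel. K z * autocorr f z)"
    unfolding integral_complex_of_real autocorr_def by (simp add: mult.commute)
  finally show ?thesis unfolding K_def of_real_eq_iff .
qed

text \<open>The Gaussian weight in \<open>fourier_gaussian_mean\<close> tends to 1. The left side
  converges monotonically, so square integrability of the transform comes out as a result; the right
  side, rescaled to a fixed Gaussian, converges by continuity of the autocorrelation at 0.\<close>

theorem plancherel:
  "(\<integral>\<^sup>+\<xi>. ennreal ((norm (fourier f \<xi>))\<^sup>2) \<partial>lborel) = ennreal ((2 * pi) ^ DIM('a)) * (\<integral>\<^sup>+x. ennreal ((f x)\<^sup>2) \<partial>lborel)"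
proof -
  \<comment> \<open>The choice satisfies \<open>(c k)\<^sup>2 = 4 * e k\<close>, so
    \<open>z = c k *\<^sub>R w\<close> turns the kernel
    \<open>exp (- (norm z)\<^sup>2 / (4 * e k))\<close> into the fixed
    \<open>exp (- (norm w)\<^sup>2)\<close>.\<close>
  define e where "e k = 1 / (4 * (real k + 1)\<^sup>2)" for k
  define c where "c k = 1 / (real k + 1)" for k
  have e: "e k > 0" and c: "c k > 0" and ce: "(c k)\<^sup>2 = 4 * e k" for k
    by (auto simp: e_def c_def power_divide)
  define I where "I k = (LINT \<xi>|lborel. exp (- e k * (norm \<xi>)\<^sup>2) * (norm (fourier f \<xi>))\<^sup>2)" for k
  have gint: "integrable lborel (\<lambda>\<xi>::'a. exp (- t * (norm \<xi>)\<^sup>2))" if "t > 0" for t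
    by (rule integrable.intros[OF has_bochner_integral_gaussian_real[OF that]])
  have "integrable lborel (\<lambda>\<xi>. exp (- e k * (norm \<xi>)\<^sup>2) * (norm (fourier f \<xi>))\<^sup>2)" for k
  proof (rule Bochner_Integration.integrable_bound)
    show "integrable lborel (\<lambda>\<xi>::'a. exp (- e k * (norm \<xi>)\<^sup>2) * (LINT x|lborel. \<bar>f x\<bar>)\<^sup>2)"
      using gint[OF e] by simp
    show "AE \<xi> in lborel. norm (exp (- e k * (norm \<xi>)\<^sup>2) * (norm (fourier f \<xi>))\<^sup>2) \<le> norm (exp (- e k * (norm \<xi>)\<^sup>2) * (LINT x|lborel. \<bar>f x\<bar>)\<^sup>2)"
      by (intro AE_I2) (auto simp: abs_mult intro!: mult_left_mono power_mono norm_fourier_le)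
  qed measurable
  then have nn: "(\<integral>\<^sup>+\<xi>. ennreal (exp (- e k * (norm \<xi>)\<^sup>2) * (norm (fourier f \<xi>))\<^sup>2) \<partial>lborel) = ennreal (I k)" for k
    unfolding I_def by (rule nn_integral_eq_integral) auto
  have "(\<lambda>k. \<integral>\<^sup>+\<xi>. ennreal (exp (- e k * (norm \<xi>)\<^sup>2) * (norm (fourier f \<xi>))\<^sup>2) \<partial>lborel)
     \<longlonglongrightarrow> (\<integral>\<^sup>+\<xi>. ennreal ((norm (fourier f \<xi>))\<^sup>2) \<partial>lborel)"
  proof (rule nn_integral_LIMSEQ)
    have "e m \<le> e k" if "k \<le> m" for k m
      unfolding e_def using that by (intro divide_left_mono mult_left_mono power_mono) auto
    then show "incseq (\<lambda>k \<xi>. ennreal (exp (- e k * (norm \<xi>)\<^sup>2) * (norm (fourier f \<xi>))\<^sup>2))"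
      by (auto simp: incseq_def le_fun_def intro!: ennreal_leI mult_right_mono)
    have "e \<longlonglongrightarrow> 0" unfolding e_def[abs_def] by real_asymp
    then have "(\<lambda>k. exp (- e k * (norm \<xi>)\<^sup>2) * (norm (fourier f \<xi>))\<^sup>2) \<longlonglongrightarrow> exp (- 0 * (norm \<xi>)\<^sup>2) * (norm (fourier f \<xi>))\<^sup>2" for \<xi>
      by (intro tendsto_intros)
    then show "(\<lambda>k. ennreal (exp (- e k * (norm \<xi>)\<^sup>2) * (norm (fourier f \<xi>))\<^sup>2)) \<longlonglongrightarrow> ennreal ((norm (fourier f \<xi>))\<^sup>2)" for \<xi>
      by (intro tendsto_ennrealI) simp
  qed measurable
  then have 1: "(\<lambda>k. ennreal (I k)) \<longlonglongrightarrow> (\<integral>\<^sup>+\<xi>. ennreal ((norm (fourier f \<xi>))\<^sup>2) \<partial>lborel)"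
    unfolding nn .
  have I: "I k = (4 * pi) powr (DIM('a) / 2) * (LINT w|lborel. exp (- (norm w)\<^sup>2) * autocorr f (c k *\<^sub>R w))" for k
  proof -
    let ?h = "\<lambda>z. (pi / e k) powr (DIM('a) / 2) * exp (- (norm z)\<^sup>2 / (4 * e k)) * autocorr f z"
    have "I k = (LINT z|lborel. ?h z)"
      unfolding I_def by (rule fourier_gaussian_mean[OF e])
    also have "\<dots> = (\<bar>c k\<bar> ^ DIM('a)) *\<^sub>R (LINT w|lborel. ?h (c k *\<^sub>R w))"
      using c[of k] by (intro integral_lborel_scale) auto
    also have "\<dots> = (LINT w|lborel. (\<bar>c k\<bar> ^ DIM('a)) *\<^sub>R ?h (c k *\<^sub>R w))"
      by (rule integral_scaleR_right[symmetric])
    also have "\<dots> = (LINT w|lborel. (c k ^ DIM('a) * (pi / e k) powr (DIM('a) / 2)) * (exp (- (norm w)\<^sup>2) * autocorr f (c k *\<^sub>R w)))"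
      using e[of k] c[of k] by (intro Bochner_Integration.integral_cong refl) (simp add: power_mult_distrib ce mult_ac)
    also have "c k ^ DIM('a) * (pi / e k) powr (DIM('a) / 2) = (4 * pi) powr (DIM('a) / 2)"
    proof -
      have "c k ^ DIM('a) = ((c k)\<^sup>2) powr (DIM('a) / 2)"
        by (rule square_powr_half[OF c, symmetric])
      then have "c k ^ DIM('a) * (pi / e k) powr (DIM('a) / 2) = (4 * e k * (pi / e k)) powr (DIM('a) / 2)"
        unfolding ce using e[of k] by (subst powr_mult) auto
      moreover have "4 * e k * (pi / e k) = 4 * pi" using e[of k] by simp
      ultimately show ?thesis by simp
    qed
    finally show ?thesis by simp
  qed
  have "(\<lambda>k. LINT w|lborel. exp (- (norm w)\<^sup>2) * autocorr f (c k *\<^sub>R w)) \<longlonglongrightarrow> (LINT w|(lborel::'a measure). exp (- (norm w)\<^sup>2) * autocorr f 0)"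
  proof (rule integral_dominated_convergence)
    show "integrable lborel (\<lambda>w::'a. exp (- (norm w)\<^sup>2) * (LINT x|lborel. (f x)\<^sup>2))"
      using gint[of 1] by simp
    show "AE w in lborel. norm (exp (- (norm w)\<^sup>2) * autocorr f (c k *\<^sub>R w)) \<le> exp (- (norm w)\<^sup>2) * (LINT x|lborel. (f x)\<^sup>2)" for k
      using abs_autocorr_le by (auto simp: abs_mult intro!: mult_left_mono)
    have "c \<longlonglongrightarrow> 0" unfolding c_def[abs_def] by real_asymp
    then have "(\<lambda>k. c k *\<^sub>R w) \<longlonglongrightarrow> 0" for w :: 'a
      using tendsto_scaleR[of c 0 sequentially "\<lambda>_. w" w] by simp
    then show "AE w in lborel. (\<lambda>k. exp (- (norm w)\<^sup>2) * autocorr f (c k *\<^sub>R w)) \<longlonglongrightarrow> exp (- (norm w)\<^sup>2) * autocorr f 0"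
      by (intro AE_I2 tendsto_mult tendsto_const autocorr_tendsto)
  qed measurable
  also have "(LINT w|(lborel::'a measure). exp (- (norm w)\<^sup>2) * autocorr f 0) = pi powr (DIM('a) / 2) * autocorr f 0"
  proof -
    have "(LINT w|(lborel::'a measure). exp (- (norm w)\<^sup>2)) = pi powr (DIM('a) / 2)"
      using has_bochner_integral_gaussian_real[of 1, where 'a='a] by (simp add: has_bochner_integral_iff)
    then show ?thesis by simp
  qed
  finally have "(\<lambda>k. (4 * pi) powr (DIM('a) / 2) * (LINT w|lborel. exp (- (norm w)\<^sup>2) * autocorr f (c k *\<^sub>R w)))
      \<longlonglongrightarrow> (4 * pi) powr (DIM('a) / 2) * (pi powr (DIM('a) / 2) * autocorr f 0)"
    by (rule tendsto_mult_left)
  then have "(\<lambda>k. ennreal (I k)) \<longlonglongrightarrow> ennreal ((4 * pi) powr (DIM('a) / 2) * (pi powr (DIM('a) / 2) * autocorr f 0))"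
    unfolding I by (rule tendsto_ennrealI)
  \<comment> \<open>The first factor is what scaling leaves of the kernel's constant, the second is
    the integral of the Gaussian.\<close>
  also have "(4 * pi) powr (DIM('a) / 2) * (pi powr (DIM('a) / 2) * autocorr f 0) = (2 * pi) ^ DIM('a) * autocorr f 0"
  proof -
    have "(4 * pi) powr (DIM('a) / 2) * pi powr (DIM('a) / 2) = ((2 * pi)\<^sup>2) powr (DIM('a) / 2)"
      by (simp add: power2_eq_square mult.assoc flip: powr_mult)
    also have "\<dots> = (2 * pi) ^ DIM('a)"
      by (rule square_powr_half) simp
    finally show ?thesis by simp
  qed
  finally have "(\<lambda>k. ennreal (I k)) \<longlonglongrightarrow> ennreal ((2 * pi) ^ DIM('a) * autocorr f 0)" .
  from LIMSEQ_unique[OF 1 this] show ?thesis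
    by (simp add: autocorr_0 nn_integral_L2 ennreal_mult'')
qed

end

end

section \<open>Fourier symbols of the singular kernels\<close>

lemma nn_integral_radial:
  fixes h :: "real \<Rightarrow> ennreal"
  assumes [measurable]: "h \<in> borel_measurable borel"
  shows "(\<integral>\<^sup>+x. h (norm (x::'a::euclidean_space)) \<partial>lborel)
    = (\<integral>\<^sup>+r. h r * ennreal (indicator {0<..} r * (unit_ball_vol DIM('a) * DIM('a) * r powr (real DIM('a) - 1))) \<partial>lborel)"
proof (rule nn_integral_homogeneous)
  show "AE x in lborel. norm (x::'a) > 0" using AE_lborel_singleton[of "0::'a"] by (auto elim!: eventually_mono)
  show "emeasure lborel {x \<in> space lborel. norm (x::'a) \<le> r} = ennreal (unit_ball_vol DIM('a) * r powr DIM('a))" if "r > 0" for r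
  proof -
    have "{x \<in> space lborel. norm (x::'a) \<le> r} = cball 0 r" by auto
    then show ?thesis using that by (simp add: emeasure_cball powr_realpow)
  qed
qed auto

text \<open>In polar coordinates the integrand becomes a multiple of \<open>r powr (- s)\<close> on
  \<open>(0, 1]\<close> and of \<open>r powr (- s - 1)\<close> from 1 on: \<open>s < 1\<close>
  serves the origin and \<open>s > 0\<close> infinity.\<close>

lemma integrable_min_norm_powr:
  assumes s: "0 < s" "s < 1"
  shows "integrable lborel (\<lambda>z::'a::euclidean_space. min 1 (norm z) * norm z powr (- (real DIM('a) + s)))"
proof (rule integrableI_nonneg)
  let ?n = "real DIM('a)"
  define V where "V = unit_ball_vol ?n * ?n"
  have V: "V \<ge> 0" by (simp add: V_def)
  have "(\<integral>\<^sup>+z. ennreal (min 1 (norm (z::'a)) * norm z powr (- (?n + s))) \<partial>lborel)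
     = (\<integral>\<^sup>+r. ennreal (min 1 r * r powr (- (?n + s))) * ennreal (indicator {0<..} r * (V * r powr (?n - 1))) \<partial>lborel)"
    unfolding V_def by (rule nn_integral_radial) measurable
  also have "\<dots> \<le> (\<integral>\<^sup>+r. ennreal V * ennreal (indicator {0<..1} r * r powr ((1 - s) - 1)) + ennreal V * ennreal (indicator {1..} r * r powr (- s - 1)) \<partial>lborel)"
  proof (rule nn_integral_mono)
    fix r :: real
    have "(min 1 r * r powr (- (?n + s))) * (indicator {0<..} r * (V * r powr (?n - 1)))
      \<le> V * (indicator {0<..1} r * r powr ((1 - s) - 1)) + V * (indicator {1..} r * r powr (- s - 1))"
    proof (cases "r > 0")
      case True
      have "r powr (- (?n + s)) * r powr (?n - 1) = r powr (- s - 1)" "r * r powr (- s - 1) = r powr ((1 - s) - 1)"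
        using True powr_add[of r 1 "- s - 1"] by (simp_all flip: powr_add)
      then have "min 1 r * (r powr (- (?n + s)) * r powr (?n - 1)) = (if r \<le> 1 then r powr ((1 - s) - 1) else r powr (- s - 1))"
        by (simp add: min_def)
      moreover have "(min 1 r * r powr (- (?n + s))) * (V * r powr (?n - 1)) = V * (min 1 r * (r powr (- (?n + s)) * r powr (?n - 1)))"
        by (simp only: mult_ac)
      ultimately have "(min 1 r * r powr (- (?n + s))) * (V * r powr (?n - 1)) = V * (if r \<le> 1 then r powr ((1 - s) - 1) else r powr (- s - 1))"
        by simp
      moreover have "V * (if r \<le> 1 then r powr ((1 - s) - 1) else r powr (- s - 1))
         \<le> V * (indicator {0<..1} r * r powr ((1 - s) - 1)) + V * (indicator {1..} r * r powr (- s - 1))"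
        using True V by (auto simp: indicator_def)
      ultimately show ?thesis using True by (simp only: indicator_simps greaterThan_iff if_True mult_1)
    qed (use V in auto)
    then show "ennreal (min 1 r * r powr (- (?n + s))) * ennreal (indicator {0<..} r * (V * r powr (?n - 1)))
      \<le> ennreal V * ennreal (indicator {0<..1} r * r powr ((1 - s) - 1)) + ennreal V * ennreal (indicator {1..} r * r powr (- s - 1))"
      using V by (cases "r > 0") (auto simp: ennreal_mult''[symmetric] ennreal_plus[symmetric] simp del: ennreal_plus intro!: ennreal_leI)
  qed
  also have "\<dots> = ennreal V * ennreal (1 powr (1 - s) / (1 - s)) + ennreal V * ennreal (1 powr (- s) / s)"
    using nn_integral_powr_from_0[of "1 - s" 1] nn_integral_powr_to_inf[of s 1] s
    by (subst nn_integral_add) (auto simp: nn_integral_cmult)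
  also have "\<dots> < \<infinity>" by (simp add: ennreal_mult_less_top)
  finally show "(\<integral>\<^sup>+z. ennreal (min 1 (norm (z::'a)) * norm z powr (- (?n + s))) \<partial>lborel) < \<infinity>" .
qed auto

text \<open>Component \<open>b\<close> of \<open>\<omega> x y *\<^sub>R \<alpha> x y\<close> in the
  increment \<open>z = y - x\<close>, without the factor \<open>C_omega\<close>.\<close>

definition riesz_kernel :: "real \<Rightarrow> 'a \<Rightarrow> 'a::euclidean_space \<Rightarrow> real" where
  "riesz_kernel s b z = norm z powr (- (real DIM('a) + s)) * ((z \<bullet> b) / norm z)"

lemma riesz_kernel_measurable [measurable]: "riesz_kernel s b \<in> borel_measurable borel"
  unfolding riesz_kernel_def[abs_def] by measurable

lemma riesz_kernel_minus: "riesz_kernel s b (- z) = - riesz_kernel s b z"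
  by (simp add: riesz_kernel_def)

lemma abs_riesz_kernel_le:
  assumes "norm b = 1"
  shows "\<bar>riesz_kernel s b (z::'a::euclidean_space)\<bar> \<le> norm z powr (- (real DIM('a) + s))"
proof -
  have "\<bar>(z \<bullet> b) / norm z\<bar> \<le> 1"
    using Cauchy_Schwarz_ineq2[of z b] assms by (simp add: divide_le_eq_1)
  then show ?thesis
    using mult_left_mono[of "\<bar>(z \<bullet> b) / norm z\<bar>" 1 "norm z powr (- (real DIM('a) + s))"]
    unfolding riesz_kernel_def abs_mult by simp
qed

text \<open>A factor that is bounded and vanishes to first order at the origin tames the kernel at
  both ends.\<close>

lemma integrable_riesz_kernel:
  fixes g :: "'a::euclidean_space \<Rightarrow> 'b::{banach, second_countable_topology}"
  assumes s: "0 < s" "s < 1" and b: "norm b = 1" and [measurable]: "g \<in> borel_measurable borel"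
    and g: "\<And>z. norm (g z) \<le> B * min 1 (norm z)"
  shows "integrable lborel (\<lambda>z. riesz_kernel s b z *\<^sub>R g z)"
proof (rule Bochner_Integration.integrable_bound)
  show "integrable lborel (\<lambda>z::'a. B * (min 1 (norm z) * norm z powr (- (real DIM('a) + s))))"
    by (rule integrable_mult_right) (rule integrable_min_norm_powr[OF s])
  have "norm (riesz_kernel s b z *\<^sub>R g z) \<le> \<bar>B * (min 1 (norm z) * norm z powr (- (real DIM('a) + s)))\<bar>" for z
  proof -
    have "norm (riesz_kernel s b z *\<^sub>R g z) \<le> norm z powr (- (real DIM('a) + s)) * (B * min 1 (norm z))"
      unfolding norm_scaleR by (intro mult_mono abs_riesz_kernel_le b g) auto
    then show ?thesis by (simp add: mult_ac)
  qed
  then show "AE z in lborel. norm (riesz_kernel s b z *\<^sub>R g z) \<le> norm (B * (min 1 (norm z) * norm z powr (- (real DIM('a) + s))))"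
    by simp
qed measurable

lemma abs_sin_inner_le: "\<bar>sin (\<xi> \<bullet> z)\<bar> \<le> max 1 (norm \<xi>) * min 1 (norm z)"
proof -
  have "\<bar>sin (\<xi> \<bullet> z)\<bar> \<le> norm \<xi> * norm z"
    using abs_sin_x_le_abs_x[of "\<xi> \<bullet> z"] Cauchy_Schwarz_ineq2[of \<xi> z] by linarith
  also have "\<dots> \<le> max 1 (norm \<xi>) * norm z" by (intro mult_right_mono) auto
  finally have "\<bar>sin (\<xi> \<bullet> z)\<bar> \<le> max 1 (norm \<xi>) * norm z" .
  moreover have "\<bar>sin (\<xi> \<bullet> z)\<bar> \<le> max 1 (norm \<xi>) * 1"
    using abs_sin_le_one[of "\<xi> \<bullet> z"] by (simp add: le_max_iff_disj)
  ultimately show ?thesis by (auto simp: min_def)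
qed

lemma powr_neg_eq_Gamma_integral:
  assumes "a > 0" and z: "(z::'a::euclidean_space) \<noteq> 0"
  shows "has_bochner_integral lborel (\<lambda>t. indicator {0<..} t * (t powr (a - 1) * exp (- (norm z)\<^sup>2 * t))) (Gamma a * norm z powr (- 2 * a))"
proof -
  have "(norm z)\<^sup>2 = norm z powr 2" using z by simp
  then have "((norm z)\<^sup>2) powr (- a) = norm z powr (- 2 * a)" by (simp only: powr_powr) simp
  then show ?thesis
    using nn_integral_Gamma[of a "(norm z)\<^sup>2"] assms
    by (intro has_bochner_integral_nn_integral) auto
qed

text \<open>What \<open>integral_riesz_kernel_sin\<close> produces: the Gamma quotient comes from
  the two integrals over \<open>t\<close>, the powers of \<open>pi\<close> and 2 from the transform
  of the Gaussians. \<open>C_omega\<close> turns out to be its inverse.\<close>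

definition riesz_const :: "nat \<Rightarrow> real \<Rightarrow> real" where
  "riesz_const n s = pi powr (n / 2) * 2 powr (- s) * Gamma ((1 - s) / 2) / Gamma ((n + 1 + s) / 2)"

text \<open>For fixed \<open>t\<close> the sine transform of \<open>z \<bullet> b\<close> times a
  Gaussian is a first Gaussian moment, and the remaining integral over \<open>t\<close> is
  \<open>nn_integral_Gamma_inverse\<close>.\<close>

lemma integral_riesz_kernel_sin:
  fixes \<xi> b :: "'a::euclidean_space"
  assumes s: "0 < s" "s < 1" and b: "b \<in> Basis" and \<xi>: "\<xi> \<noteq> 0"
  shows "(LINT z|lborel. riesz_kernel s b z * sin (\<xi> \<bullet> z)) = riesz_const DIM('a) s * ((\<xi> \<bullet> b) * norm \<xi> powr (s - 1))"
proof -
  let ?n = "real DIM('a)"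
  \<comment> \<open>\<open>2 * a\<close> is \<open>n + s + 1\<close>, where the 1 stems from the
    division by \<open>norm z\<close> in the unit direction.\<close>
  define a where "a = (?n + 1 + s) / 2"
  define c where "c = (norm \<xi>)\<^sup>2 / 4"
  \<comment> \<open>The exponent of \<open>t\<close> left over at the end: \<open>a - 1\<close> from
    the Gamma integral together with \<open>- 1\<close> and \<open>- n / 2\<close> from the moment
    is \<open>- \<alpha> - 1\<close>.\<close>
  define \<alpha> where "\<alpha> = (1 - s) / 2"
  have a: "a > 0" using s by (simp add: a_def add_pos_pos)
  have c: "c > 0" and \<alpha>: "\<alpha> > 0" using \<xi> s by (auto simp: c_def \<alpha>_def)
  define G where "G z t = indicator {0<..} t * (t powr (a - 1) * exp (- (norm z)\<^sup>2 * t))" for z :: 'a and t :: real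
  have [measurable]: "(\<lambda>p. G (fst p) (snd p)) \<in> borel_measurable (borel \<Otimes>\<^sub>M borel)" "G z \<in> borel_measurable borel" for z
    unfolding G_def[abs_def] by measurable
  have G: "has_bochner_integral lborel (G z) (Gamma a * norm z powr (- 2 * a))" if "z \<noteq> 0" for z
    unfolding G_def by (rule powr_neg_eq_Gamma_integral[OF a that])
  let ?w = "\<lambda>z. (z \<bullet> b) * sin (\<xi> \<bullet> z)"
  have ker: "riesz_kernel s b z = (z \<bullet> b) * norm z powr (- 2 * a)" if "z \<noteq> 0" for z
  proof -
    have "norm z powr (- 2 * a) = norm z powr (- (?n + s) + -1)"
      by (rule arg_cong[where f="(powr) (norm z)"]) (simp add: a_def field_simps)
    also have "\<dots> = norm z powr (- (?n + s)) / norm z"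
      unfolding powr_add using that by (simp add: powr_minus_divide)
    finally show ?thesis by (simp add: riesz_kernel_def)
  qed
  have ne: "AE z in (lborel::'a measure). z \<noteq> 0"
    using AE_lborel_singleton[of "0::'a"] by simp
  have int_ker: "integrable lborel (\<lambda>z. riesz_kernel s b z * sin (\<xi> \<bullet> z))"
    using integrable_riesz_kernel[OF s, of b "\<lambda>z. sin (\<xi> \<bullet> z)" "max 1 (norm \<xi>)"] b abs_sin_inner_le[of \<xi>] by simp
  \<comment> \<open>Integrating the absolute value over \<open>t\<close> first restores the kernel
    up to the factor \<open>Gamma a\<close>, and the sine makes that integrable at the
    origin.\<close>
  have pair: "integrable (lborel \<Otimes>\<^sub>M lborel) (\<lambda>(z, t). ?w z * G z t)"
  proof (rule lborel_pair.Fubini_integrable)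
    show "integrable lborel (\<lambda>z. LINT t|lborel. norm (case (z, t) of (z, t) \<Rightarrow> ?w z * G z t))"
    proof (rule integrable_cong_AE_imp)
      show "integrable lborel (\<lambda>z. \<bar>Gamma a * (riesz_kernel s b z * sin (\<xi> \<bullet> z))\<bar>)"
        using int_ker by (intro integrable_abs integrable_mult_right)
      show "AE z in lborel. \<bar>Gamma a * (riesz_kernel s b z * sin (\<xi> \<bullet> z))\<bar> = (LINT t|lborel. norm (case (z, t) of (z, t) \<Rightarrow> ?w z * G z t))"
        using ne
      proof eventually_elim
        case (elim z)
        have "(LINT t|lborel. norm (case (z, t) of (z, t) \<Rightarrow> ?w z * G z t)) = \<bar>?w z\<bar> * (LINT t|lborel. G z t)"
          by (subst integral_mult_right_zero[symmetric]) (auto intro!: Bochner_Integration.integral_cong simp: G_def abs_mult)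
        then show ?case
          using G[OF elim] a by (auto simp: has_bochner_integral_iff ker[OF elim] abs_mult mult_ac)
      qed
    qed measurable
    show "AE z in lborel. integrable lborel (\<lambda>t. case (z, t) of (z, t) \<Rightarrow> ?w z * G z t)"
      using ne by eventually_elim (use G in \<open>auto simp: has_bochner_integral_iff\<close>)
  qed (simp add: split_beta')
  have "Gamma a * (LINT z|lborel. riesz_kernel s b z * sin (\<xi> \<bullet> z)) = (LINT z|lborel. Gamma a * (riesz_kernel s b z * sin (\<xi> \<bullet> z)))"
    by simp
  also have "\<dots> = (LINT z|lborel. (LINT t|lborel. ?w z * G z t))"
  proof (rule Bochner_Integration.integral_cong_AE)
    show "AE z in lborel. Gamma a * (riesz_kernel s b z * sin (\<xi> \<bullet> z)) = (LINT t|lborel. ?w z * G z t)"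
      using ne by eventually_elim (use G in \<open>simp add: has_bochner_integral_iff ker\<close>)
  qed measurable
  also have "\<dots> = (LINT t|lborel. (LINT z|lborel. ?w z * G z t))"
    using pair by (rule lborel_pair.Fubini_integral[symmetric])
  also have "\<dots> = (LINT t|lborel. ((\<xi> \<bullet> b) / 2 * pi powr (?n / 2)) * (indicator {0<..} t * (t powr (- \<alpha> - 1) * exp (- c / t))))"
  proof (rule Bochner_Integration.integral_cong[OF refl])
    fix t :: real
    show "(LINT z|lborel. ?w z * G z t) = ((\<xi> \<bullet> b) / 2 * pi powr (?n / 2)) * (indicator {0<..} t * (t powr (- \<alpha> - 1) * exp (- c / t)))"
    proof (cases "t > 0")
      case True
      have "has_bochner_integral lborel (\<lambda>z. (z \<bullet> b) * exp (- t * (norm z)\<^sup>2) * sin (\<xi> \<bullet> z))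
         ((\<xi> \<bullet> b) / (2 * t) * ((pi / t) powr (?n / 2) * exp (- (norm \<xi>)\<^sup>2 / (4 * t))))"
        using has_bochner_integral_bounded_linear[OF bounded_linear_Im has_bochner_integral_gaussian_moment_euclidean[OF True b, of \<xi>]]
        by simp
      then have "(LINT z|lborel. (z \<bullet> b) * exp (- t * (norm z)\<^sup>2) * sin (\<xi> \<bullet> z)) = (\<xi> \<bullet> b) / (2 * t) * ((pi / t) powr (?n / 2) * exp (- (norm \<xi>)\<^sup>2 / (4 * t)))"
        by (simp only: has_bochner_integral_iff)
      moreover have "?w z * G z t = t powr (a - 1) * ((z \<bullet> b) * exp (- t * (norm z)\<^sup>2) * sin (\<xi> \<bullet> z))" for z
        using True by (simp add: G_def mult_ac)
      ultimately have "(LINT z|lborel. ?w z * G z t) = t powr (a - 1) * ((\<xi> \<bullet> b) / (2 * t) * ((pi / t) powr (?n / 2) * exp (- (norm \<xi>)\<^sup>2 / (4 * t))))"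
        by (simp only: integral_mult_right_zero)
      also have "\<dots> = ((\<xi> \<bullet> b) / 2 * pi powr (?n / 2)) * ((t powr (a - 1) * t powr (-1) * t powr (- (?n / 2))) * exp (- c / t))"
        using True by (simp add: powr_divide powr_minus c_def field_simps)
      also have "t powr (a - 1) * t powr (-1) * t powr (- (?n / 2)) = t powr (- \<alpha> - 1)"
        unfolding powr_add[symmetric] by (rule arg_cong[where f="(powr) t"]) (simp add: a_def \<alpha>_def field_simps)
      finally show ?thesis using True by simp
    qed (simp add: G_def)
  qed
  also have "\<dots> = ((\<xi> \<bullet> b) / 2 * pi powr (?n / 2)) * (Gamma \<alpha> * c powr (- \<alpha>))"
  proof -
    have "has_bochner_integral lborel (\<lambda>t. indicator {0<..} t * (t powr (- \<alpha> - 1) * exp (- c / t))) (Gamma \<alpha> * c powr (- \<alpha>))"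
      using nn_integral_Gamma_inverse[OF \<alpha> c] \<alpha> by (intro has_bochner_integral_nn_integral) auto
    then show ?thesis by (simp add: has_bochner_integral_iff)
  qed
  also have "c powr (- \<alpha>) = norm \<xi> powr (s - 1) * (2 * 2 powr (- s))"
  proof -
    have "c = (norm \<xi> / 2) powr 2" using \<xi> by (simp add: c_def power_divide)
    then have "c powr (- \<alpha>) = (norm \<xi> / 2) powr (2 * (- \<alpha>))" by (simp only: powr_powr)
    also have "2 * (- \<alpha>) = s - 1" by (simp add: \<alpha>_def field_simps)
    also have "(norm \<xi> / 2) powr (s - 1) = norm \<xi> powr (s - 1) * 2 powr (1 + - s)"
    proof -
      have "(2::real) powr (1 + - s) = 2 powr (- (s - 1))" by simp
      also have "\<dots> = 1 / 2 powr (s - 1)" by (rule powr_minus_divide)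
      finally show ?thesis by (simp only: powr_divide) simp
    qed
    also have "2 powr (1 + - s) = (2::real) * 2 powr (- s)" by (subst powr_add) simp
    finally show ?thesis .
  qed
  finally have eq: "Gamma a * (LINT z|lborel. riesz_kernel s b z * sin (\<xi> \<bullet> z))
      = (\<xi> \<bullet> b) / 2 * pi powr (?n / 2) * (Gamma \<alpha> * (norm \<xi> powr (s - 1) * (2 * 2 powr - s)))" .
  have R: "riesz_const DIM('a) s = pi powr (?n / 2) * 2 powr (- s) * Gamma \<alpha> / Gamma a"
    by (simp add: riesz_const_def a_def \<alpha>_def)
  have ne: "Gamma a \<noteq> 0" using Gamma_real_pos[OF a] by linarith
  then have "Gamma a * (riesz_const DIM('a) s * ((\<xi> \<bullet> b) * norm \<xi> powr (s - 1)))
      = (\<xi> \<bullet> b) / 2 * pi powr (?n / 2) * (Gamma \<alpha> * (norm \<xi> powr (s - 1) * (2 * 2 powr - s)))"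
    unfolding R by simp
  then have "Gamma a * (LINT z|lborel. riesz_kernel s b z * sin (\<xi> \<bullet> z)) = Gamma a * (riesz_const DIM('a) s * ((\<xi> \<bullet> b) * norm \<xi> powr (s - 1)))"
    unfolding eq by (rule sym)
  then show ?thesis unfolding mult_cancel_left using ne by blast
qed

text \<open>\<open>t powr (s - 1) * (1 - exp (- c / t))\<close> is the integral of
  \<open>t powr (s - 2) * exp (- v / t)\<close> over \<open>v\<close> from 0 to \<open>c\<close>.
  After the exchange, the integral over \<open>t\<close> is \<open>nn_integral_Gamma_inverse\<close>
  with exponent \<open>1 - s\<close>.\<close>

lemma nn_integral_powr_one_minus_exp:
  assumes s: "0 < s" "s < 1" and c: "c \<ge> (0::real)"
  shows "(\<integral>\<^sup>+t. ennreal (indicator {0<..} t * (t powr (s - 1) * (1 - exp (- c / t)))) \<partial>lborel) = ennreal (Gamma (1 - s) * c powr s / s)"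
proof -
  have "(\<integral>\<^sup>+t. ennreal (indicator {0<..} t * (t powr (s - 1) * (1 - exp (- c / t)))) \<partial>lborel)
      = (\<integral>\<^sup>+t. (\<integral>\<^sup>+v. ennreal (indicator {0<..c} v * (indicator {0<..} t * (t powr (- (1 - s) - 1) * exp (- v / t)))) \<partial>lborel) \<partial>lborel)"
  proof (rule nn_integral_cong)
    fix t :: real
    show "ennreal (indicator {0<..} t * (t powr (s - 1) * (1 - exp (- c / t))))
       = (\<integral>\<^sup>+v. ennreal (indicator {0<..c} v * (indicator {0<..} t * (t powr (- (1 - s) - 1) * exp (- v / t)))) \<partial>lborel)"
    proof (cases "t > 0")
      case True
      have "(\<integral>\<^sup>+v. ennreal (indicator {0<..c} v * (indicator {0<..} t * (t powr (- (1 - s) - 1) * exp (- v / t)))) \<partial>lborel)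
          = (\<integral>\<^sup>+v. ennreal (t powr (- (1 - s) - 1) * exp (- v / t)) * indicator {0..c} v \<partial>lborel)"
        using AE_lborel_singleton[of 0] True
        by (intro nn_integral_cong_AE) (auto simp: indicator_def elim!: eventually_mono)
      also have "\<dots> = ennreal (- (t powr (s - 1)) * exp (- c / t) - (- (t powr (s - 1)) * exp (- 0 / t)))"
      proof (rule nn_integral_FTC_Icc)
        have "t powr (s - 1) / t = t powr (- (1 - s) - 1)"
          using True by (simp add: powr_diff power2_eq_square)
        then show "((\<lambda>v. - (t powr (s - 1)) * exp (- v / t)) has_real_derivative t powr (- (1 - s) - 1) * exp (- v / t)) (at v)" for v
        proof -
          have "((\<lambda>v. - (t powr (s - 1)) * exp (- v / t)) has_real_derivative - (t powr (s - 1)) * (exp (- v / t) * (- 1 / t))) (at v)"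
            using True by (auto intro!: derivative_eq_intros)
          moreover have "- (t powr (s - 1)) * (exp (- v / t) * (- 1 / t)) = t powr (s - 1) / t * exp (- v / t)" by simp
          ultimately show ?thesis
            unfolding \<open>t powr (s - 1) / t = t powr (- (1 - s) - 1)\<close> by simp
        qed
      qed (use c True in auto)
      finally show ?thesis using True by (simp add: algebra_simps)
    qed simp
  qed
  also have "\<dots> = (\<integral>\<^sup>+v. (\<integral>\<^sup>+t. ennreal (indicator {0<..c} v * (indicator {0<..} t * (t powr (- (1 - s) - 1) * exp (- v / t)))) \<partial>lborel) \<partial>lborel)"
    by (rule lborel_pair.Fubini') measurable
  also have "\<dots> = (\<integral>\<^sup>+v. ennreal (Gamma (1 - s)) * ennreal (indicator {0<..c} v * v powr (s - 1)) \<partial>lborel)"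
  proof (rule nn_integral_cong)
    fix v :: real
    show "(\<integral>\<^sup>+t. ennreal (indicator {0<..c} v * (indicator {0<..} t * (t powr (- (1 - s) - 1) * exp (- v / t)))) \<partial>lborel)
       = ennreal (Gamma (1 - s)) * ennreal (indicator {0<..c} v * v powr (s - 1))"
      using nn_integral_Gamma_inverse[of "1 - s" v] s
      by (cases "v \<in> {0<..c}") (auto simp: ennreal_mult''[symmetric])
  qed
  also have "\<dots> = ennreal (Gamma (1 - s)) * ennreal (c powr s / s)"
    using nn_integral_powr_from_0[of s c] s c by (subst nn_integral_cmult) auto
  finally show ?thesis using s by (simp add: ennreal_mult''[symmetric])
qed

text \<open>\<open>Gamma\<close> is negative at \<open>- s\<close>, and the functional equation
  \<open>Gamma (1 - s) = - s * Gamma (- s)\<close> resolves the absolute value in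
  \<open>C_ns\<close>.\<close>

lemma
  assumes "0 < s" "s < 1"
  shows C_ns_pos: "C_ns n s > 0"
    and C_ns_eq: "C_ns n s = s * 4 powr s * Gamma (n / 2 + s) / (pi powr (n / 2) * Gamma (1 - s))"
proof -
  have "- s \<notin> \<int>"
  proof
    assume "- s \<in> \<int>"
    then obtain k where "- s = of_int k" by (elim Ints_cases)
    then have "- 1 < k" "k < 0" using assms by linarith+
    then show False by simp
  qed
  then have "- s \<notin> \<int>\<^sub>\<le>\<^sub>0" by auto
  then have "Gamma (1 - s) = - s * Gamma (- s)" using Gamma_plus1[of "- s"] by (simp add: add.commute)
  moreover have "Gamma (1 - s) > 0" using assms by simp
  ultimately have *: "\<bar>Gamma (- s)\<bar> = Gamma (1 - s) / s" using assms by (auto simp: zero_less_mult_iff mult_less_0_iff abs_if field_simps)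
  show "C_ns n s = s * 4 powr s * Gamma (n / 2 + s) / (pi powr (n / 2) * Gamma (1 - s))"
    unfolding C_ns_def * using assms by (simp add: add.commute field_simps)
  then show "C_ns n s > 0"
    using assms by (auto intro!: divide_pos_pos mult_pos_pos Gamma_real_pos add_nonneg_pos)
qed

text \<open>The symbol of the fractional Laplacian, up to its constant. The Gamma integral again
  replaces the power of \<open>norm z\<close>; the integrand is nonnegative, so Tonelli exchanges
  the integrals.\<close>

lemma nn_integral_cos_kernel:
  fixes \<xi> :: "'a::euclidean_space"
  assumes s: "0 < s" "s < 1"
  shows "(\<integral>\<^sup>+z. ennreal ((1 - cos (\<xi> \<bullet> z)) / norm z powr (real DIM('a) + 2 * s)) \<partial>lborel)
     = ennreal (norm \<xi> powr (2 * s) / C_ns DIM('a) s)"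
proof -
  let ?n = "real DIM('a)"
  define a where "a = ?n / 2 + s"
  define c where "c = (norm \<xi>)\<^sup>2 / 4"
  have a: "a > 0" using s by (simp add: a_def add_nonneg_pos)
  have c: "c \<ge> 0" by (simp add: c_def)
  define G where "G z t = indicator {0<..} t * (t powr (a - 1) * exp (- (norm z)\<^sup>2 * t))" for z :: 'a and t :: real
  have [measurable]: "(\<lambda>p. G (fst p) (snd p)) \<in> borel_measurable (borel \<Otimes>\<^sub>M borel)" "(\<lambda>p. G (snd p) (fst p)) \<in> borel_measurable (borel \<Otimes>\<^sub>M borel)" "G z \<in> borel_measurable borel" for z
    unfolding G_def[abs_def] by measurable
  have "ennreal (Gamma a) * (\<integral>\<^sup>+z. ennreal ((1 - cos (\<xi> \<bullet> z)) / norm z powr (?n + 2 * s)) \<partial>lborel)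
     = (\<integral>\<^sup>+z. ennreal (Gamma a) * ennreal ((1 - cos (\<xi> \<bullet> z)) / norm z powr (?n + 2 * s)) \<partial>lborel)"
    by (rule nn_integral_cmult[symmetric]) measurable
  also have "\<dots> = (\<integral>\<^sup>+z. (\<integral>\<^sup>+t. ennreal ((1 - cos (\<xi> \<bullet> z)) * G z t) \<partial>lborel) \<partial>lborel)"
  proof (rule nn_integral_cong)
    fix z :: 'a
    show "ennreal (Gamma a) * ennreal ((1 - cos (\<xi> \<bullet> z)) / norm z powr (?n + 2 * s)) = (\<integral>\<^sup>+t. ennreal ((1 - cos (\<xi> \<bullet> z)) * G z t) \<partial>lborel)"
    proof (cases "z = 0")
      case False
      have "(\<integral>\<^sup>+t. ennreal (G z t) \<partial>lborel) = ennreal (Gamma a * norm z powr (- 2 * a))"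
      proof -
        have "has_bochner_integral lborel (G z) (Gamma a * norm z powr (- 2 * a))"
          unfolding G_def by (rule powr_neg_eq_Gamma_integral[OF a False])
        moreover have "AE t in lborel. 0 \<le> G z t" by (simp add: G_def)
        ultimately show ?thesis by (simp add: has_bochner_integral_iff nn_integral_eq_integral)
      qed
      then have "(\<integral>\<^sup>+t. ennreal (1 - cos (\<xi> \<bullet> z)) * ennreal (G z t) \<partial>lborel) = ennreal (1 - cos (\<xi> \<bullet> z)) * ennreal (Gamma a * norm z powr (- 2 * a))"
        by (subst nn_integral_cmult) auto
      moreover have "norm z powr (- 2 * a) = 1 / norm z powr (?n + 2 * s)"
      proof -
        have "- 2 * a = - (?n + 2 * s)" by (simp add: a_def)
        then show ?thesis by (simp only: powr_minus_divide)
      qed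
      ultimately show ?thesis using a by (simp add: ennreal_mult''[symmetric] ennreal_mult'[symmetric] G_def mult_ac)
    qed simp
  qed
  also have "\<dots> = (\<integral>\<^sup>+t. (\<integral>\<^sup>+z. ennreal ((1 - cos (\<xi> \<bullet> z)) * G z t) \<partial>lborel) \<partial>lborel)"
    by (rule lborel_pair.Fubini') measurable
  also have "\<dots> = (\<integral>\<^sup>+t. ennreal (pi powr (?n / 2)) * ennreal (indicator {0<..} t * (t powr (s - 1) * (1 - exp (- c / t)))) \<partial>lborel)"
  proof (rule nn_integral_cong)
    fix t :: real
    show "(\<integral>\<^sup>+z. ennreal ((1 - cos (\<xi> \<bullet> z)) * G z t) \<partial>lborel) = ennreal (pi powr (?n / 2)) * ennreal (indicator {0<..} t * (t powr (s - 1) * (1 - exp (- c / t))))"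
    proof (cases "t > 0")
      case True
      have "has_bochner_integral lborel (\<lambda>z. exp (- t * (norm z)\<^sup>2) * cos (\<xi> \<bullet> z)) ((pi / t) powr (?n / 2) * exp (- (norm \<xi>)\<^sup>2 / (4 * t)))"
        using has_bochner_integral_bounded_linear[OF bounded_linear_Re has_bochner_integral_gaussian_euclidean[OF True, of \<xi>]] by simp
      from has_bochner_integral_diff[OF has_bochner_integral_gaussian_real[OF True] this]
      have "has_bochner_integral lborel (\<lambda>z. t powr (a - 1) * (exp (- t * (norm z)\<^sup>2) - exp (- t * (norm z)\<^sup>2) * cos (\<xi> \<bullet> z)))
         (t powr (a - 1) * ((pi / t) powr (?n / 2) - (pi / t) powr (?n / 2) * exp (- (norm \<xi>)\<^sup>2 / (4 * t))))"
        by (rule has_bochner_integral_mult_right)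
      moreover have "t powr (a - 1) * (exp (- t * (norm z)\<^sup>2) - exp (- t * (norm z)\<^sup>2) * cos (\<xi> \<bullet> z)) = (1 - cos (\<xi> \<bullet> z)) * G z t" for z
        using True by (simp add: G_def algebra_simps)
      moreover have "t powr (a - 1) * ((pi / t) powr (?n / 2) - (pi / t) powr (?n / 2) * exp (- (norm \<xi>)\<^sup>2 / (4 * t)))
         = pi powr (?n / 2) * (t powr (s - 1) * (1 - exp (- c / t)))"
      proof -
        have "t powr (a - 1) = t powr (s - 1) * t powr (?n / 2)"
          unfolding powr_add[symmetric] by (simp add: a_def algebra_simps)
        then show ?thesis using True by (simp add: powr_divide c_def field_simps)
      qed
      ultimately have "has_bochner_integral lborel (\<lambda>z. (1 - cos (\<xi> \<bullet> z)) * G z t) (pi powr (?n / 2) * (t powr (s - 1) * (1 - exp (- c / t))))"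
        by simp
      then have "(\<integral>\<^sup>+z. ennreal ((1 - cos (\<xi> \<bullet> z)) * G z t) \<partial>lborel) = ennreal (pi powr (?n / 2) * (t powr (s - 1) * (1 - exp (- c / t))))"
        by (subst nn_integral_eq_integral) (auto simp: has_bochner_integral_iff G_def)
      then show ?thesis using True c by (simp add: ennreal_mult'[symmetric])
    qed (simp add: G_def)
  qed
  also have "\<dots> = ennreal (pi powr (?n / 2)) * ennreal (Gamma (1 - s) * c powr s / s)"
    using nn_integral_powr_one_minus_exp[OF s c] by (subst nn_integral_cmult) auto
  also have "\<dots> = ennreal (Gamma a) * ennreal (norm \<xi> powr (2 * s) / C_ns DIM('a) s)"
  proof -
    have "c powr s = norm \<xi> powr (2 * s) / 4 powr s"
    proof (cases "\<xi> = 0")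
      case False
      have "c = norm \<xi> powr 2 / 4" using False by (simp add: c_def)
      then show ?thesis by (simp only: powr_divide powr_powr)
    qed (simp add: c_def)
    then have "pi powr (?n / 2) * (Gamma (1 - s) * c powr s / s) = Gamma a * (norm \<xi> powr (2 * s) / C_ns DIM('a) s)"
    proof -
      have C: "C_ns DIM('a) s = s * 4 powr s * Gamma a / (pi powr (?n / 2) * Gamma (1 - s))"
        unfolding a_def by (rule C_ns_eq[OF s])
      have "Gamma a \<noteq> 0" "Gamma (1 - s) \<noteq> 0" using Gamma_real_pos[OF a] Gamma_real_pos[of "1 - s"] s by linarith+
      then show ?thesis unfolding C \<open>c powr s = _\<close> using s by (simp add: field_simps)
    qed
    moreover have "norm \<xi> powr (2 * s) / C_ns DIM('a) s \<ge> 0" using C_ns_pos[OF s, of "DIM('a)"] by simp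
    ultimately show ?thesis using a s by (simp add: ennreal_mult'[symmetric] ennreal_mult''[symmetric])
  qed
  finally have eq: "ennreal (Gamma a) * (\<integral>\<^sup>+z. ennreal ((1 - cos (\<xi> \<bullet> z)) / norm z powr (?n + 2 * s)) \<partial>lborel)
      = ennreal (Gamma a) * ennreal (norm \<xi> powr (2 * s) / C_ns DIM('a) s)" .
  then show ?thesis
    using Gamma_real_pos[OF a] by (subst (asm) ennreal_mult_cancel_left) auto
qed

section \<open>Moments of the unit sphere and the constant \<open>C_omega\<close>\<close>

lemma AE_lborel_norm_neq: "AE x in lborel. norm (x::'a::euclidean_space) \<noteq> r"
proof -
  have "AE x in lebesgue. x \<notin> sphere (0::'a) r"
    by (rule AE_not_in) (simp flip: negligible_iff_null_sets add: negligible_sphere)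
  then show ?thesis by (simp add: AE_completion_iff)
qed

text \<open>The integral of
  \<open>\<bar>x \<bullet> b\<bar> powr q * exp (- (norm x)\<^sup>2)\<close> is computed twice. In
  polar coordinates the unknown ball integral appears as a factor next to a Gamma value; in
  Cartesian coordinates the result is \<open>nn_integral_powr_component_gaussian\<close>.\<close>

lemma nn_integral_ball_sgn_component:
  fixes b :: "'a::euclidean_space" and q :: real
  assumes b: "b \<in> Basis" and q: "q > 0"
  shows "(\<integral>\<^sup>+x. ennreal (indicator (ball 0 1) x * \<bar>sgn x \<bullet> b\<bar> powr q) \<partial>lborel)
     = ennreal (2 * (Gamma ((q + 1) / 2) * pi powr ((real DIM('a) - 1) / 2)) / (DIM('a) * Gamma ((DIM('a) + q) / 2)))"
proof -
  let ?n = "real DIM('a)"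
  define f where "f x = \<bar>sgn x \<bullet> b\<bar> powr q" for x :: 'a
  have [measurable]: "f \<in> borel_measurable borel" unfolding f_def[abs_def] sgn_div_norm by measurable
  let ?I = "\<integral>\<^sup>+x. ennreal (f x) * indicator (ball 0 1) x \<partial>lborel"
  have f1: "f x \<le> 1" "0 \<le> f x" for x
  proof -
    have "\<bar>sgn x \<bullet> b\<bar> \<le> 1"
      using Cauchy_Schwarz_ineq2[of "sgn x" b] b by (auto simp: norm_sgn split: if_splits)
    then show "f x \<le> 1" unfolding f_def using powr_mono2[of q "\<bar>sgn x \<bullet> b\<bar>" 1] q by simp
  qed (simp add: f_def)
  have "?I \<le> (\<integral>\<^sup>+x. indicator (ball (0::'a) 1) x \<partial>lborel)"
    using f1 by (intro nn_integral_mono) (auto simp: indicator_def)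
  also have "\<dots> = emeasure lborel (ball (0::'a) 1)" by (rule nn_integral_indicator) auto
  also have "\<dots> < \<infinity>" using emeasure_lborel_ball_finite[of "0::'a" 1] by simp
  finally obtain k where k: "k \<ge> 0" "?I = ennreal k" by (cases ?I) auto
  let ?M = "density lborel (\<lambda>x. ennreal (f x))"
  \<comment> \<open>\<open>f\<close> is homogeneous of degree 0, so by scaling a ball of radius
    \<open>r\<close> has mass \<open>k * r powr n\<close>, as \<open>nn_integral_homogeneous\<close>
    requires of the weighted measure.\<close>
  have level: "emeasure ?M {x \<in> space ?M. norm x \<le> r} = ennreal (k * r powr ?n)" if r: "r > 0" for r
  proof -
    have "emeasure ?M {x \<in> space ?M. norm x \<le> r} = (\<integral>\<^sup>+x. ennreal (f x) * indicator {x. norm x \<le> r} x \<partial>lborel)"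
      by (subst emeasure_density) auto
    also have "\<dots> = ennreal (\<bar>r\<bar> ^ DIM('a)) * (\<integral>\<^sup>+x. ennreal (f (0 + r *\<^sub>R x)) * indicator {x. norm x \<le> r} (0 + r *\<^sub>R x) \<partial>lborel)"
      using r by (intro nn_integral_lborel_affine) auto
    also have "(\<integral>\<^sup>+x. ennreal (f (0 + r *\<^sub>R x)) * indicator {x. norm x \<le> r} (0 + r *\<^sub>R x) \<partial>lborel) = ?I"
      \<comment> \<open>Sublevel sets of the norm are closed balls whereas \<open>?I\<close> uses
        the open one; they differ by a null sphere.\<close>
      using AE_lborel_norm_neq[of 1] r
      by (intro nn_integral_cong_AE) (auto simp: f_def sgn_scaleR indicator_def elim!: eventually_mono)
    finally show ?thesis using r k by (simp add: ennreal_mult''[symmetric] powr_realpow mult.commute)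
  qed
  have "(\<integral>\<^sup>+x. ennreal (norm x powr q * exp (- (norm x)\<^sup>2)) \<partial>?M)
     = (\<integral>\<^sup>+r. ennreal (r powr q * exp (- r\<^sup>2)) * ennreal (indicator {0<..} r * (k * ?n * r powr (?n - 1))) \<partial>lborel)"
  proof (rule nn_integral_homogeneous)
    show "AE x in ?M. 0 < norm x"
      using AE_lborel_singleton[of "0::'a"] by (subst AE_density) (auto elim!: eventually_mono)
  qed (use k level in auto)
  also have "\<dots> = (\<integral>\<^sup>+r. ennreal (k * ?n) * ennreal (indicator {0<..} r * (r powr ((?n + q) - 1) * exp (- r\<^sup>2))) \<partial>lborel)"
  proof (rule nn_integral_cong)
    fix r :: real
    have "(r powr q * exp (- r\<^sup>2)) * (indicator {0<..} r * (k * ?n * r powr (?n - 1)))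
        = (k * ?n) * (indicator {0<..} r * ((r powr q * r powr (?n - 1)) * exp (- r\<^sup>2)))"
      by (simp only: mult_ac)
    also have "r powr q * r powr (?n - 1) = r powr ((?n + q) - 1)"
      unfolding powr_add[symmetric] by (rule arg_cong[where f="(powr) r"]) simp
    finally show "ennreal (r powr q * exp (- r\<^sup>2)) * ennreal (indicator {0<..} r * (k * ?n * r powr (?n - 1)))
        = ennreal (k * ?n) * ennreal (indicator {0<..} r * (r powr ((?n + q) - 1) * exp (- r\<^sup>2)))"
      using k by (subst (1 2) ennreal_mult''[symmetric]) auto
  qed
  also have "\<dots> = ennreal (k * ?n) * ennreal (Gamma ((?n + q) / 2) / 2)"
    using nn_integral_powr_exp_square[of "?n + q"] q by (subst nn_integral_cmult) (auto simp: add_nonneg_pos)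
  finally have 1: "(\<integral>\<^sup>+x. ennreal (norm x powr q * exp (- (norm x)\<^sup>2)) \<partial>?M) = ennreal (k * ?n * (Gamma ((?n + q) / 2) / 2))"
    using k by (simp add: ennreal_mult'[symmetric])
  have "(\<integral>\<^sup>+x. ennreal (norm x powr q * exp (- (norm x)\<^sup>2)) \<partial>?M)
     = (\<integral>\<^sup>+x. ennreal (f x) * ennreal (norm x powr q * exp (- (norm x)\<^sup>2)) \<partial>lborel)"
    by (rule nn_integral_density) auto
  also have "\<dots> = (\<integral>\<^sup>+x. ennreal (\<bar>x \<bullet> b\<bar> powr ((q + 1) - 1) * exp (- (norm x)\<^sup>2)) \<partial>lborel)"
  proof (rule nn_integral_cong)
    fix x :: 'a
    have "f x * norm x powr q = \<bar>x \<bullet> b\<bar> powr q"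
    proof (cases "x = 0")
      case False
      then have "\<bar>sgn x \<bullet> b\<bar> * norm x = \<bar>x \<bullet> b\<bar>" by (simp add: sgn_div_norm abs_mult)
      then show ?thesis by (simp add: f_def flip: powr_mult)
    qed (simp add: f_def)
    then show "ennreal (f x) * ennreal (norm x powr q * exp (- (norm x)\<^sup>2)) = ennreal (\<bar>x \<bullet> b\<bar> powr ((q + 1) - 1) * exp (- (norm x)\<^sup>2))"
      using f1(2) by (simp add: ennreal_mult''[symmetric] mult.assoc[symmetric])
  qed
  also have "\<dots> = ennreal (Gamma ((q + 1) / 2) * pi powr ((?n - 1) / 2))"
    using nn_integral_powr_component_gaussian[OF b, of "q + 1"] q by simp
  finally have "k * ?n * (Gamma ((?n + q) / 2) / 2) = Gamma ((q + 1) / 2) * pi powr ((?n - 1) / 2)"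
    unfolding 1 using k q by (subst (asm) ennreal_inj) (auto intro!: mult_nonneg_nonneg divide_nonneg_pos Gamma_real_nonneg)
  moreover have "Gamma ((?n + q) / 2) > 0" using q by (simp add: add_nonneg_pos)
  ultimately have "k = 2 * (Gamma ((q + 1) / 2) * pi powr ((?n - 1) / 2)) / (?n * Gamma ((?n + q) / 2))"
    by (simp add: field_simps)
  moreover have "(\<integral>\<^sup>+x. ennreal (indicator (ball 0 1) x * \<bar>sgn x \<bullet> b\<bar> powr q) \<partial>lborel) = ?I"
    by (intro nn_integral_cong) (auto simp: f_def indicator_def)
  ultimately show ?thesis using k by simp
qed

text \<open>Unfolded, the sphere integral is \<open>n\<close> times an integral over half of the
  unit ball. Reflection at the origin completes it to the whole ball; points with
  \<open>\<theta> $ i = 0\<close> belong to both halves but carry the value 0.\<close>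

lemma half_sphere_integral:
  fixes i :: "'n::finite" and q :: real
  assumes q: "q > 0"
  shows "(LINT \<theta>:{\<theta>::real^'n. \<theta> $ i \<ge> 0}|sphere_measure. \<bar>\<theta> $ i\<bar> powr q)
    = Gamma ((q + 1) / 2) * pi powr ((real CARD('n) - 1) / 2) / Gamma ((CARD('n) + q) / 2)"
proof -
  let ?n = "real CARD('n)"
  define J where "J = Gamma ((q + 1) / 2) * pi powr ((?n - 1) / 2) / Gamma ((?n + q) / 2)"
  have J: "J \<ge> 0" unfolding J_def using q by (intro divide_nonneg_pos mult_nonneg_nonneg Gamma_real_pos) (auto simp: add_nonneg_pos)
  have [measurable]: "(sgn :: real^'n \<Rightarrow> real^'n) \<in> borel_measurable borel"
    unfolding sgn_div_norm[abs_def] by measurable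
  define w where "w \<theta> = indicator {\<theta>. \<theta> $ i \<ge> 0} \<theta> * \<bar>\<theta> $ i\<bar> powr q" for \<theta> :: "real^'n"
  have [measurable]: "w \<in> borel_measurable borel" unfolding w_def[abs_def] by measurable
  define g where "g x = ennreal (indicator (ball 0 1) x * w (sgn x))" for x :: "real^'n"
  have [measurable]: "g \<in> borel_measurable borel" unfolding g_def[abs_def]
    by (intro measurable_compose[OF _ measurable_ennreal] borel_measurable_times borel_measurable_indicator measurable_compose[of sgn borel borel w]) auto
  have "(\<integral>\<^sup>+\<theta>. ennreal (w \<theta>) \<partial>sphere_measure) = (\<integral>\<^sup>+x. ennreal ?n * g x \<partial>lborel)"
    unfolding sphere_measure_def
    by (simp add: nn_integral_distr nn_integral_density g_def indicator_def)
       (intro nn_integral_cong, auto)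
  also have "\<dots> = ennreal ?n * (\<integral>\<^sup>+x. g x \<partial>lborel)" by (rule nn_integral_cmult) auto
  finally have 1: "(\<integral>\<^sup>+\<theta>. ennreal (w \<theta>) \<partial>sphere_measure) = ennreal ?n * (\<integral>\<^sup>+x. g x \<partial>lborel)" .
  have "(\<integral>\<^sup>+x. g x \<partial>lborel) + (\<integral>\<^sup>+x. g x \<partial>lborel) = (\<integral>\<^sup>+x. g x \<partial>lborel) + (\<integral>\<^sup>+x. g (0 - x) \<partial>lborel)"
    by (subst nn_integral_lborel_reflect[of g 0]) auto
  also have "\<dots> = (\<integral>\<^sup>+x. g x + g (0 - x) \<partial>lborel)" by (rule nn_integral_add[symmetric]) auto
  also have "\<dots> = (\<integral>\<^sup>+x. ennreal (indicator (ball 0 1) x * \<bar>sgn x \<bullet> (axis i 1 :: real^'n)\<bar> powr q) \<partial>lborel)"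
  proof (rule nn_integral_cong)
    fix x :: "real^'n"
    have "sgn x $ i = sgn x \<bullet> axis i 1" by (simp add: inner_axis)
    then show "g x + g (0 - x) = ennreal (indicator (ball 0 1) x * \<bar>sgn x \<bullet> (axis i 1 :: real^'n)\<bar> powr q)"
      by (auto simp: g_def w_def indicator_def sgn_minus)
  qed
  also have "\<dots> = ennreal (2 * (J / ?n))"
    using nn_integral_ball_sgn_component[of "axis i 1 :: real^'n", OF _ q] unfolding J_def by (simp add: field_simps)
  also have "\<dots> = ennreal 2 * ennreal (J / ?n)" by (rule ennreal_mult') simp
  also have "ennreal 2 = 2" by simp
  finally have "2 * (\<integral>\<^sup>+x. g x \<partial>lborel) = 2 * ennreal (J / ?n)"
    by (simp only: mult_2)
  then have "(\<integral>\<^sup>+x. g x \<partial>lborel) = ennreal (J / ?n)"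
    by (subst (asm) ennreal_mult_cancel_left) auto
  with 1 J have "(\<integral>\<^sup>+\<theta>. ennreal (w \<theta>) \<partial>sphere_measure) = ennreal J"
    by (simp add: ennreal_mult''[symmetric])
  then have "has_bochner_integral sphere_measure w J"
    using J by (intro has_bochner_integral_nn_integral) (auto simp: w_def sphere_measure_def)
  then show ?thesis
    unfolding set_lebesgue_integral_def J_def w_def by (simp add: has_bochner_integral_iff)
qed

text \<open>The explicit \<open>C_omega\<close> is the right normalization. The half sphere moment
  contributes \<open>Gamma (1 + s / 2)\<close>, the reflection formula at \<open>s / 2\<close>
  eliminates the sine, and the duplication formula at \<open>(1 - s) / 2\<close> relates
  \<open>Gamma ((1 - s) / 2)\<close> to \<open>Gamma (1 - s)\<close>.\<close>

lemma C_omega_riesz_const: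
  fixes i :: "'n::finite"
  assumes s: "0 < s" "s < 1"
  shows "C_omega i s * riesz_const CARD('n) s = 1"
proof -
  let ?n = "real CARD('n)"
  define g where "g = Gamma ((?n + 1 + s) / 2)"
  define p where "p = pi powr ((?n - 1) / 2)"
  have g: "g > 0" using s by (simp add: g_def add_nonneg_pos)
  have p: "p > 0" by (simp add: p_def)
  have pn: "pi powr (?n / 2) = p * sqrt pi"
    unfolding p_def by (simp add: powr_half_sqrt[symmetric] powr_add[symmetric] field_simps)
  have J: "(LINT \<theta>:{\<theta>::real^'n. \<theta> $ i \<ge> 0}|sphere_measure. \<bar>\<theta> $ i\<bar> powr (s + 1)) = Gamma (1 + s / 2) * p / g"
  proof -
    have *: "(s + 1 + 1) / 2 = 1 + s / 2" "(?n + (s + 1)) / 2 = (?n + 1 + s) / 2" by (simp_all add: field_simps)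
    have "s + 1 > 0" using s by simp
    from half_sphere_integral[OF this, of i] show ?thesis unfolding * p_def g_def .
  qed
  have leg: "Gamma ((1 - s) / 2) * Gamma (1 - s / 2) = 2 powr s * sqrt pi * Gamma (1 - s)"
  proof -
    define a where "a = (1 - s) / 2"
    have a: "1 - s / 2 = a + 1 / 2" "1 - s = 2 * a" "a > 0" using s by (auto simp: a_def field_simps)
    have "complex_of_real x \<notin> \<int>\<^sub>\<le>\<^sub>0" if "x > 0" for x
      using that by (auto simp: complex_eq_iff elim!: nonpos_Ints_cases)
    from this[of a] this[of "a + 1 / 2"]
    have *: "Gamma (complex_of_real a) * Gamma (complex_of_real a + 1 / 2)
        = exp ((1 - 2 * complex_of_real a) * of_real (ln 2)) * of_real (sqrt pi) * Gamma (2 * complex_of_real a)"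
      using a(3) by (intro Gamma_legendre_duplication) auto
    have e: "complex_of_real a + 1 / 2 = of_real (a + 1 / 2)" "2 * complex_of_real a = of_real (2 * a)"
      "(1 - 2 * complex_of_real a) * of_real (ln 2) = of_real ((1 - 2 * a) * ln 2)" by simp_all
    have "complex_of_real (Gamma a * Gamma (a + 1 / 2)) = of_real (exp ((1 - 2 * a) * ln 2) * sqrt pi * Gamma (2 * a))"
      using *[unfolded e(3), unfolded e(1,2)]
      unfolding of_real_mult[of "Gamma a"] of_real_mult[of _ "Gamma (2 * a)"] of_real_mult[of _ "sqrt pi"]
        Gamma_complex_of_real[symmetric] exp_of_real[symmetric] .
    then have "Gamma a * Gamma (a + 1 / 2) = exp ((1 - 2 * a) * ln 2) * sqrt pi * Gamma (2 * a)"
      by (simp only: of_real_eq_iff)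
    moreover have "exp ((1 - 2 * a) * ln 2) = 2 powr s" by (simp add: powr_def a_def field_simps)
    ultimately show ?thesis unfolding a_def[symmetric] unfolding a(1,2) by simp
  qed
  have refl: "Gamma (s / 2) * Gamma (1 - s / 2) = pi / sin (pi * s / 2)"
  proof -
    have "Gamma (complex_of_real (s / 2)) * Gamma (complex_of_real (1 - s / 2)) = complex_of_real pi / sin (complex_of_real (pi * (s / 2)))"
      by (simp only: of_real_diff of_real_1 of_real_mult Gamma_reflection_complex)
    then have "Gamma (s / 2) * Gamma (1 - s / 2) = pi / sin (pi * (s / 2))"
      unfolding Gamma_complex_of_real sin_of_real of_real_mult[symmetric] of_real_divide[symmetric] of_real_eq_iff .
    then show ?thesis by simp
  qed
  have gs: "Gamma (1 + s / 2) = s / 2 * Gamma (s / 2)"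
  proof -
    have "s / 2 \<notin> \<int>\<^sub>\<le>\<^sub>0" using s by (auto elim!: nonpos_Ints_cases)
    from Gamma_plus1[OF this] show ?thesis by (simp add: add.commute)
  qed
  have pos: "Gamma (s / 2) > 0" "Gamma (1 - s / 2) > 0" "Gamma (1 - s) > 0" using s by auto
  have sn: "sin (pi * s / 2) > 0" using s by (intro sin_gt_zero) auto
  \<comment> \<open>Letters stand for the Gamma values, the sine and the powers, so that clearing
    the fractions leaves those terms intact.\<close>
  have cancel: "s / (2 * a * c) * inverse (s / 2 * d * p / g) * (p * q * r * h / g) = (q * (r * h)) / (a * (c * d))"
    if "a \<noteq> 0" "c \<noteq> 0" "d \<noteq> 0" for a c d q r h
    using that s p g by (simp add: divide_simps)
  have "sin (pi * s / 2) * Gamma (s / 2) = pi / Gamma (1 - s / 2)"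
    using refl pos sn by (simp add: field_simps)
  moreover have "2 powr (- s) * Gamma ((1 - s) / 2) = sqrt pi * Gamma (1 - s) / Gamma (1 - s / 2)"
  proof -
    have "2 powr s * (2 powr (- s) * Gamma ((1 - s) / 2) * Gamma (1 - s / 2)) = 2 powr s * (sqrt pi * Gamma (1 - s))"
      unfolding mult.assoc leg by (simp add: powr_minus)
    then have "2 powr (- s) * Gamma ((1 - s) / 2) * Gamma (1 - s / 2) = sqrt pi * Gamma (1 - s)" by simp
    then show ?thesis using pos(2) by (simp add: eq_divide_eq)
  qed
  ultimately have "C_omega i s * riesz_const CARD('n) s
      = (sqrt pi * (sqrt pi * Gamma (1 - s) / Gamma (1 - s / 2))) / (Gamma (1 - s) * (pi / Gamma (1 - s / 2)))"
    unfolding C_omega_def J riesz_const_def pn g_def[symmetric] gs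
    using cancel[of "Gamma (1 - s)" "sin (pi * s / 2)" "Gamma (s / 2)" "sqrt pi" "2 powr (- s)" "Gamma ((1 - s) / 2)"] pos sn
    by simp
  also have "\<dots> = 1" using pos by simp
  finally show ?thesis .
qed

section \<open>The Gagliardo seminorm and the nonlocal gradient in Fourier variables\<close>

lemma norm_cis_minus_1_sq: "(norm (cis \<theta> - 1))\<^sup>2 = 2 * (1 - cos \<theta>)"
proof -
  have "(norm (cis \<theta> - 1))\<^sup>2 = (cos \<theta> - 1)\<^sup>2 + (sin \<theta>)\<^sup>2" by (simp add: cmod_power2)
  also have "\<dots> = 2 * (1 - cos \<theta>)"
    using sin_cos_squared_add[of \<theta>] by (simp add: power2_diff)
  finally show ?thesis .
qed

definition spectral_energy :: "real \<Rightarrow> ('a::euclidean_space \<Rightarrow> complex) \<Rightarrow> ennreal" where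
  "spectral_energy s F = (\<integral>\<^sup>+\<xi>. ennreal (norm \<xi> powr (2 * s) * (norm (F \<xi>))\<^sup>2) \<partial>lborel)"

text \<open>With \<open>y = x + z\<close>, Plancherel for the increment of \<open>f\<close> by
  \<open>z\<close> brings in the multiplier \<open>2 * (1 - cos (\<xi> \<bullet> z))\<close>.
  Integrating it over \<open>z\<close> first is \<open>nn_integral_cos_kernel\<close>. All
  integrands are nonnegative, so the identity covers infinite values as well.\<close>

lemma gagliardo_sq_fourier:
  fixes f :: "'a::euclidean_space \<Rightarrow> real"
  assumes s: "0 < s" "s < 1" and f[measurable]: "f \<in> borel_measurable borel"
    and L1: "integrable lborel f" and L2: "integrable lborel (\<lambda>x. (f x)\<^sup>2)"
  shows "gagliardo_sq s f = ennreal (2 / (C_ns DIM('a) s * (2 * pi) ^ DIM('a))) * spectral_energy s (fourier f)"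
proof -
  let ?n = "real DIM('a)"
  define k where "k z = 1 / norm z powr (?n + 2 * s)" for z :: 'a
  have k0: "k z \<ge> 0" for z by (simp add: k_def)
  have [measurable]: "k \<in> borel_measurable borel" unfolding k_def[abs_def] by measurable
  define P where "P = (2 * pi) ^ DIM('a)"
  have P: "P > 0" by (simp add: P_def)
  have C: "C_ns DIM('a) s > 0" by (rule C_ns_pos[OF s])
  have "gagliardo_sq s f = (\<integral>\<^sup>+x. (\<integral>\<^sup>+y. ennreal (k (y - x) * (f y - f x)\<^sup>2) \<partial>lborel) \<partial>lborel)"
    unfolding gagliardo_sq_def nn_integral_completion k_def
    by (intro nn_integral_cong) (simp add: norm_minus_commute power2_commute)
  also have "\<dots> = (\<integral>\<^sup>+x. (\<integral>\<^sup>+z. ennreal (k z * (f (x + z) - f x)\<^sup>2) \<partial>lborel) \<partial>lborel)"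
  proof (rule nn_integral_cong)
    fix x
    show "(\<integral>\<^sup>+y. ennreal (k (y - x) * (f y - f x)\<^sup>2) \<partial>lborel) = (\<integral>\<^sup>+z. ennreal (k z * (f (x + z) - f x)\<^sup>2) \<partial>lborel)"
      using nn_integral_lborel_translate[of "\<lambda>y. ennreal (k (y - x) * (f y - f x)\<^sup>2)" x] by (simp add: add.commute)
  qed
  also have "\<dots> = (\<integral>\<^sup>+z. (\<integral>\<^sup>+x. ennreal (k z * (f (x + z) - f x)\<^sup>2) \<partial>lborel) \<partial>lborel)"
    by (rule lborel_pair.Fubini') measurable
  also have "\<dots> = (\<integral>\<^sup>+z. (\<integral>\<^sup>+\<xi>. ennreal (k z / P * (2 * (1 - cos (\<xi> \<bullet> z)) * (norm (fourier f \<xi>))\<^sup>2)) \<partial>lborel) \<partial>lborel)"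
  proof (rule nn_integral_cong)
    fix z :: 'a
    let ?d = "\<lambda>x. f (x + z) - f x"
    have tr: "integrable lborel (\<lambda>x. f (x + z))" using L1 by (simp add: integrable_lborel_translate_iff)
    have d1: "integrable lborel ?d" using tr L1 by (rule Bochner_Integration.integrable_diff)
    have d2: "integrable lborel (\<lambda>x. (?d x)\<^sup>2)"
    proof -
      have "(?d x)\<^sup>2 = ((f (x + z))\<^sup>2 + (f x)\<^sup>2) - 2 * (f x * f (x + z))" for x by (simp add: power2_diff)
      then show ?thesis
        using integrable_autocorr[OF f L2, of z] integrable_square_translate[OF f L2, of z] L2 by simp
    qed
    have F: "fourier ?d \<xi> = (cis (- (\<xi> \<bullet> z)) - 1) * fourier f \<xi>" for \<xi>
      by (subst fourier_diff[OF tr L1]) (simp add: fourier_translate algebra_simps)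
    have "ennreal P * (\<integral>\<^sup>+x. ennreal ((?d x)\<^sup>2) \<partial>lborel) = (\<integral>\<^sup>+\<xi>. ennreal ((norm (fourier ?d \<xi>))\<^sup>2) \<partial>lborel)"
      unfolding P_def by (rule plancherel[symmetric]) (use d1 d2 in auto)
    also have "\<dots> = (\<integral>\<^sup>+\<xi>. ennreal (2 * (1 - cos (\<xi> \<bullet> z)) * (norm (fourier f \<xi>))\<^sup>2) \<partial>lborel)"
      unfolding F norm_mult power_mult_distrib norm_cis_minus_1_sq by simp
    finally have pl: "ennreal P * (\<integral>\<^sup>+x. ennreal ((?d x)\<^sup>2) \<partial>lborel) = (\<integral>\<^sup>+\<xi>. ennreal (2 * (1 - cos (\<xi> \<bullet> z)) * (norm (fourier f \<xi>))\<^sup>2) \<partial>lborel)" .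
    have "(\<integral>\<^sup>+x. ennreal (k z * (?d x)\<^sup>2) \<partial>lborel) = ennreal (k z) * (\<integral>\<^sup>+x. ennreal ((?d x)\<^sup>2) \<partial>lborel)"
      using k0 by (simp add: ennreal_mult nn_integral_cmult)
    also have "\<dots> = ennreal (k z / P) * (ennreal P * (\<integral>\<^sup>+x. ennreal ((?d x)\<^sup>2) \<partial>lborel))"
      using P k0 by (simp add: mult.assoc[symmetric] ennreal_mult''[symmetric])
    also have "\<dots> = (\<integral>\<^sup>+\<xi>. ennreal (k z / P) * ennreal (2 * (1 - cos (\<xi> \<bullet> z)) * (norm (fourier f \<xi>))\<^sup>2) \<partial>lborel)"
      unfolding pl by (rule nn_integral_cmult[symmetric]) measurable
    also have "\<dots> = (\<integral>\<^sup>+\<xi>. ennreal (k z / P * (2 * (1 - cos (\<xi> \<bullet> z)) * (norm (fourier f \<xi>))\<^sup>2)) \<partial>lborel)"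
      using P k0 by (intro nn_integral_cong ennreal_mult'[symmetric]) simp
    finally show "(\<integral>\<^sup>+x. ennreal (k z * (?d x)\<^sup>2) \<partial>lborel) = (\<integral>\<^sup>+\<xi>. ennreal (k z / P * (2 * (1 - cos (\<xi> \<bullet> z)) * (norm (fourier f \<xi>))\<^sup>2)) \<partial>lborel)" .
  qed
  also have "\<dots> = (\<integral>\<^sup>+\<xi>. (\<integral>\<^sup>+z. ennreal (k z / P * (2 * (1 - cos (\<xi> \<bullet> z)) * (norm (fourier f \<xi>))\<^sup>2)) \<partial>lborel) \<partial>lborel)"
    by (rule lborel_pair.Fubini') measurable
  also have "\<dots> = (\<integral>\<^sup>+\<xi>. ennreal (2 / (C_ns DIM('a) s * P)) * ennreal (norm \<xi> powr (2 * s) * (norm (fourier f \<xi>))\<^sup>2) \<partial>lborel)"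
  proof (rule nn_integral_cong)
    fix \<xi> :: 'a
    have "(\<integral>\<^sup>+z. ennreal (k z / P * (2 * (1 - cos (\<xi> \<bullet> z)) * (norm (fourier f \<xi>))\<^sup>2)) \<partial>lborel)
        = (\<integral>\<^sup>+z. ennreal (2 / P * (norm (fourier f \<xi>))\<^sup>2) * ennreal ((1 - cos (\<xi> \<bullet> z)) / norm z powr (?n + 2 * s)) \<partial>lborel)"
      using P by (intro nn_integral_cong) (simp add: ennreal_mult'[symmetric] k_def mult_ac)
    also have "\<dots> = ennreal (2 / P * (norm (fourier f \<xi>))\<^sup>2) * ennreal (norm \<xi> powr (2 * s) / C_ns DIM('a) s)"
      using nn_integral_cos_kernel[OF s, of \<xi>] by (subst nn_integral_cmult) auto
    also have "\<dots> = ennreal (2 / (C_ns DIM('a) s * P)) * ennreal (norm \<xi> powr (2 * s) * (norm (fourier f \<xi>))\<^sup>2)"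
      using P C by (simp add: ennreal_mult'[symmetric] mult_ac)
    finally show "(\<integral>\<^sup>+z. ennreal (k z / P * (2 * (1 - cos (\<xi> \<bullet> z)) * (norm (fourier f \<xi>))\<^sup>2)) \<partial>lborel) = \<dots>" .
  qed
  also have "\<dots> = ennreal (2 / (C_ns DIM('a) s * P)) * spectral_energy s (fourier f)"
    unfolding spectral_energy_def by (rule nn_integral_cmult) measurable
  finally show ?thesis unfolding P_def .
qed

text \<open>One component of the nonlocal gradient without the factor \<open>C_omega\<close>,
  written in the increment \<open>z = y - x\<close> so that translates of \<open>u\<close>
  appear.\<close>

definition riesz_grad :: "real \<Rightarrow> 'a::euclidean_space \<Rightarrow> ('a \<Rightarrow> real) \<Rightarrow> 'a \<Rightarrow> real" where
  "riesz_grad s b u x = (LINT z|lborel. riesz_kernel s b z * (u (x + z) - u x))"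

text \<open>Subtracting 1 makes the integral converge absolutely at the origin. The kernel is odd,
  so the cosine part integrates to 0 and \<open>integral_riesz_kernel_sin\<close> gives the
  rest.\<close>

lemma fourier_riesz_symbol:
  fixes \<xi> b :: "'a::euclidean_space"
  assumes s: "0 < s" "s < 1" and b: "b \<in> Basis"
  shows "integrable lborel (\<lambda>z. riesz_kernel s b z *\<^sub>R (cis (- (\<xi> \<bullet> z)) - 1))" (is "integrable _ ?f")
    and "(LINT z|lborel. riesz_kernel s b z *\<^sub>R (cis (- (\<xi> \<bullet> z)) - 1)) =
      - \<i> * of_real (riesz_const DIM('a) s * ((\<xi> \<bullet> b) * norm \<xi> powr (s - 1)))"
proof -
  have nb: "norm b = 1" using b by simp
  have bound: "norm (cis (- (\<xi> \<bullet> z)) - 1) \<le> max 2 (norm \<xi>) * min 1 (norm z)" for z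
  proof -
    have "(norm (cis (- (\<xi> \<bullet> z)) - 1))\<^sup>2 = (2 * \<bar>sin ((\<xi> \<bullet> z) / 2)\<bar>)\<^sup>2"
      using cos_double_sin[of "(\<xi> \<bullet> z) / 2"] by (simp add: norm_cis_minus_1_sq power_mult_distrib)
    then have eq: "norm (cis (- (\<xi> \<bullet> z)) - 1) = 2 * \<bar>sin ((\<xi> \<bullet> z) / 2)\<bar>"
      by (rule power2_eq_imp_eq) auto
    have "2 * \<bar>sin ((\<xi> \<bullet> z) / 2)\<bar> \<le> norm \<xi> * norm z"
      using abs_sin_x_le_abs_x[of "(\<xi> \<bullet> z) / 2"] Cauchy_Schwarz_ineq2[of \<xi> z] by simp
    also have "\<dots> \<le> max 2 (norm \<xi>) * norm z" by (intro mult_right_mono) auto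
    finally have "2 * \<bar>sin ((\<xi> \<bullet> z) / 2)\<bar> \<le> max 2 (norm \<xi>) * norm z" .
    moreover have "2 * \<bar>sin ((\<xi> \<bullet> z) / 2)\<bar> \<le> max 2 (norm \<xi>) * 1"
      using abs_sin_le_one[of "(\<xi> \<bullet> z) / 2"] by (simp add: le_max_iff_disj)
    ultimately show ?thesis unfolding eq by (auto simp: min_def)
  qed
  show int: "integrable lborel ?f"
    by (rule integrable_riesz_kernel[OF s nb _ bound]) measurable
  have re: "Re (?f z) = riesz_kernel s b z * (cos (\<xi> \<bullet> z) - 1)" and im: "Im (?f z) = - (riesz_kernel s b z * sin (\<xi> \<bullet> z))" for z
    by simp_all
  have "(LINT z|lborel. riesz_kernel s b z * (cos (\<xi> \<bullet> z) - 1)) = (LINT z|lborel. riesz_kernel s b (0 - z) * (cos (\<xi> \<bullet> (0 - z)) - 1))"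
    by (rule integral_lborel_reflect[symmetric, of "\<lambda>z. riesz_kernel s b z * (cos (\<xi> \<bullet> z) - 1)"]) measurable
  also have "\<dots> = - (LINT z|lborel. riesz_kernel s b z * (cos (\<xi> \<bullet> z) - 1))"
    by (simp add: riesz_kernel_minus)
  finally have "(LINT z|lborel. riesz_kernel s b z * (cos (\<xi> \<bullet> z) - 1)) = 0" by simp
  then have "Re (LINT z|lborel. ?f z) = 0"
    using integral_Re[OF int] unfolding re by simp
  moreover have "Im (LINT z|lborel. ?f z) = - (riesz_const DIM('a) s * ((\<xi> \<bullet> b) * norm \<xi> powr (s - 1)))"
  proof -
    have "Im (LINT z|lborel. ?f z) = (LINT z|lborel. Im (?f z))" using integral_Im[OF int] by simp
    also have "\<dots> = - (LINT z|lborel. riesz_kernel s b z * sin (\<xi> \<bullet> z))" unfolding im by simp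
    also have "(LINT z|lborel. riesz_kernel s b z * sin (\<xi> \<bullet> z)) = riesz_const DIM('a) s * ((\<xi> \<bullet> b) * norm \<xi> powr (s - 1))"
    proof (cases "\<xi> = 0")
      case False
      then show ?thesis by (rule integral_riesz_kernel_sin[OF s b])
    qed simp
    finally show ?thesis .
  qed
  ultimately show "(LINT z|lborel. ?f z) = - \<i> * of_real (riesz_const DIM('a) s * ((\<xi> \<bullet> b) * norm \<xi> powr (s - 1)))"
    by (simp add: complex_eq_iff)
qed

section \<open>The Riesz gradient of a compactly supported Lipschitz function\<close>

lemma integrable_bounded_support:
  fixes f :: "'a::euclidean_space \<Rightarrow> 'b::{banach, second_countable_topology}"
  assumes [measurable]: "f \<in> borel_measurable borel" and "\<And>x. norm (f x) \<le> C" "\<And>x. norm x > r \<Longrightarrow> f x = 0"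
  shows "integrable lborel f"
proof (rule Bochner_Integration.integrable_bound)
  show "integrable lborel (\<lambda>x::'a. C * indicator (cball 0 r) x)"
    using emeasure_lborel_cball_finite[of "0::'a" r] by (intro integrable_mult_right integrable_real_indicator) auto
  have "norm (f x) \<le> norm (C * indicator (cball 0 r) x)" for x
    using assms(2,3)[of x] by (cases "norm x > r") auto
  then show "AE x in lborel. norm (f x) \<le> norm (C * indicator (cball 0 r) x)" by simp
qed measurable

context
  fixes u :: "'a::euclidean_space \<Rightarrow> real" and B R :: real
  assumes cont: "continuous_on UNIV u" and supp: "\<And>x. norm x > R \<Longrightarrow> u x = 0"
    and lip: "\<And>x y. \<bar>u x - u y\<bar> \<le> B * norm (x - y)"
begin

lemma lipschitz_measurable [measurable]: "u \<in> borel_measurable borel"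
  using cont by (rule borel_measurable_continuous_onI)

lemma lipschitz_difference_bound:
  obtains M where "\<And>x z. \<bar>u (x + z) - u x\<bar> \<le> M * min 1 (norm z)" "M \<ge> 0"
proof -
  obtain D where D: "D \<ge> 0" "\<And>x. norm (u x) \<le> D"
    using continuous_compact_support_bounded[OF cont supp] by blast
  define M where "M = max (2 * D) B"
  have "\<bar>u (x + z) - u x\<bar> \<le> M * min 1 (norm z)" for x z
  proof -
    have "\<bar>u (x + z) - u x\<bar> \<le> 2 * D" using D(2)[of x] D(2)[of "x + z"] by simp
    then have 1: "\<bar>u (x + z) - u x\<bar> \<le> M * 1" by (simp add: M_def)
    have "\<bar>u (x + z) - u x\<bar> \<le> B * norm z" using lip[of "x + z" x] by simp
    also have "\<dots> \<le> M * norm z" by (intro mult_right_mono) (auto simp: M_def)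
    finally show ?thesis using 1 by (auto simp: min_def)
  qed
  then show thesis using that[of M] D(1) by (simp add: M_def)
qed

lemma lipschitz_integrable: "integrable lborel u" "integrable lborel (\<lambda>x. (u x)\<^sup>2)"
proof -
  obtain D where D: "D \<ge> 0" "\<And>x. norm (u x) \<le> D"
    using continuous_compact_support_bounded[OF cont supp] by blast
  show "integrable lborel u" by (rule integrable_bounded_support[OF _ D(2) supp]) measurable
  show "integrable lborel (\<lambda>x. (u x)\<^sup>2)"
  proof (rule integrable_bounded_support)
    show "norm ((u x)\<^sup>2) \<le> D\<^sup>2" for x using power_mono[OF D(2)[of x], of 2] by simp
    show "(u x)\<^sup>2 = 0" if "norm x > R" for x using supp[OF that] by simp
  qed measurable
qed

lemma riesz_grad_integrand:
  assumes s: "0 < s" "s < 1" and b: "norm b = 1"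
  shows "integrable lborel (\<lambda>z. riesz_kernel s b z * (u (x + z) - u x))"
proof -
  obtain M where M: "\<And>x z. \<bar>u (x + z) - u x\<bar> \<le> M * min 1 (norm z)" "M \<ge> 0" using lipschitz_difference_bound by blast
  show ?thesis
    using integrable_riesz_kernel[OF s b, of "\<lambda>z. u (x + z) - u x" M] M by simp
qed

lemma riesz_grad_measurable [measurable]: "riesz_grad s b u \<in> borel_measurable borel"
  unfolding riesz_grad_def[abs_def] by measurable

text \<open>The L^1 norm of the increment by \<open>z\<close> is at most a multiple of
  \<open>min 1 (norm z)\<close>: for small \<open>z\<close> the increment is of order
  \<open>norm z\<close> and lives in a ball of radius \<open>R + 1\<close>, for large
  \<open>z\<close> the triangle inequality suffices. This compensates the singular kernel.\<close>

lemma riesz_grad_pair_integrable: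
  assumes s: "0 < s" "s < 1" and b: "norm b = 1"
  shows "integrable (lborel \<Otimes>\<^sub>M lborel) (\<lambda>(z, x). riesz_kernel s b z * (u (x + z) - u x))"
proof (rule lborel_pair.Fubini_integrable)
  obtain M where M: "\<And>x z. \<bar>u (x + z) - u x\<bar> \<le> M * min 1 (norm z)" "M \<ge> 0" using lipschitz_difference_bound by blast
  have tr: "integrable lborel (\<lambda>x. u (x + z))" for z
    using lipschitz_integrable(1) by (simp add: integrable_lborel_translate_iff)
  then show "AE z in lborel. integrable lborel (\<lambda>x. case (z, x) of (z, x) \<Rightarrow> riesz_kernel s b z * (u (x + z) - u x))"
    using lipschitz_integrable(1) by simp
  define V where "V = M * measure lborel (cball (0::'a) (R + 1))"
  define W where "W = 2 * (LINT x|lborel. \<bar>u x\<bar>)"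
  have le: "(LINT x|lborel. \<bar>u (x + z) - u x\<bar>) \<le> max V W * min 1 (norm z)" for z
  proof (cases "norm z \<le> 1")
    case True
    have "(LINT x|lborel. \<bar>u (x + z) - u x\<bar>) \<le> (LINT x|lborel. (M * norm z) * indicator (cball (0::'a) (R + 1)) x)"
    proof (rule integral_mono)
      show "integrable lborel (\<lambda>x::'a. (M * norm z) * indicator (cball 0 (R + 1)) x)"
        using emeasure_lborel_cball_finite[of "0::'a" "R + 1"] by (intro integrable_mult_right integrable_real_indicator) auto
      show "\<bar>u (x + z) - u x\<bar> \<le> (M * norm z) * indicator (cball 0 (R + 1)) x" for x
      proof (cases "norm x > R + 1")
        case True
        have "norm x \<le> norm (x + z) + norm z" by (metis add_diff_cancel_right' norm_triangle_ineq4)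
        then have "norm (x + z) > R" using True \<open>norm z \<le> 1\<close> by linarith
        then show ?thesis using True supp by simp
      next
        case False
        then show ?thesis using M(1)[of x z] \<open>norm z \<le> 1\<close> by simp
      qed
    qed (use tr lipschitz_integrable(1) in auto)
    also have "\<dots> = V * min 1 (norm z)"
      using True by (simp add: V_def)
    also have "\<dots> \<le> max V W * min 1 (norm z)" by (intro mult_right_mono) auto
    finally show ?thesis .
  next
    case False
    have "(LINT x|lborel. \<bar>u (x + z) - u x\<bar>) \<le> (LINT x|lborel. \<bar>u (x + z)\<bar> + \<bar>u x\<bar>)"
      using tr lipschitz_integrable(1) by (intro integral_mono) auto
    also have "\<dots> = (LINT x|lborel. \<bar>u (x + z)\<bar>) + (LINT x|lborel. \<bar>u x\<bar>)"
      using tr lipschitz_integrable(1) by (intro Bochner_Integration.integral_add) auto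
    also have "(LINT x|lborel. \<bar>u (x + z)\<bar>) = (LINT x|lborel. \<bar>u x\<bar>)"
      by (rule integral_lborel_translate[of "\<lambda>x. \<bar>u x\<bar>"]) measurable
    finally show ?thesis using False by (simp add: W_def)
  qed
  have "integrable lborel (\<lambda>z. riesz_kernel s b z *\<^sub>R (LINT x|lborel. \<bar>u (x + z) - u x\<bar>))"
    by (rule integrable_riesz_kernel[OF s b, of _ "max V W"]) (use le in auto)
  then have "integrable lborel (\<lambda>z. \<bar>riesz_kernel s b z *\<^sub>R (LINT x|lborel. \<bar>u (x + z) - u x\<bar>)\<bar>)"
    by (rule integrable_abs)
  then show "integrable lborel (\<lambda>z. LINT x|lborel. norm (case (z, x) of (z, x) \<Rightarrow> riesz_kernel s b z * (u (x + z) - u x)))"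
    by (simp add: abs_mult)
qed measurable

text \<open>Plancherel asks for both. The first is a marginal of
  \<open>riesz_grad_pair_integrable\<close>; the second follows because the Riesz gradient is
  bounded by \<open>K\<close>.\<close>

lemma riesz_grad_integrable:
  assumes s: "0 < s" "s < 1" and b: "norm b = 1"
  shows "integrable lborel (riesz_grad s b u)" "integrable lborel (\<lambda>x. (riesz_grad s b u x)\<^sup>2)"
proof -
  show 1: "integrable lborel (riesz_grad s b u)"
    using lborel_pair.integrable_snd[OF riesz_grad_pair_integrable[OF s b]] by (simp add: riesz_grad_def[abs_def])
  obtain M where M: "\<And>x z. \<bar>u (x + z) - u x\<bar> \<le> M * min 1 (norm z)" "M \<ge> 0" using lipschitz_difference_bound by blast
  define K where "K = (LINT z|lborel. \<bar>M * (riesz_kernel s b z * min 1 (norm z))\<bar>)"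
  have K: "\<bar>riesz_grad s b u x\<bar> \<le> K" for x
  proof -
    have "\<bar>riesz_grad s b u x\<bar> \<le> (LINT z|lborel. \<bar>riesz_kernel s b z * (u (x + z) - u x)\<bar>)"
      unfolding riesz_grad_def by (rule integral_abs_bound)
    also have "\<dots> \<le> K"
      unfolding K_def
    proof (rule integral_mono)
      show "integrable lborel (\<lambda>z. \<bar>M * (riesz_kernel s b z * min 1 (norm z))\<bar>)"
        using integrable_riesz_kernel[OF s b, of "\<lambda>z. min 1 (norm z)" 1] by (intro integrable_abs integrable_mult_right) simp
      show "\<bar>riesz_kernel s b z * (u (x + z) - u x)\<bar> \<le> \<bar>M * (riesz_kernel s b z * min 1 (norm z))\<bar>" for z
        using mult_left_mono[OF M(1)[of x z], of "\<bar>riesz_kernel s b z\<bar>"] M(2) by (simp add: abs_mult mult_ac)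
    qed (use riesz_grad_integrand[OF s b] in auto)
    finally show ?thesis .
  qed
  show "integrable lborel (\<lambda>x. (riesz_grad s b u x)\<^sup>2)"
  proof (rule Bochner_Integration.integrable_bound)
    show "integrable lborel (\<lambda>x. K * riesz_grad s b u x)" using 1 by simp
    have "(riesz_grad s b u x)\<^sup>2 \<le> \<bar>K * riesz_grad s b u x\<bar>" for x
      using mult_right_mono[OF K[of x], of "\<bar>riesz_grad s b u x\<bar>"] K[of x] by (simp add: abs_mult power2_eq_square)
    then show "AE x in lborel. norm ((riesz_grad s b u x)\<^sup>2) \<le> norm (K * riesz_grad s b u x)" by simp
  qed measurable
qed

text \<open>Integrating over \<open>x\<close> first turns the increment of \<open>u\<close> into the
  factor \<open>cis (- (\<xi> \<bullet> z)) - 1\<close>; the integral over \<open>z\<close> is then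
  \<open>fourier_riesz_symbol\<close>.\<close>

lemma fourier_riesz_grad:
  assumes s: "0 < s" "s < 1" and b: "b \<in> Basis"
  shows "fourier (riesz_grad s b u) \<xi> = fourier u \<xi> * (- \<i> * of_real (riesz_const DIM('a) s * ((\<xi> \<bullet> b) * norm \<xi> powr (s - 1))))"
proof -
  have nb: "norm b = 1" using b by simp
  have tr: "integrable lborel (\<lambda>x. u (x + z))" for z
    using lipschitz_integrable(1) by (simp add: integrable_lborel_translate_iff)
  have "fourier (riesz_grad s b u) \<xi> = (LINT x|lborel. (LINT z|lborel. (riesz_kernel s b z * (u (x + z) - u x)) *\<^sub>R cis (\<xi> \<bullet> x)))"
    unfolding fourier_def riesz_grad_def
    by (intro Bochner_Integration.integral_cong refl integral_scaleR_left[symmetric] riesz_grad_integrand[OF s nb])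
  also have "\<dots> = (LINT z|lborel. (LINT x|lborel. (riesz_kernel s b z * (u (x + z) - u x)) *\<^sub>R cis (\<xi> \<bullet> x)))"
  proof (rule lborel_pair.Fubini_integral)
    show "integrable (lborel \<Otimes>\<^sub>M lborel) (\<lambda>(z, x). (riesz_kernel s b z * (u (x + z) - u x)) *\<^sub>R cis (\<xi> \<bullet> x))"
      by (rule Bochner_Integration.integrable_bound[OF riesz_grad_pair_integrable[OF s nb]]) auto
  qed
  also have "\<dots> = (LINT z|lborel. fourier u \<xi> * (riesz_kernel s b z *\<^sub>R (cis (- (\<xi> \<bullet> z)) - 1)))"
  proof (rule Bochner_Integration.integral_cong[OF refl])
    fix z :: 'a
    have "(LINT x|lborel. (riesz_kernel s b z * (u (x + z) - u x)) *\<^sub>R cis (\<xi> \<bullet> x)) = riesz_kernel s b z *\<^sub>R fourier (\<lambda>x. u (x + z) - u x) \<xi>"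
      unfolding fourier_def by (simp flip: scaleR_scaleR)
    also have "fourier (\<lambda>x. u (x + z) - u x) \<xi> = fourier u \<xi> * (cis (- (\<xi> \<bullet> z)) - 1)"
      by (subst fourier_diff[OF tr lipschitz_integrable(1)]) (simp add: fourier_translate algebra_simps)
    finally show "(LINT x|lborel. (riesz_kernel s b z * (u (x + z) - u x)) *\<^sub>R cis (\<xi> \<bullet> x)) = fourier u \<xi> * (riesz_kernel s b z *\<^sub>R (cis (- (\<xi> \<bullet> z)) - 1))"
      by simp
  qed
  also have "\<dots> = fourier u \<xi> * (LINT z|lborel. riesz_kernel s b z *\<^sub>R (cis (- (\<xi> \<bullet> z)) - 1))"
    by (rule integral_mult_right_zero)
  finally show ?thesis unfolding fourier_riesz_symbol(2)[OF s b] .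
qed

text \<open>Each component has a symbol proportional to
  \<open>(\<xi> \<bullet> b) * norm \<xi> powr (s - 1)\<close>. Summing the squares over the basis
  leaves \<open>norm \<xi> powr (2 * s)\<close>, the weight that also represents the Gagliardo
  seminorm.\<close>

lemma riesz_grad_energy:
  assumes s: "0 < s" "s < 1"
  shows "ennreal ((2 * pi) ^ DIM('a)) * (\<Sum>b\<in>Basis. \<integral>\<^sup>+x. ennreal ((riesz_grad s b u x)\<^sup>2) \<partial>lborel)
    = ennreal ((riesz_const DIM('a) s)\<^sup>2) * spectral_energy s (fourier u)"
proof -
  have "ennreal ((2 * pi) ^ DIM('a)) * (\<Sum>b\<in>Basis. \<integral>\<^sup>+x. ennreal ((riesz_grad s b u x)\<^sup>2) \<partial>lborel)
     = (\<Sum>b\<in>Basis. \<integral>\<^sup>+\<xi>. ennreal ((norm (fourier (riesz_grad s b u) \<xi>))\<^sup>2) \<partial>lborel)"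
    unfolding sum_distrib_left
    by (intro sum.cong refl plancherel[symmetric] riesz_grad_integrable[OF s]) auto
  also have "\<dots> = (\<integral>\<^sup>+\<xi>. (\<Sum>b\<in>Basis. ennreal ((norm (fourier (riesz_grad s b u) \<xi>))\<^sup>2)) \<partial>lborel)"
    by (rule nn_integral_sum[symmetric]) measurable
  also have "\<dots> = (\<integral>\<^sup>+\<xi>. ennreal ((riesz_const DIM('a) s)\<^sup>2) * ennreal (norm \<xi> powr (2 * s) * (norm (fourier u \<xi>))\<^sup>2) \<partial>lborel)"
  proof (rule nn_integral_cong)
    fix \<xi> :: 'a
    have "(\<Sum>b\<in>Basis. (norm (fourier (riesz_grad s b u) \<xi>))\<^sup>2)
        = (\<Sum>b\<in>Basis. ((riesz_const DIM('a) s)\<^sup>2 * (norm (fourier u \<xi>))\<^sup>2 * (norm \<xi> powr (s - 1))\<^sup>2) * (\<xi> \<bullet> b)\<^sup>2)"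
      by (intro sum.cong refl) (simp add: fourier_riesz_grad[OF s] norm_mult abs_mult power_mult_distrib mult_ac)
    also have "\<dots> = ((riesz_const DIM('a) s)\<^sup>2 * (norm (fourier u \<xi>))\<^sup>2 * (norm \<xi> powr (s - 1))\<^sup>2) * (norm \<xi>)\<^sup>2"
      by (simp only: sum_distrib_left[symmetric] norm_sq_eq_sum_Basis[symmetric])
    also have "\<dots> = (riesz_const DIM('a) s)\<^sup>2 * (((norm \<xi> powr (s - 1))\<^sup>2 * (norm \<xi>)\<^sup>2) * (norm (fourier u \<xi>))\<^sup>2)"
      by (simp only: mult_ac)
    also have "(norm \<xi> powr (s - 1))\<^sup>2 * (norm \<xi>)\<^sup>2 = norm \<xi> powr (2 * s)"
    proof (cases "\<xi> = 0")
      case False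
      then have "norm \<xi> powr (s - 1) * norm \<xi> = norm \<xi> powr s"
        using powr_add[of "norm \<xi>" "s - 1" 1] by simp
      then have "(norm \<xi> powr (s - 1))\<^sup>2 * (norm \<xi>)\<^sup>2 = (norm \<xi> powr s)\<^sup>2"
        by (simp flip: power_mult_distrib)
      also have "\<dots> = norm \<xi> powr (2 * s)"
        unfolding power2_eq_square powr_add[symmetric] by simp
      finally show ?thesis .
    qed simp
    finally show "(\<Sum>b\<in>Basis. ennreal ((norm (fourier (riesz_grad s b u) \<xi>))\<^sup>2))
      = ennreal ((riesz_const DIM('a) s)\<^sup>2) * ennreal (norm \<xi> powr (2 * s) * (norm (fourier u \<xi>))\<^sup>2)"
      by (simp add: sum_ennreal ennreal_mult'[symmetric])
  qed
  also have "\<dots> = ennreal ((riesz_const DIM('a) s)\<^sup>2) * spectral_energy s (fourier u)"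
    unfolding spectral_energy_def by (rule nn_integral_cmult) measurable
  finally show ?thesis .
qed

end

section \<open>Smooth functions and mollification\<close>

lemma Ck_SucI:
  assumes "\<And>x. (f has_derivative D x) (at x)" "\<And>h. Ck k (\<lambda>x. D x h)"
  shows "Ck (Suc k) f"
proof -
  have "frechet_derivative f (at x) = D x" for x using frechet_derivative_at[OF assms(1)] by simp
  then show ?thesis using assms by (auto simp: differentiable_def)
qed

lemma Ck_Suc_has_derivative: "Ck (Suc k) f \<Longrightarrow> (f has_derivative frechet_derivative f (at x)) (at x)"
  by (simp add: frechet_derivative_works[symmetric])

lemma Ck_Suc_continuous: "Ck (Suc k) f \<Longrightarrow> continuous_on UNIV f"
  by (auto intro!: differentiable_imp_continuous_on simp: differentiable_on_def)

text \<open>\<open>Ck (Suc k)\<close> constrains \<open>f\<close> itself only by differentiability,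
  so descending takes an induction that ends in continuity.\<close>

lemma Ck_SucD: "Ck (Suc k) f \<Longrightarrow> Ck k f"
proof (induction k arbitrary: f)
  case 0
  then show ?case using Ck_Suc_continuous[OF 0] by (simp only: Ck.simps(1))
next
  case (Suc k)
  from Suc.prems have d: "\<And>x. f differentiable (at x)" and *: "\<And>h. Ck (Suc k) (\<lambda>x. frechet_derivative f (at x) h)"
    by (simp_all only: Ck.simps(2)[of "Suc k"])
  have "Ck k (\<lambda>x. frechet_derivative f (at x) h)" for h by (rule Suc.IH[OF *])
  with d show ?case by simp
qed

lemma Ck_const: "Ck k (\<lambda>x. c)"
proof (induction k arbitrary: c)
  case (Suc k)
  then show ?case by (intro Ck_SucI[where D="\<lambda>_ _. 0"]) auto
qed simp

lemma Ck_inner: "Ck k (\<lambda>x. x \<bullet> a)"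
proof (cases k)
  case (Suc j)
  then show ?thesis
    by (simp only:, intro Ck_SucI[where D="\<lambda>_ h. h \<bullet> a"] Ck_const) (auto intro!: derivative_eq_intros)
qed (auto intro!: continuous_intros)

lemma Ck_add: "Ck k f \<Longrightarrow> Ck k g \<Longrightarrow> Ck k (\<lambda>x. f x + g x)"
proof (induction k arbitrary: f g)
  case 0
  then show ?case by (auto intro!: continuous_intros)
next
  case (Suc k)
  show ?case
  proof (rule Ck_SucI)
    show "((\<lambda>x. f x + g x) has_derivative (\<lambda>h. frechet_derivative f (at x) h + frechet_derivative g (at x) h)) (at x)" for x
      using Suc.prems by (intro has_derivative_add Ck_Suc_has_derivative)
    show "Ck k (\<lambda>x. frechet_derivative f (at x) h + frechet_derivative g (at x) h)" for h
      using Suc.prems by (intro Suc.IH) simp_all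
  qed
qed

lemma Ck_mult: "Ck k f \<Longrightarrow> Ck k g \<Longrightarrow> Ck k (\<lambda>x. f x * g x)"
proof (induction k arbitrary: f g)
  case 0
  then show ?case by (auto intro!: continuous_intros)
next
  case (Suc k)
  show ?case
  proof (rule Ck_SucI)
    show "((\<lambda>x. f x * g x) has_derivative (\<lambda>h. f x * frechet_derivative g (at x) h + frechet_derivative f (at x) h * g x)) (at x)" for x
      using Suc.prems by (intro has_derivative_mult Ck_Suc_has_derivative)
    show "Ck k (\<lambda>x. f x * frechet_derivative g (at x) h + frechet_derivative f (at x) h * g x)" for h
    proof (intro Ck_add Suc.IH)
      \<comment> \<open>The product rule multiplies derivatives with the functions themselves, whose
        order has to be lowered by one first.\<close>
      show "Ck k f" "Ck k g" using Suc.prems Ck_SucD by blast+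
    qed (use Suc.prems in simp_all)
  qed
qed

lemma Ck_cmult: "Ck k f \<Longrightarrow> Ck k (\<lambda>x. c * f x)"
  by (intro Ck_mult Ck_const)

lemma Ck_diff: "Ck k f \<Longrightarrow> Ck k g \<Longrightarrow> Ck k (\<lambda>x. f x - g x)"
  using Ck_add[of k f "\<lambda>x. (-1) * g x"] Ck_cmult[of k g "-1"] by simp

text \<open>The factor \<open>inverse t ^ m\<close> makes the family closed under differentiation up
  to linear combinations, so that smoothness is one induction over all \<open>m\<close> at
  once.\<close>

definition flat :: "nat \<Rightarrow> real \<Rightarrow> real" where
  "flat m t = (if t > 0 then exp (- inverse t) * inverse t ^ m else 0)"

lemma flat_has_real_derivative:
  "(flat m has_real_derivative (flat (m + 2) t - real m * flat (m + 1) t)) (at t)"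
proof -
  consider "t > 0" | "t < 0" | "t = 0" by linarith
  then show ?thesis
  proof cases
    case 1
    have outer: "((\<lambda>r. exp (- r) * r ^ m) has_real_derivative (exp (- r) * (real m * r ^ (m - 1)) - exp (- r) * r ^ m)) (at r)" for r :: real
      by (auto intro!: derivative_eq_intros)
    have "((\<lambda>t. exp (- inverse t) * inverse t ^ m) has_real_derivative
        (exp (- inverse t) * (real m * inverse t ^ (m - 1)) - exp (- inverse t) * inverse t ^ m) * - (inverse t ^ Suc (Suc 0))) (at t)"
      using 1 by (intro DERIV_chain2[OF outer] DERIV_inverse) simp
    also have "(exp (- inverse t) * (real m * inverse t ^ (m - 1)) - exp (- inverse t) * inverse t ^ m) * - (inverse t ^ Suc (Suc 0))
        = flat (m + 2) t - real m * flat (m + 1) t"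
    proof (cases m)
      case (Suc j)
      then show ?thesis using 1 by (simp add: flat_def algebra_simps)
    qed (use 1 in \<open>simp add: flat_def\<close>)
    finally have "((\<lambda>t. exp (- inverse t) * inverse t ^ m) has_real_derivative (flat (m + 2) t - real m * flat (m + 1) t)) (at t)" .
    then show ?thesis
      by (rule has_field_derivative_transform_within_open[of _ _ _ "{0<..}"]) (use 1 in \<open>auto simp: flat_def\<close>)
  next
    case 2
    have "((\<lambda>t. 0) has_real_derivative (flat (m + 2) t - real m * flat (m + 1) t)) (at t)"
      using 2 by (simp add: flat_def)
    then show ?thesis
      by (rule has_field_derivative_transform_within_open[of _ _ _ "{..<0}"]) (use 2 in \<open>auto simp: flat_def\<close>)
  next
    case 3
    have "((\<lambda>y. flat m y / y) \<longlongrightarrow> 0) (at 0)"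
    proof (rule filterlim_split_at)
      show "((\<lambda>y. flat m y / y) \<longlongrightarrow> 0) (at_left 0)"
      proof (rule tendsto_eventually)
        show "eventually (\<lambda>y. flat m y / y = 0) (at_left 0)"
          by (auto simp: eventually_at_filter flat_def)
      qed
      \<comment> \<open>In the variable \<open>1 / y\<close> this is the decay of a power against
        the exponential; \<open>m + 1\<close> instead of \<open>m\<close> accounts for the
        denominator of the difference quotient.\<close>
      have "((\<lambda>y. (inverse y) ^ (m + 1) / exp (inverse y)) \<longlongrightarrow> 0) (at_right (0::real))"
        by (rule filterlim_compose[OF tendsto_power_div_exp_0 filterlim_inverse_at_top_right])
      moreover have "eventually (\<lambda>y. (inverse y) ^ (m + 1) / exp (inverse y) = flat m y / y) (at_right 0)"
        by (auto simp: eventually_at_filter flat_def exp_minus divide_inverse mult_ac)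
      ultimately show "((\<lambda>y. flat m y / y) \<longlongrightarrow> 0) (at_right 0)"
        by (rule Lim_transform_eventually)
    qed
    then show ?thesis using 3 by (simp add: has_field_derivative_iff flat_def)
  qed
qed

lemma Ck_flat: "Ck k (\<lambda>x::'a::euclidean_space. flat m (1 - c * (x \<bullet> x)))"
proof (induction k arbitrary: m)
  have d: "((\<lambda>x. flat m (1 - c * (x \<bullet> x))) has_derivative
      (\<lambda>h. - 2 * c * (x \<bullet> h) * (flat (m + 2) (1 - c * (x \<bullet> x)) - real m * flat (m + 1) (1 - c * (x \<bullet> x))))) (at x)" for x :: 'a and m
  proof -
    have "((\<lambda>x. 1 - c * (x \<bullet> x)) has_derivative (\<lambda>h. - 2 * c * (x \<bullet> h))) (at x)"
      by (auto intro!: derivative_eq_intros simp: inner_commute algebra_simps)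
    from DERIV_compose_FDERIV[OF flat_has_real_derivative this] show ?thesis .
  qed
  {
    case 0
    have "(\<lambda>x::'a. flat m (1 - c * (x \<bullet> x))) differentiable_on UNIV"
      using d by (auto simp: differentiable_on_def differentiable_def)
    then show ?case by (simp add: differentiable_imp_continuous_on)
  next
    case (Suc k)
    show ?case
    proof (rule Ck_SucI[OF d])
      show "Ck k (\<lambda>x::'a. - 2 * c * (x \<bullet> h) * (flat (m + 2) (1 - c * (x \<bullet> x)) - real m * flat (m + 1) (1 - c * (x \<bullet> x))))" for h
        by (intro Ck_mult[of k "\<lambda>x. - 2 * c * (x \<bullet> h)"] Ck_cmult Ck_diff Ck_inner Suc.IH)
    qed
  }
qed

lemma derivative_zero_outside:
  fixes f :: "'a::euclidean_space \<Rightarrow> real"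
  assumes "\<And>x. norm x > R \<Longrightarrow> f x = 0" "norm x > R"
  shows "frechet_derivative f (at x) = (\<lambda>h. 0)"
proof -
  have "open {x::'a. norm x > R}" by (simp add: open_Collect_less continuous_on_norm_id)
  then have "(f has_derivative (\<lambda>h. 0)) (at x)"
    using assms by (intro has_derivative_transform_within_open[OF has_derivative_const[of 0]]) auto
  then show ?thesis by (metis frechet_derivative_at)
qed

lemma compact_support_lipschitz:
  fixes f :: "'a::euclidean_space \<Rightarrow> real"
  assumes f: "Ck 1 f" and supp: "\<And>x. norm x > R \<Longrightarrow> f x = 0"
  obtains L where "L \<ge> 0" "\<And>x h. \<bar>frechet_derivative f (at x) h\<bar> \<le> L * norm h" "\<And>x y. \<bar>f x - f y\<bar> \<le> L * norm (x - y)"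
proof -
  let ?D = "\<lambda>x. frechet_derivative f (at x)"
  have d: "(f has_derivative ?D x) (at x)" for x using f Ck_Suc_has_derivative[of 0] by simp
  have lin: "bounded_linear (?D x)" for x using d has_derivative_bounded_linear by blast
  have "\<exists>B\<ge>0. \<forall>x. \<bar>?D x b\<bar> \<le> B" for b
  proof -
    have "continuous_on UNIV (\<lambda>x. ?D x b)" using f by simp
    moreover have "?D x b = 0" if "norm x > R" for x using derivative_zero_outside[OF supp that] by simp
    ultimately obtain C where "C \<ge> 0" "\<And>x. norm (?D x b) \<le> C"
      using continuous_compact_support_bounded by blast
    then show ?thesis by auto
  qed
  then obtain B where B: "\<And>b. B b \<ge> 0" "\<And>b x. \<bar>?D x b\<bar> \<le> B b" by metis
  define L where "L = (\<Sum>b\<in>Basis. B b)"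
  have L: "\<bar>?D x h\<bar> \<le> L * norm h" for x h
  proof -
    interpret bounded_linear "?D x" by (rule lin)
    have "?D x h = ?D x (\<Sum>b\<in>Basis. (h \<bullet> b) *\<^sub>R b)" by (simp add: euclidean_representation)
    also have "\<dots> = (\<Sum>b\<in>Basis. (h \<bullet> b) * ?D x b)" by (simp add: sum scaleR)
    also have "\<bar>\<dots>\<bar> \<le> (\<Sum>b\<in>Basis. \<bar>(h \<bullet> b) * ?D x b\<bar>)" by (rule sum_abs)
    also have "\<dots> \<le> (\<Sum>b\<in>Basis. B b * norm h)"
    proof (rule sum_mono)
      fix b :: 'a assume "b \<in> Basis"
      then have "\<bar>h \<bullet> b\<bar> \<le> norm h" by (rule Basis_le_norm)
      then show "\<bar>(h \<bullet> b) * ?D x b\<bar> \<le> B b * norm h"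
        unfolding abs_mult by (subst mult.commute) (intro mult_mono B, auto simp: B)
    qed
    finally show ?thesis by (simp add: L_def sum_distrib_right)
  qed
  have "norm (f x - f y) \<le> L * norm (x - y)" for x y
  proof (rule differentiable_bound[of UNIV])
    show "onorm (?D x) \<le> L" for x
      by (rule onorm_bound) (use L B in \<open>auto simp: L_def intro: sum_nonneg\<close>)
  qed (use d in auto)
  moreover have "L \<ge> 0" unfolding L_def by (rule sum_nonneg) (rule B)
  ultimately show thesis using that[of L] L by simp
qed

section \<open>Convolution of an integrable function with a smooth one\<close>

context
  fixes u :: "'a::euclidean_space \<Rightarrow> real"
  assumes u: "integrable lborel u" and um[measurable]: "u \<in> borel_measurable borel"
begin

lemma integrable_convolution:
  assumes "continuous_on UNIV f" "\<And>x. \<bar>f x\<bar> \<le> (B::real)"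
  shows "integrable lborel (\<lambda>y. u y * f (x - y))"
proof (rule Bochner_Integration.integrable_bound)
  have [measurable]: "f \<in> borel_measurable borel" using assms(1) by (rule borel_measurable_continuous_onI)
  show "integrable lborel (\<lambda>y. B * u y)" using u by simp
  have "\<bar>u y * f (x - y)\<bar> \<le> \<bar>B * u y\<bar>" for y
    using mult_left_mono[OF assms(2)[of "x - y"], of "\<bar>u y\<bar>"] assms(2)[of 0] by (simp add: abs_mult mult.commute)
  then show "AE y in lborel. norm (u y * f (x - y)) \<le> norm (B * u y)" by simp
  show "(\<lambda>y. u y * f (x - y)) \<in> borel_measurable lborel" by measurable
qed

text \<open>The derivative falls on \<open>f\<close>. Differentiation under the integral is
  dominated convergence: \<open>L\<close> is a Lipschitz constant of \<open>f\<close> and bounds its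
  derivative, so the normalized remainders are at most \<open>2 * L\<close>, uniformly in
  \<open>y\<close>.\<close>

lemma has_derivative_convolution:
  assumes f: "Ck 1 f" and supp: "\<And>x. norm x > R \<Longrightarrow> f x = 0"
  shows "((\<lambda>x. LINT y|lborel. u y * f (x - y)) has_derivative
     (\<lambda>h. LINT y|lborel. u y * frechet_derivative f (at (x - y)) h)) (at x)"
proof -
  let ?D = "\<lambda>x. frechet_derivative f (at x)"
  have d: "(f has_derivative ?D x) (at x)" for x using f Ck_Suc_has_derivative[of 0] by simp
  have lin: "bounded_linear (?D x)" for x using d has_derivative_bounded_linear by blast
  obtain L where L: "L \<ge> 0" "\<And>x h. \<bar>?D x h\<bar> \<le> L * norm h" "\<And>x y. \<bar>f x - f y\<bar> \<le> L * norm (x - y)"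
    using compact_support_lipschitz[OF f supp] by blast
  have fc: "continuous_on UNIV f" using f Ck_Suc_continuous[of 0] by simp
  obtain B where B: "\<And>x. \<bar>f x\<bar> \<le> B" using continuous_compact_support_bounded[OF fc supp] by (metis real_norm_def)
  have Dc: "continuous_on UNIV (\<lambda>x. ?D x h)" for h using f by simp
  note if_ = integrable_convolution[OF fc B] and iD = integrable_convolution[OF Dc L(2)]
  have [measurable]: "f \<in> borel_measurable borel" "(\<lambda>x. ?D x h) \<in> borel_measurable borel" for h
    using fc Dc by (auto intro: borel_measurable_continuous_onI)
  define F where "F x = (LINT y|lborel. u y * f (x - y))" for x
  define G where "G h = (LINT y|lborel. u y * ?D (x - y) h)" for h
  have "bounded_linear G"
  proof (rule bounded_linear_intro)
    show "G (a + b) = G a + G b" for a b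
      unfolding G_def by (subst Bochner_Integration.integral_add[symmetric])
        (use iD lin in \<open>auto simp: bounded_linear.linear linear_add distrib_left\<close>)
    show "G (r *\<^sub>R a) = r *\<^sub>R G a" for r a
      unfolding G_def using lin by (simp add: bounded_linear.linear linear_scale mult.left_commute)
    show "norm (G h) \<le> norm h * (L * (LINT y|lborel. \<bar>u y\<bar>))" for h
    proof -
      have "norm (G h) \<le> (LINT y|lborel. \<bar>u y * ?D (x - y) h\<bar>)"
        unfolding G_def real_norm_def by (rule integral_abs_bound)
      also have "\<dots> \<le> (LINT y|lborel. (L * norm h) * \<bar>u y\<bar>)"
      proof (rule integral_mono)
        show "\<bar>u y * ?D (x - y) h\<bar> \<le> (L * norm h) * \<bar>u y\<bar>" for y
          unfolding abs_mult by (subst mult.commute) (intro mult_right_mono L, simp)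
      qed (use iD u in auto)
      finally show ?thesis by (simp add: mult_ac)
    qed
  qed
  moreover have "(\<lambda>h. norm (F (x + h) - F x - G h) / norm h) \<midarrow>0\<rightarrow> 0"
    unfolding tendsto_at_iff_sequentially
  proof (intro allI impI, unfold comp_def)
    fix h :: "nat \<Rightarrow> 'a" assume h: "\<forall>j. h j \<in> UNIV - {0}" "h \<longlonglongrightarrow> 0"
    define q where "q j y = (f (x - y + h j) - f (x - y) - ?D (x - y) (h j)) / norm (h j)" for j y
    have eq: "norm (F (x + h j) - F x - G (h j)) / norm (h j) = \<bar>LINT y|lborel. u y * q j y\<bar>" for j
    proof -
      have "F (x + h j) - F x - G (h j) = (LINT y|lborel. u y * f (x + h j - y) - u y * f (x - y) - u y * ?D (x - y) (h j))"
        unfolding F_def G_def using if_ iD by simp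
      then have "(F (x + h j) - F x - G (h j)) / norm (h j) = (LINT y|lborel. (u y * f (x + h j - y) - u y * f (x - y) - u y * ?D (x - y) (h j)) / norm (h j))"
        by simp
      also have "\<dots> = (LINT y|lborel. u y * q j y)"
        by (intro Bochner_Integration.integral_cong refl) (simp add: q_def algebra_simps)
      finally have "(F (x + h j) - F x - G (h j)) / norm (h j) = (LINT y|lborel. u y * q j y)" .
      then show ?thesis by (metis abs_divide abs_norm_cancel real_norm_def)
    qed
    have "(\<lambda>j. LINT y|lborel. u y * q j y) \<longlonglongrightarrow> (LINT y|lborel. u y * 0)"
    proof (rule integral_dominated_convergence)
      show "integrable lborel (\<lambda>y. (2 * L) * \<bar>u y\<bar>)" using u by simp
      have "\<bar>q j y\<bar> \<le> 2 * L" for j y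
      proof -
        have "\<bar>f (x - y + h j) - f (x - y) - ?D (x - y) (h j)\<bar> \<le> L * norm (h j) + L * norm (h j)"
          using L(3)[of "x - y + h j" "x - y"] L(2)[of "x - y" "h j"] by simp
        then show ?thesis using h(1) by (simp add: q_def divide_le_eq)
      qed
      then show "AE y in lborel. norm (u y * q j y) \<le> (2 * L) * \<bar>u y\<bar>" for j
        using mult_right_mono[of "\<bar>q j _\<bar>" "2 * L" "\<bar>u _\<bar>"] by (intro AE_I2) (simp add: abs_mult mult.commute)
      have "(\<lambda>j. q j y) \<longlonglongrightarrow> 0" for y
      proof -
        have "(\<lambda>h. norm (f (x - y + h) - f (x - y) - ?D (x - y) h) / norm h) \<midarrow>0\<rightarrow> 0"
          using d[of "x - y"] by (simp add: has_derivative_at)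
        then have "(\<lambda>j. norm (f (x - y + h j) - f (x - y) - ?D (x - y) (h j)) / norm (h j)) \<longlonglongrightarrow> 0"
          using h unfolding tendsto_at_iff_sequentially comp_def by blast
        then show ?thesis by (intro tendsto_norm_zero_cancel[of "\<lambda>j. q j y"]) (simp add: q_def)
      qed
      then show "AE y in lborel. (\<lambda>j. u y * q j y) \<longlonglongrightarrow> u y * 0"
        by (intro AE_I2 tendsto_intros)
      show "(\<lambda>y. u y * q j y) \<in> borel_measurable lborel" for j unfolding q_def by measurable
    qed simp
    then have "(\<lambda>j. \<bar>LINT y|lborel. u y * q j y\<bar>) \<longlonglongrightarrow> 0" by (intro tendsto_rabs_zero) simp
    then show "(\<lambda>j. norm (F (x + h j) - F x - G (h j)) / norm (h j)) \<longlonglongrightarrow> 0" unfolding eq .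
  qed
  ultimately show ?thesis unfolding has_derivative_at F_def G_def by blast
qed

lemma Ck_convolution:
  assumes "\<And>j. Ck j f" "\<And>x. norm x > R \<Longrightarrow> f x = 0"
  shows "Ck k (\<lambda>x. LINT y|lborel. u y * f (x - y))"
  using assms
proof (induction k arbitrary: f)
  case 0
  have "(\<lambda>x. LINT y|lborel. u y * f (x - y)) differentiable_on UNIV"
    using has_derivative_convolution[OF 0(1,2)] by (auto simp: differentiable_on_def differentiable_def)
  then show ?case by (simp add: differentiable_imp_continuous_on)
next
  case (Suc k)
  show ?case
  proof (rule Ck_SucI[OF has_derivative_convolution[OF Suc.prems]])
    show "Ck k (\<lambda>x. LINT y|lborel. u y * frechet_derivative f (at (x - y)) h)" for h
    proof (rule Suc.IH)
      show "Ck j (\<lambda>x. frechet_derivative f (at x) h)" for j using Suc.prems(1)[of "Suc j"] by simp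
      show "frechet_derivative f (at x) h = 0" if "norm x > R" for x
        using derivative_zero_outside[OF Suc.prems(2) that] by simp
    qed
  qed
qed

lemma fourier_convolution:
  assumes f: "integrable lborel f" and [measurable]: "f \<in> borel_measurable borel"
  shows "integrable lborel (\<lambda>x. LINT y|lborel. u y * f (x - y))"
    and "fourier (\<lambda>x. LINT y|lborel. u y * f (x - y)) \<xi> = fourier u \<xi> * fourier f \<xi>"
proof -
  have tr: "integrable lborel (\<lambda>x. g (x - y))" if "integrable lborel g" for g :: "'a \<Rightarrow> real" and y
    using integrable_lborel_translate_iff[of g "- y"] that by simp
  have tr2: "(LINT x|lborel. g (x - y)) = (LINT x|lborel. g x)" if "g \<in> borel_measurable borel" for g :: "'a \<Rightarrow> real" and y
    using integral_lborel_translate[of g "- y"] that by simp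
  have pair: "integrable (lborel \<Otimes>\<^sub>M lborel) (\<lambda>(y, x). u y * f (x - y))"
  proof (rule lborel_pair.Fubini_integrable)
    have "(LINT x|lborel. norm (case (y, x) of (y, x) \<Rightarrow> u y * f (x - y))) = \<bar>u y\<bar> * (LINT x|lborel. \<bar>f x\<bar>)" for y
      using tr2[of "\<lambda>x. \<bar>f x\<bar>" y] by (simp add: abs_mult)
    then show "integrable lborel (\<lambda>y. LINT x|lborel. norm (case (y, x) of (y, x) \<Rightarrow> u y * f (x - y)))"
      using u by simp
    show "AE y in lborel. integrable lborel (\<lambda>x. case (y, x) of (y, x) \<Rightarrow> u y * f (x - y))"
      using tr[OF f] by simp
  qed measurable
  show "integrable lborel (\<lambda>x. LINT y|lborel. u y * f (x - y))"
    using lborel_pair.integrable_snd[OF pair] by simp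
  have "fourier (\<lambda>x. LINT y|lborel. u y * f (x - y)) \<xi> = (LINT x|lborel. (LINT y|lborel. (u y * f (x - y)) *\<^sub>R cis (\<xi> \<bullet> x)))"
    unfolding fourier_def
  \<comment> \<open>Moving \<open>cis\<close> under the inner integral uses integrability of its
    integrand, which Fubini grants for almost every \<open>x\<close>.\<close>
  proof (rule Bochner_Integration.integral_cong_AE)
    have "AE x in lborel. integrable lborel (\<lambda>y. u y * f (x - y))"
      using lborel_pair.AE_integrable_snd[OF pair] by simp
    then show "AE x in lborel. (LINT y|lborel. u y * f (x - y)) *\<^sub>R cis (\<xi> \<bullet> x) = (LINT y|lborel. (u y * f (x - y)) *\<^sub>R cis (\<xi> \<bullet> x))"
      by eventually_elim (rule integral_scaleR_left[symmetric])
  qed measurable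
  also have "\<dots> = (LINT y|lborel. (LINT x|lborel. (u y * f (x - y)) *\<^sub>R cis (\<xi> \<bullet> x)))"
  proof (rule lborel_pair.Fubini_integral)
    show "integrable (lborel \<Otimes>\<^sub>M lborel) (\<lambda>(y, x). (u y * f (x - y)) *\<^sub>R cis (\<xi> \<bullet> x))"
      by (rule Bochner_Integration.integrable_bound[OF pair]) auto
  qed
  also have "\<dots> = (LINT y|lborel. (u y *\<^sub>R cis (\<xi> \<bullet> y)) * fourier f \<xi>)"
  proof (rule Bochner_Integration.integral_cong[OF refl])
    fix y
    have "(LINT x|lborel. (u y * f (x - y)) *\<^sub>R cis (\<xi> \<bullet> x)) = u y *\<^sub>R fourier (\<lambda>x. f (x + (- y))) \<xi>"
      unfolding fourier_def by (simp flip: scaleR_scaleR)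
    also have "fourier (\<lambda>x. f (x + (- y))) \<xi> = cis (\<xi> \<bullet> y) * fourier f \<xi>"
      by (subst fourier_translate) simp_all
    finally show "(LINT x|lborel. (u y * f (x - y)) *\<^sub>R cis (\<xi> \<bullet> x)) = (u y *\<^sub>R cis (\<xi> \<bullet> y)) * fourier f \<xi>" by simp
  qed
  also have "\<dots> = fourier u \<xi> * fourier f \<xi>"
    unfolding fourier_def[of u] by (rule integral_mult_left_zero)
  finally show "fourier (\<lambda>x. LINT y|lborel. u y * f (x - y)) \<xi> = fourier u \<xi> * fourier f \<xi>" .
qed

end

section \<open>Test functions and mollifiers\<close>

lemma test_functions_Ck: "f \<in> test_functions \<Omega> \<Longrightarrow> Ck k f"
  by (simp add: test_functions_def)

lemma test_functions_mult:
  assumes "f \<in> test_functions \<Omega>" "g \<in> test_functions \<Omega>"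
  shows "(\<lambda>x. f x * g x) \<in> test_functions \<Omega>"
  using assms unfolding test_functions_def by (auto intro!: Ck_mult)

lemma test_functions_diff:
  assumes "f \<in> test_functions \<Omega>" "g \<in> test_functions \<Omega>"
  shows "(\<lambda>x. f x - g x) \<in> test_functions \<Omega>"
proof -
  obtain K K' where "compact K" "K \<subseteq> \<Omega>" "\<forall>x. x \<notin> K \<longrightarrow> f x = 0" "compact K'" "K' \<subseteq> \<Omega>" "\<forall>x. x \<notin> K' \<longrightarrow> g x = 0"
    using assms unfolding test_functions_def by blast
  then have "compact (K \<union> K')" "K \<union> K' \<subseteq> \<Omega>" "\<forall>x. x \<notin> K \<union> K' \<longrightarrow> f x - g x = 0" by auto
  then show ?thesis using assms unfolding test_functions_def by (blast intro: Ck_diff)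
qed

text \<open>Supplies the hypotheses under which the Riesz gradient was studied.\<close>

lemma test_functions_lipschitz:
  fixes f :: "'a::euclidean_space \<Rightarrow> real"
  assumes f: "f \<in> test_functions \<Omega>"
  obtains L R where "continuous_on UNIV f" "\<forall>x. norm x > R \<longrightarrow> f x = 0" "\<forall>x y. \<bar>f x - f y\<bar> \<le> L * norm (x - y)"
proof -
  obtain K where K: "compact K" "\<forall>x. x \<notin> K \<longrightarrow> f x = 0" using f by (auto simp: test_functions_def)
  obtain R where R: "\<And>x. x \<in> K \<Longrightarrow> norm x \<le> R" using compact_imp_bounded[OF K(1)] by (auto simp: bounded_iff)
  have supp: "f x = 0" if "norm x > R" for x
  proof -
    have "x \<notin> K" using R[of x] that by auto
    then show ?thesis using K(2) by blast
  qed
  have "continuous_on UNIV f" using test_functions_Ck[OF f, of 0] by simp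
  then show thesis
    using compact_support_lipschitz[OF test_functions_Ck[OF f] supp] that supp by metis
qed

text \<open>The use of \<open>x \<bullet> x\<close> keeps the argument smooth at the origin. For
  \<open>c > 0\<close> the support is the ball of radius \<open>1 / c\<close>.\<close>

definition bump :: "real \<Rightarrow> 'a::euclidean_space \<Rightarrow> real" where
  "bump c x = flat 0 (1 - c\<^sup>2 * (x \<bullet> x))"

lemma Ck_bump: "Ck k (bump c)"
  unfolding bump_def[abs_def] by (rule Ck_flat)

lemma bump_nonneg: "bump c x \<ge> 0" and bump_le_1: "bump c x \<le> 1"
  by (auto simp: bump_def flat_def)

lemma bump_scale: "bump c x = bump 1 (c *\<^sub>R x)"
  by (simp add: bump_def power2_eq_square mult.assoc)

lemma bump_support: "c \<ge> 1 \<Longrightarrow> norm x > 1 \<Longrightarrow> bump c x = 0"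
proof -
  assume "c \<ge> 1" "norm x > 1"
  then have "1 \<le> c\<^sup>2 * (norm x)\<^sup>2" using mult_mono[of 1 "c\<^sup>2" 1 "(norm x)\<^sup>2"] by simp
  then show ?thesis by (simp add: bump_def flat_def power2_norm_eq_inner)
qed

lemma bump_continuous: "continuous_on UNIV (bump c)"
  using Ck_bump[of 0 c] by simp

lemma bump_measurable [measurable]: "bump c \<in> borel_measurable borel"
  by (rule borel_measurable_continuous_onI[OF bump_continuous])

lemma bump_integrable: "c \<ge> 1 \<Longrightarrow> integrable lborel (bump c :: 'a::euclidean_space \<Rightarrow> real)"
  by (rule integrable_bounded_support[of _ 1 1]) (auto simp: bump_nonneg bump_le_1 bump_support)

lemma integral_bump_pos: "(LINT x|lborel. bump 1 (x::'a::euclidean_space)) > 0"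
proof -
  have "(LINT x|lborel. bump 1 (x::'a)) \<noteq> 0"
  proof
    assume "(LINT x|lborel. bump 1 (x::'a)) = 0"
    then have "AE x in lborel. bump 1 (x::'a) = 0"
      using integral_nonneg_eq_0_iff_AE[OF bump_integrable[of 1, where 'a='a]] by (simp add: bump_nonneg)
    moreover have "bump 1 x \<noteq> 0" if "x \<in> ball 0 1" for x :: 'a
    proof -
      have "(norm x)\<^sup>2 < 1" using that by (simp add: abs_square_less_1)
      then show ?thesis by (simp add: bump_def flat_def power2_norm_eq_inner)
    qed
    ultimately have "AE x in lborel. (x::'a) \<notin> ball 0 1" by (auto elim!: eventually_mono)
    then have "emeasure lborel (ball (0::'a) 1) = 0" by (subst (asm) AE_iff_measurable[of "ball 0 1"]) auto
    then show False using unit_ball_vol_pos[of "real DIM('a)"] by (simp add: emeasure_ball)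
  qed
  moreover have "(LINT x|lborel. bump 1 (x::'a)) \<ge> 0" by (simp add: bump_nonneg integral_nonneg)
  ultimately show ?thesis by simp
qed

text \<open>The factor \<open>c ^ DIM('a)\<close> offsets the volume change under dilation, so the
  mass is 1 at every scale \<open>c > 0\<close>.\<close>

definition mollifier :: "real \<Rightarrow> 'a::euclidean_space \<Rightarrow> real" where
  "mollifier c x = (c ^ DIM('a) / (LINT x|lborel. bump 1 (x::'a))) * bump c x"

lemma Ck_mollifier: "Ck k (mollifier c)"
  unfolding mollifier_def[abs_def] by (rule Ck_cmult[OF Ck_bump])

lemma mollifier_measurable [measurable]: "mollifier c \<in> borel_measurable borel"
  unfolding mollifier_def[abs_def] by measurable

lemma mollifier_support: "c \<ge> 1 \<Longrightarrow> norm x > 1 \<Longrightarrow> mollifier c x = 0"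
  by (simp add: mollifier_def bump_support)

lemma mollifier_integrable: "c \<ge> 1 \<Longrightarrow> integrable lborel (mollifier c :: 'a::euclidean_space \<Rightarrow> real)"
  unfolding mollifier_def[abs_def] by (intro integrable_mult_right bump_integrable)

text \<open>By scaling, the transform at \<open>\<xi>\<close> is that of \<open>mollifier 1\<close>
  at \<open>\<xi> / c\<close>. Unit mass and nonnegativity then give the bound 1, and letting
  \<open>c\<close> grow gives the limit 1.\<close>

lemma fourier_mollifier:
  assumes c: "c \<ge> 1"
  shows "fourier (mollifier c) \<xi> = (LINT x|lborel. mollifier 1 x *\<^sub>R cis (\<xi> \<bullet> (inverse c *\<^sub>R (x::'a::euclidean_space))))"
proof -
  let ?h = "\<lambda>x::'a. mollifier c x *\<^sub>R cis (\<xi> \<bullet> x)"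
  have "fourier (mollifier c) \<xi> = (\<bar>inverse c\<bar> ^ DIM('a)) *\<^sub>R (LINT x|lborel. ?h (inverse c *\<^sub>R x))"
    unfolding fourier_def using c by (intro integral_lborel_scale) auto
  also have "\<dots> = (LINT x|lborel. (\<bar>inverse c\<bar> ^ DIM('a)) *\<^sub>R ?h (inverse c *\<^sub>R x))"
    by (rule integral_scaleR_right[symmetric])
  also have "\<dots> = (LINT x|lborel. mollifier 1 x *\<^sub>R cis (\<xi> \<bullet> (inverse c *\<^sub>R x)))"
  proof (intro Bochner_Integration.integral_cong refl)
    fix x :: 'a
    have "bump c (inverse c *\<^sub>R x) = bump 1 x" using c by (subst bump_scale) simp
    moreover have "\<bar>inverse c\<bar> ^ DIM('a) * c ^ DIM('a) = 1" using c by (simp flip: power_mult_distrib)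
    ultimately show "(\<bar>inverse c\<bar> ^ DIM('a)) *\<^sub>R ?h (inverse c *\<^sub>R x) = mollifier 1 x *\<^sub>R cis (\<xi> \<bullet> (inverse c *\<^sub>R x))"
      by (simp add: mollifier_def)
  qed
  finally show ?thesis .
qed

lemma integral_mollifier: "(LINT x|lborel. mollifier 1 (x::'a::euclidean_space)) = 1"
  using integral_bump_pos[where 'a='a] by (simp add: mollifier_def)

lemma mollifier_nonneg: "c \<ge> 0 \<Longrightarrow> mollifier c (x::'a::euclidean_space) \<ge> 0"
  using integral_bump_pos[where 'a='a] by (simp add: mollifier_def bump_nonneg)

lemma norm_fourier_mollifier_le:
  assumes c: "c \<ge> 1"
  shows "norm (fourier (mollifier c) (\<xi>::'a::euclidean_space)) \<le> 1"
proof -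
  have "norm (fourier (mollifier c) \<xi>) \<le> (LINT x|lborel. norm (mollifier 1 x *\<^sub>R cis (\<xi> \<bullet> (inverse c *\<^sub>R x))))"
    unfolding fourier_mollifier[OF c] by (rule integral_norm_bound)
  also have "\<dots> = 1" using integral_mollifier[where 'a='a] by (simp add: mollifier_nonneg)
  finally show ?thesis .
qed

lemma fourier_mollifier_tendsto: "(\<lambda>k. fourier (mollifier (real (Suc k))) (\<xi>::'a::euclidean_space)) \<longlonglongrightarrow> 1"
proof -
  have "(\<lambda>k. LINT x|lborel. mollifier 1 x *\<^sub>R cis (\<xi> \<bullet> (inverse (real (Suc k)) *\<^sub>R (x::'a)))) \<longlonglongrightarrow> (LINT x|lborel. mollifier 1 (x::'a) *\<^sub>R 1)"
  proof (rule integral_dominated_convergence)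
    show "integrable lborel (mollifier 1 :: 'a \<Rightarrow> real)" by (rule mollifier_integrable) simp
    show "AE x in lborel. norm (mollifier 1 x *\<^sub>R cis (\<xi> \<bullet> (inverse (real (Suc k)) *\<^sub>R (x::'a)))) \<le> mollifier 1 x" for k
      by (simp add: mollifier_nonneg)
    have "(\<lambda>k. cis (inverse (real (Suc k)) * (\<xi> \<bullet> x))) \<longlonglongrightarrow> cis (0 * (\<xi> \<bullet> x))" for x
      by (intro tendsto_intros LIMSEQ_inverse_real_of_nat)
    then show "AE x in lborel. (\<lambda>k. mollifier 1 x *\<^sub>R cis (\<xi> \<bullet> (inverse (real (Suc k)) *\<^sub>R (x::'a)))) \<longlonglongrightarrow> mollifier 1 x *\<^sub>R 1"
      by (intro AE_I2 tendsto_scaleR tendsto_const) simp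
  qed measurable
  also have "(LINT x|lborel. mollifier 1 (x::'a) *\<^sub>R (1::complex)) = 1"
    using integral_mollifier[where 'a='a] by (simp add: mollifier_integrable)
  finally show ?thesis
    using fourier_mollifier[of "real (Suc _)" \<xi>] by simp
qed

section \<open>Approximation in the fractional Sobolev space\<close>

lemma gagliardo_sq_cong_AE:
  fixes f g :: "'a::euclidean_space \<Rightarrow> real"
  assumes "AE x in lborel. f x = g x"
  shows "gagliardo_sq s f = gagliardo_sq s g"
  unfolding gagliardo_sq_def nn_integral_completion
  by (rule nn_integral_cong_AE, use assms in eventually_elim, rule nn_integral_cong_AE, use assms in eventually_elim) simp

lemma L2_sq_cong_AE:
  assumes "AE x in lborel. f x = g x"
  shows "L2_sq f = L2_sq g"
  unfolding L2_sq_def nn_integral_completion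
  by (rule nn_integral_cong_AE, use assms in eventually_elim) simp

lemma L2_sq_real: "L2_sq f = (\<integral>\<^sup>+x. ennreal ((f x)\<^sup>2) \<partial>lborel)" for f :: "'a::euclidean_space \<Rightarrow> real"
  by (simp add: L2_sq_def nn_integral_completion)

lemma integrable_square_iff:
  fixes f :: "'a \<Rightarrow> real"
  assumes "f \<in> borel_measurable M"
  shows "integrable M (\<lambda>x. (f x)\<^sup>2) \<longleftrightarrow> (\<integral>\<^sup>+x. ennreal ((f x)\<^sup>2) \<partial>M) < \<infinity>"
  using assms by (simp add: integrable_iff_bounded)

text \<open>For bounded \<open>\<Omega>\<close> this makes elements of \<open>Hs_Omega\<close>
  integrable, as Plancherel requires. On the ball
  \<open>\<bar>f x\<bar> \<le> (f x)\<^sup>2 + 1\<close>.\<close>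

lemma integrable_of_square_integrable_bounded_support:
  fixes f :: "'a::euclidean_space \<Rightarrow> real"
  assumes [measurable]: "f \<in> borel_measurable borel" and L2: "integrable lborel (\<lambda>x. (f x)\<^sup>2)"
    and supp: "\<And>x. norm x > R \<Longrightarrow> f x = 0"
  shows "integrable lborel f"
proof (rule Bochner_Integration.integrable_bound)
  show "integrable lborel (\<lambda>x. (f x)\<^sup>2 + indicator (cball 0 R) x)"
    using emeasure_lborel_cball_finite[of "0::'a" R] by (intro Bochner_Integration.integrable_add L2 integrable_real_indicator) auto
  have "\<bar>f x\<bar> \<le> (f x)\<^sup>2 + indicator (cball 0 R) x" for x
  proof (cases "norm x > R")
    case False
    have "0 \<le> (\<bar>f x\<bar> - 1)\<^sup>2 + \<bar>f x\<bar>" by simp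
    then have "\<bar>f x\<bar> \<le> (f x)\<^sup>2 + 1" by (simp add: power2_diff)
    then show ?thesis using False by simp
  qed (use supp in simp)
  then show "AE x in lborel. norm (f x) \<le> norm ((f x)\<^sup>2 + indicator (cball 0 R) x)"
    by (auto intro: order_trans[OF _ abs_ge_self])
qed measurable

text \<open>Convolution with a mollifier multiplies the transform by
  \<open>fourier (\<rho> k)\<close>, which is bounded by 1 and tends to 1. Plancherel and
  \<open>gagliardo_sq_fourier\<close> turn both parts of the norm into frequency integrals, where
  dominated convergence applies. The supports may spread beyond \<open>\<Omega>\<close>, so the
  approximants are test functions on the whole space.\<close>

lemma Hs_approx_exists:
  fixes u :: "'a::euclidean_space \<Rightarrow> real"
  assumes s: "0 < s" "s < 1" and u: "u \<in> Hs_Omega s \<Omega>" and "bounded \<Omega>"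
  obtains \<phi> where "Hs_approx s UNIV \<phi> u"
proof -
  have um: "u \<in> borel_measurable lebesgue" and uL: "L2_sq u < \<infinity>" and uG: "gagliardo_sq s u < \<infinity>"
    and u0: "AE x in lborel. x \<notin> \<Omega> \<longrightarrow> u x = 0"
    using u by (auto simp: Hs_Omega_def Hs_def AE_completion_iff)
  obtain R where R: "\<And>x. x \<in> \<Omega> \<Longrightarrow> norm x \<le> R" using \<open>bounded \<Omega>\<close> by (auto simp: bounded_iff)
  obtain v where v[measurable]: "v \<in> borel_measurable borel" and uv: "AE x in lborel. u x = v x"
    using completion_ex_borel_measurable_real[OF um] by auto
  \<comment> \<open>The Fourier lemmas are about Borel functions: \<open>w\<close> is a Borel
    version of \<open>u\<close> that vanishes outside a ball at every point and not just almost
    everywhere.\<close>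
  define w where "w x = v x * indicator (cball 0 R) x" for x
  have w[measurable]: "w \<in> borel_measurable borel"
    unfolding w_def[abs_def] by (intro borel_measurable_times borel_measurable_indicator v) auto
  have uw: "AE x in lborel. u x = w x"
    using uv u0 by eventually_elim (use R in \<open>auto simp: w_def indicator_def\<close>)
  have supp: "w x = 0" if "norm x > R" for x using that by (simp add: w_def)
  have "(\<integral>\<^sup>+x. ennreal ((w x)\<^sup>2) \<partial>lborel) < \<infinity>"
    using uL L2_sq_cong_AE[OF uw] by (simp add: L2_sq_real)
  then have w2: "integrable lborel (\<lambda>x. (w x)\<^sup>2)" by (subst integrable_square_iff) auto
  then have w1: "integrable lborel w" by (rule integrable_of_square_integrable_bounded_support[OF w _ supp])
  define F where "F = fourier w"
  have [measurable]: "F \<in> borel_measurable borel" unfolding F_def by measurable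
  define C where "C = 2 / (C_ns DIM('a) s * (2 * pi) ^ DIM('a))"
  have C: "C > 0" using C_ns_pos[OF s, of "DIM('a)"] by (simp add: C_def)
  have "gagliardo_sq s w < \<infinity>" using uG gagliardo_sq_cong_AE[OF uw] by simp
  then have "ennreal C * spectral_energy s F < \<infinity>"
    unfolding F_def C_def gagliardo_sq_fourier[OF s w w1 w2] .
  then have Fs: "spectral_energy s F < \<infinity>"
    using C by (auto simp: ennreal_mult_less_top)
  have F2: "(\<integral>\<^sup>+\<xi>. ennreal ((norm (F \<xi>))\<^sup>2) \<partial>lborel) < \<infinity>"
    unfolding F_def plancherel[OF w w2 w1]
    using w2 integrable_square_iff[of w lborel] by (simp add: ennreal_mult_less_top)
  define \<rho> where "\<rho> k = (mollifier (real (Suc k)) :: 'a \<Rightarrow> real)" for k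
  define \<phi> where "\<phi> k x = (LINT y|lborel. w y * \<rho> k (x - y))" for k x
  have \<rho>supp: "\<rho> k x = 0" if "norm x > 1" for k x using that by (simp add: \<rho>_def mollifier_support)
  have \<rho>m[measurable]: "\<rho> k \<in> borel_measurable borel" and \<rho>1: "integrable lborel (\<rho> k)" for k
    by (simp_all add: \<rho>_def mollifier_integrable)
  have Ck\<phi>: "Ck j (\<phi> k)" for j k
    unfolding \<phi>_def[abs_def] by (rule Ck_convolution[OF w1 w _ \<rho>supp]) (simp add: \<rho>_def Ck_mollifier)
  have \<phi>supp: "\<phi> k x = 0" if "norm x > R + 1" for k x
  proof -
    have z: "w y * \<rho> k (x - y) = 0" for y
    proof (cases "norm y > R")
      case False
      have "norm x \<le> norm (x - y) + norm y" by (metis diff_add_cancel norm_triangle_ineq)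
      then have "norm (x - y) > 1" using that False by linarith
      then show ?thesis by (simp add: \<rho>supp)
    qed (simp add: supp)
    show ?thesis unfolding \<phi>_def z by simp
  qed
  have \<phi>t: "\<phi> k \<in> test_functions UNIV" for k
  proof -
    have "\<forall>x. x \<notin> cball 0 (R + 1) \<longrightarrow> \<phi> k x = 0" using \<phi>supp by simp
    then have "\<exists>K. compact K \<and> K \<subseteq> UNIV \<and> (\<forall>x. x \<notin> K \<longrightarrow> \<phi> k x = 0)" by (intro exI[of _ "cball 0 (R + 1)"]) simp
    then show ?thesis unfolding test_functions_def using Ck\<phi> by simp
  qed
  have \<phi>m[measurable]: "\<phi> k \<in> borel_measurable borel" for k
    using Ck\<phi>[of 0 k] by (intro borel_measurable_continuous_onI) simp
  have \<phi>1: "integrable lborel (\<phi> k)" for k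
    using fourier_convolution(1)[OF w1 w \<rho>1[of k] \<rho>m[of k]] unfolding \<phi>_def[abs_def] .
  have F\<phi>: "fourier (\<phi> k) \<xi> = F \<xi> * fourier (\<rho> k) \<xi>" for k \<xi>
    using fourier_convolution(2)[OF w1 w \<rho>1[of k] \<rho>m[of k]] unfolding \<phi>_def[abs_def] F_def .
  have \<phi>2: "integrable lborel (\<lambda>x. (\<phi> k x)\<^sup>2)" for k
  proof -
    obtain L r where "continuous_on UNIV (\<phi> k)" "\<forall>x. norm x > r \<longrightarrow> \<phi> k x = 0" "\<forall>x y. \<bar>\<phi> k x - \<phi> k y\<bar> \<le> L * norm (x - y)"
      by (rule test_functions_lipschitz[OF \<phi>t])
    then show ?thesis by (intro lipschitz_integrable(2)[of "\<phi> k" r L]) auto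
  qed
  define d where "d k x = \<phi> k x - w x" for k x
  have [measurable]: "d k \<in> borel_measurable borel" for k unfolding d_def[abs_def] by measurable
  have d1: "integrable lborel (d k)" for k unfolding d_def[abs_def] using \<phi>1 w1 by simp
  have d2: "integrable lborel (\<lambda>x. (d k x)\<^sup>2)" for k
  proof (rule Bochner_Integration.integrable_bound)
    show "integrable lborel (\<lambda>x. 2 * (\<phi> k x)\<^sup>2 + 2 * (w x)\<^sup>2)" using \<phi>2 w2 by simp
    have "(d k x)\<^sup>2 \<le> 2 * (\<phi> k x)\<^sup>2 + 2 * (w x)\<^sup>2" for x
      using zero_le_power2[of "\<phi> k x + w x"] by (simp add: d_def power2_diff power2_sum)
    then show "AE x in lborel. norm ((d k x)\<^sup>2) \<le> norm (2 * (\<phi> k x)\<^sup>2 + 2 * (w x)\<^sup>2)" by simp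
  qed measurable
  define m where "m k \<xi> = (norm (fourier (\<rho> k) \<xi> - 1))\<^sup>2" for k \<xi>
  have [measurable]: "m k \<in> borel_measurable borel" for k unfolding m_def[abs_def] by measurable
  have Fd: "(norm (fourier (d k) \<xi>))\<^sup>2 = (norm (F \<xi>))\<^sup>2 * m k \<xi>" for k \<xi>
  proof -
    have "fourier (d k) \<xi> = F \<xi> * (fourier (\<rho> k) \<xi> - 1)"
      unfolding d_def[abs_def] by (subst fourier_diff[OF \<phi>1 w1]) (simp add: F\<phi> F_def algebra_simps)
    then show ?thesis by (simp add: norm_mult power_mult_distrib m_def)
  qed
  have m4: "m k \<xi> \<le> 4" "0 \<le> m k \<xi>" for k \<xi>
  proof -
    have "norm (fourier (\<rho> k) \<xi>) \<le> 1" unfolding \<rho>_def by (rule norm_fourier_mollifier_le) simp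
    then have "norm (fourier (\<rho> k) \<xi> - 1) \<le> 2" using norm_triangle_ineq4[of "fourier (\<rho> k) \<xi>" 1] by simp
    from power_mono[OF this, of 2] show "m k \<xi> \<le> 4" by (simp add: m_def)
  qed (simp add: m_def)
  have m0: "(\<lambda>k. m k \<xi>) \<longlonglongrightarrow> 0" for \<xi>
  proof -
    have "(\<lambda>k. (norm (fourier (\<rho> k) \<xi> - 1))\<^sup>2) \<longlonglongrightarrow> (norm (1 - 1 :: complex))\<^sup>2"
      unfolding \<rho>_def by (intro tendsto_intros fourier_mollifier_tendsto)
    then show ?thesis by (simp add: m_def)
  qed
  \<comment> \<open>Used with \<open>h \<xi> = 1\<close> for the L^2 part and with
    \<open>h \<xi> = norm \<xi> powr (2 * s)\<close> for the seminorm; the bound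
    \<open>m k \<xi> \<le> 4\<close> gives the dominating function.\<close>
  have lim: "(\<lambda>k. \<integral>\<^sup>+\<xi>. ennreal (h \<xi> * ((norm (F \<xi>))\<^sup>2 * m k \<xi>)) \<partial>lborel) \<longlonglongrightarrow> 0"
    if [measurable]: "h \<in> borel_measurable borel" and h0: "\<And>\<xi>. h \<xi> \<ge> 0"
      and fin: "(\<integral>\<^sup>+\<xi>. ennreal (h \<xi> * (norm (F \<xi>))\<^sup>2) \<partial>lborel) < \<infinity>" for h
  proof -
    have "(\<lambda>k. \<integral>\<^sup>+\<xi>. ennreal (h \<xi> * ((norm (F \<xi>))\<^sup>2 * m k \<xi>)) \<partial>lborel) \<longlonglongrightarrow> (\<integral>\<^sup>+\<xi>. 0 \<partial>(lborel::'a measure))"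
    proof (rule nn_integral_dominated_convergence[where w="\<lambda>\<xi>. 4 * ennreal (h \<xi> * (norm (F \<xi>))\<^sup>2)"])
      have "h \<xi> * ((norm (F \<xi>))\<^sup>2 * m k \<xi>) \<le> 4 * (h \<xi> * (norm (F \<xi>))\<^sup>2)" for k \<xi>
        using mult_left_mono[OF m4(1)[of k \<xi>], of "h \<xi> * (norm (F \<xi>))\<^sup>2"] h0 by (simp add: mult_ac)
      then have "ennreal (h \<xi> * ((norm (F \<xi>))\<^sup>2 * m k \<xi>)) \<le> ennreal (4 * (h \<xi> * (norm (F \<xi>))\<^sup>2))" for k \<xi>
        by (rule ennreal_leI)
      moreover have "ennreal (4 * x) = 4 * ennreal x" for x
        by (subst ennreal_mult') auto
      ultimately show "AE \<xi> in lborel. ennreal (h \<xi> * ((norm (F \<xi>))\<^sup>2 * m k \<xi>)) \<le> 4 * ennreal (h \<xi> * (norm (F \<xi>))\<^sup>2)" for k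
        by (intro AE_I2) metis
      show "(\<integral>\<^sup>+\<xi>. 4 * ennreal (h \<xi> * (norm (F \<xi>))\<^sup>2) \<partial>lborel) < \<infinity>"
        using fin by (subst nn_integral_cmult) (auto simp: ennreal_mult_less_top)
      have "(\<lambda>k. h \<xi> * ((norm (F \<xi>))\<^sup>2 * m k \<xi>)) \<longlonglongrightarrow> h \<xi> * ((norm (F \<xi>))\<^sup>2 * 0)" for \<xi>
        by (intro tendsto_intros m0)
      then show "AE \<xi> in lborel. (\<lambda>k. ennreal (h \<xi> * ((norm (F \<xi>))\<^sup>2 * m k \<xi>))) \<longlonglongrightarrow> 0"
        using tendsto_ennrealI by (intro AE_I2) fastforce
    qed measurable
    then show ?thesis by simp
  qed
  have L2d: "(\<lambda>k. L2_sq (d k)) \<longlonglongrightarrow> 0"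
  proof -
    define P where "P = (2 * pi) ^ DIM('a)"
    have P: "P > 0" by (simp add: P_def)
    have "ennreal (1 / P) * (\<integral>\<^sup>+\<xi>. ennreal (1 * ((norm (F \<xi>))\<^sup>2 * m k \<xi>)) \<partial>lborel) = L2_sq (d k)" for k
    proof -
      have "(\<integral>\<^sup>+\<xi>. ennreal (1 * ((norm (F \<xi>))\<^sup>2 * m k \<xi>)) \<partial>lborel) = ennreal P * L2_sq (d k)"
        unfolding L2_sq_real P_def using plancherel[of "d k", OF _ d2 d1] by (simp add: Fd)
      then show ?thesis using P by (simp add: mult.assoc[symmetric] ennreal_mult'[symmetric])
    qed
    moreover have "(\<lambda>k. ennreal (1 / P) * (\<integral>\<^sup>+\<xi>. ennreal (1 * ((norm (F \<xi>))\<^sup>2 * m k \<xi>)) \<partial>lborel)) \<longlonglongrightarrow> ennreal (1 / P) * 0"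
      using F2 by (intro ennreal_tendsto_cmult lim) auto
    ultimately show ?thesis by simp
  qed
  have Gd: "(\<lambda>k. gagliardo_sq s (d k)) \<longlonglongrightarrow> 0"
  proof -
    have "gagliardo_sq s (d k) = ennreal C * (\<integral>\<^sup>+\<xi>. ennreal (norm \<xi> powr (2 * s) * ((norm (F \<xi>))\<^sup>2 * m k \<xi>)) \<partial>lborel)" for k
      unfolding C_def using gagliardo_sq_fourier[OF s _ d1 d2] by (simp add: spectral_energy_def Fd)
    moreover have "(\<lambda>k. ennreal C * (\<integral>\<^sup>+\<xi>. ennreal (norm \<xi> powr (2 * s) * ((norm (F \<xi>))\<^sup>2 * m k \<xi>)) \<partial>lborel)) \<longlonglongrightarrow> ennreal C * 0"
      using Fs unfolding spectral_energy_def by (intro ennreal_tendsto_cmult lim) auto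
    ultimately show ?thesis by simp
  qed
  have dist: "AE x in lborel. \<phi> k x - u x = d k x" for k
    using uw by eventually_elim (simp add: d_def)
  have "(\<lambda>k. L2_sq (\<lambda>x. \<phi> k x - u x) + gagliardo_sq s (\<lambda>x. \<phi> k x - u x)) \<longlonglongrightarrow> 0 + 0"
    unfolding L2_sq_cong_AE[OF dist] gagliardo_sq_cong_AE[OF dist] by (intro tendsto_add L2d Gd)
  then have "Hs_approx s UNIV \<phi> u" using \<phi>t by (simp add: Hs_approx_def)
  then show thesis by (rule that)
qed

section \<open>The nonlocal gradient on \<open>H\<^sup>s\<close>\<close>

text \<open>Young's inequality with a free weight. A fixed \<open>e\<close> would spoil the constant
  \<open>C_ns / 2\<close>; in \<open>nl_grad_props\<close> it is sent to 0 after the error terms,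
  with their factor \<open>1 + 1 / e\<close>, have vanished.\<close>

lemma norm_add_sq_le:
  fixes a b :: "'a::real_inner"
  assumes e: "e > 0"
  shows "(norm (a + b))\<^sup>2 \<le> (1 + e) * (norm a)\<^sup>2 + (1 + 1 / e) * (norm b)\<^sup>2"
proof -
  have "2 * (norm a * norm b) = 2 * (sqrt e * norm a) * (norm b / sqrt e)" using e by simp
  also have "\<dots> \<le> (sqrt e * norm a)\<^sup>2 + (norm b / sqrt e)\<^sup>2"
    using sum_squares_bound[of "sqrt e * norm a" "norm b / sqrt e"] by simp
  also have "\<dots> = e * (norm a)\<^sup>2 + (norm b)\<^sup>2 / e" using e by (simp add: power_mult_distrib power_divide)
  finally have "2 * (norm a * norm b) \<le> e * (norm a)\<^sup>2 + (norm b)\<^sup>2 / e" .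
  moreover have "(norm (a + b))\<^sup>2 \<le> (norm a + norm b)\<^sup>2" by (intro power_mono norm_triangle_ineq) auto
  ultimately show ?thesis by (simp add: power2_sum algebra_simps)
qed

lemma L2_sq_add_le:
  fixes f g :: "'a::euclidean_space \<Rightarrow> 'b::euclidean_space"
  assumes e: "e > 0" and [measurable]: "f \<in> borel_measurable lebesgue" "g \<in> borel_measurable lebesgue"
  shows "L2_sq (\<lambda>x. f x + g x) \<le> ennreal (1 + e) * L2_sq f + ennreal (1 + 1 / e) * L2_sq g"
proof -
  have "L2_sq (\<lambda>x. f x + g x) \<le> (\<integral>\<^sup>+x. ennreal (1 + e) * ennreal ((norm (f x))\<^sup>2) + ennreal (1 + 1 / e) * ennreal ((norm (g x))\<^sup>2) \<partial>lebesgue)"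
    unfolding L2_sq_def
  proof (rule nn_integral_mono)
    fix x
    have "ennreal ((norm (f x + g x))\<^sup>2) \<le> ennreal ((1 + e) * (norm (f x))\<^sup>2 + (1 + 1 / e) * (norm (g x))\<^sup>2)"
      by (rule ennreal_leI[OF norm_add_sq_le[OF e]])
    also have "\<dots> = ennreal ((1 + e) * (norm (f x))\<^sup>2) + ennreal ((1 + 1 / e) * (norm (g x))\<^sup>2)"
      using e by (intro ennreal_plus mult_nonneg_nonneg) auto
    also have "\<dots> = ennreal (1 + e) * ennreal ((norm (f x))\<^sup>2) + ennreal (1 + 1 / e) * ennreal ((norm (g x))\<^sup>2)"
      using e by (intro arg_cong2[where f="(+)"] ennreal_mult) auto
    finally show "ennreal ((norm (f x + g x))\<^sup>2) \<le> \<dots>" .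
  qed
  also have "\<dots> = ennreal (1 + e) * L2_sq f + ennreal (1 + 1 / e) * L2_sq g"
    unfolding L2_sq_def by (subst nn_integral_add) (auto simp: nn_integral_cmult)
  finally show ?thesis .
qed

lemma gagliardo_sq_add_le:
  fixes f g :: "'a::euclidean_space \<Rightarrow> real"
  assumes e: "e > 0" and [measurable]: "f \<in> borel_measurable borel" "g \<in> borel_measurable borel"
  shows "gagliardo_sq s (\<lambda>x. f x + g x) \<le> ennreal (1 + e) * gagliardo_sq s f + ennreal (1 + 1 / e) * gagliardo_sq s g"
proof -
  let ?k = "\<lambda>x y. norm (x - y) powr (real DIM('a) + 2 * s)"
  let ?G = "\<lambda>f (x::'a) (y::'a). ennreal (\<bar>f x - f y\<bar>\<^sup>2 / ?k x y)"
  have "gagliardo_sq s (\<lambda>x. f x + g x) \<le> (\<integral>\<^sup>+x. (\<integral>\<^sup>+y. ennreal (1 + e) * ?G f x y + ennreal (1 + 1 / e) * ?G g x y \<partial>lborel) \<partial>lborel)"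
    unfolding gagliardo_sq_def nn_integral_completion
  proof (intro nn_integral_mono)
    fix x y :: 'a
    have "\<bar>f x + g x - (f y + g y)\<bar>\<^sup>2 \<le> (1 + e) * \<bar>f x - f y\<bar>\<^sup>2 + (1 + 1 / e) * \<bar>g x - g y\<bar>\<^sup>2"
      using norm_add_sq_le[OF e, of "f x - f y" "g x - g y"] by (simp add: algebra_simps)
    then have "\<bar>f x + g x - (f y + g y)\<bar>\<^sup>2 / ?k x y \<le> ((1 + e) * \<bar>f x - f y\<bar>\<^sup>2 + (1 + 1 / e) * \<bar>g x - g y\<bar>\<^sup>2) / ?k x y"
      by (rule divide_right_mono) simp
    also have "\<dots> = (1 + e) * (\<bar>f x - f y\<bar>\<^sup>2 / ?k x y) + (1 + 1 / e) * (\<bar>g x - g y\<bar>\<^sup>2 / ?k x y)"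
      by (simp add: add_divide_distrib)
    finally have "ennreal (\<bar>f x + g x - (f y + g y)\<bar>\<^sup>2 / ?k x y)
        \<le> ennreal ((1 + e) * (\<bar>f x - f y\<bar>\<^sup>2 / ?k x y) + (1 + 1 / e) * (\<bar>g x - g y\<bar>\<^sup>2 / ?k x y))"
      by (rule ennreal_leI)
    also have "\<dots> = ennreal ((1 + e) * (\<bar>f x - f y\<bar>\<^sup>2 / ?k x y)) + ennreal ((1 + 1 / e) * (\<bar>g x - g y\<bar>\<^sup>2 / ?k x y))"
      using e by (intro ennreal_plus mult_nonneg_nonneg divide_nonneg_nonneg) auto
    also have "\<dots> = ennreal (1 + e) * ?G f x y + ennreal (1 + 1 / e) * ?G g x y"
      using e by (intro arg_cong2[where f="(+)"] ennreal_mult) auto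
    finally show "ennreal (\<bar>f x + g x - (f y + g y)\<bar>\<^sup>2 / ?k x y) \<le> ennreal (1 + e) * ?G f x y + ennreal (1 + 1 / e) * ?G g x y" .
  qed
  also have "\<dots> = (\<integral>\<^sup>+x. ennreal (1 + e) * (\<integral>\<^sup>+y. ?G f x y \<partial>lborel) + ennreal (1 + 1 / e) * (\<integral>\<^sup>+y. ?G g x y \<partial>lborel) \<partial>lborel)"
    by (intro nn_integral_cong) (subst nn_integral_add, auto simp: nn_integral_cmult)
  also have "\<dots> = ennreal (1 + e) * gagliardo_sq s f + ennreal (1 + 1 / e) * gagliardo_sq s g"
    unfolding gagliardo_sq_def nn_integral_completion
    by (subst nn_integral_add) (auto simp: nn_integral_cmult)
  finally show ?thesis .
qed

text \<open>The completeness argument of Riesz and Fischer. Convergence along a subsequence is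
  enough, since a subsequence of an approximating sequence is again a witness for
  \<open>nl_grad\<close>.\<close>

lemma L2_sq_complete:
  fixes f :: "nat \<Rightarrow> 'a::euclidean_space \<Rightarrow> 'b::euclidean_space"
  assumes f[measurable]: "\<And>k. f k \<in> borel_measurable lebesgue"
    and Cauchy: "\<And>e. e > 0 \<Longrightarrow> \<exists>N. \<forall>m\<ge>N. \<forall>n\<ge>N. L2_sq (\<lambda>x. f m x - f n x) < ennreal e"
    and fin: "\<And>k. L2_sq (f k) < \<infinity>"
  obtains g r where "g \<in> borel_measurable lebesgue" "L2_sq g < \<infinity>" "strict_mono (r :: nat \<Rightarrow> nat)"
    "(\<lambda>k. L2_sq (\<lambda>x. f (r k) x - g x)) \<longlonglongrightarrow> 0"
proof -
  obtain N where N: "\<And>j m n. m \<ge> N j \<Longrightarrow> n \<ge> N j \<Longrightarrow> L2_sq (\<lambda>x. f m x - f n x) < ennreal ((1/4) ^ j)"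
    using Cauchy[of "(1/4) ^ j" for j] by (metis zero_less_power zero_less_divide_1_iff zero_less_numeral)
  define r where "r = rec_nat (N 0) (\<lambda>j p. max (Suc p) (N (Suc j)))"
  have rs: "r (Suc j) > r j" for j by (simp add: r_def)
  then have r: "strict_mono r" by (simp add: strict_mono_Suc_iff)
  have rN: "r j \<ge> N j" for j by (cases j) (auto simp: r_def)
  have mono: "r i \<le> r j" if "i \<le> j" for i j using r that by (simp add: strict_mono_less_eq)
  define d where "d j x = (norm (f (r (Suc j)) x - f (r j) x))\<^sup>2" for j x
  have [measurable]: "d j \<in> borel_measurable lebesgue" for j unfolding d_def[abs_def] by measurable
  \<comment> \<open>The bounds \<open>(1/4) ^ j\<close> absorb the weight \<open>2 ^ j\<close> and
    stay summable. Where the weighted series is finite, the increments of the subsequence decay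
    geometrically.\<close>
  have dj: "(\<integral>\<^sup>+x. ennreal (2 ^ j * d j x) \<partial>lebesgue) \<le> ennreal ((1/2) ^ j)" for j
  proof -
    have "L2_sq (\<lambda>x. f (r (Suc j)) x - f (r j) x) < ennreal ((1/4) ^ j)"
      using rN[of j] mono[of j "Suc j"] by (intro N) auto
    then have "ennreal (2 ^ j) * L2_sq (\<lambda>x. f (r (Suc j)) x - f (r j) x) \<le> ennreal (2 ^ j) * ennreal ((1/4) ^ j)"
      by (intro mult_left_mono) auto
    also have "\<dots> = ennreal ((1/2) ^ j)" by (simp add: ennreal_mult'[symmetric] flip: power_mult_distrib)
    finally show ?thesis
      unfolding L2_sq_def d_def by (simp add: ennreal_mult' nn_integral_cmult)
  qed
  have "(\<integral>\<^sup>+x. (\<Sum>j. ennreal (2 ^ j * d j x)) \<partial>lebesgue) = (\<Sum>j. \<integral>\<^sup>+x. ennreal (2 ^ j * d j x) \<partial>lebesgue)"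
    by (rule nn_integral_suminf) measurable
  also have "\<dots> \<le> (\<Sum>j. ennreal ((1/2) ^ j))" by (intro suminf_le dj) auto
  also have "\<dots> = ennreal (\<Sum>j. (1/2) ^ j)" by (intro suminf_ennreal2) (auto simp: summable_geometric)
  also have "\<dots> < \<infinity>" by simp
  finally have "AE x in lebesgue. (\<Sum>j. ennreal (2 ^ j * d j x)) \<noteq> \<infinity>"
    by (intro nn_integral_PInf_AE) auto
  then have conv: "AE x in lebesgue. convergent (\<lambda>j. f (r j) x)"
  proof eventually_elim
    case (elim x)
    then obtain S where S: "S \<ge> 0" "(\<Sum>j. ennreal (2 ^ j * d j x)) = ennreal S"
      by (cases "\<Sum>j. ennreal (2 ^ j * d j x)") auto
    have b: "norm (f (r (Suc j)) x - f (r j) x) \<le> sqrt S * (sqrt (1/2)) ^ j" for j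
    proof -
      have "ennreal (2 ^ j * d j x) \<le> ennreal S"
        unfolding S(2)[symmetric] using sum_le_suminf[of "\<lambda>j. ennreal (2 ^ j * d j x)" "{j}"] by simp
      then have "2 ^ j * d j x \<le> S" using S(1) by simp
      then have "d j x \<le> S * (1/2) ^ j" by (simp add: power_divide pos_le_divide_eq mult.commute)
      then have "sqrt (d j x) \<le> sqrt (S * (1/2) ^ j)" by (rule real_sqrt_le_mono)
      then show ?thesis unfolding real_sqrt_mult real_sqrt_power d_def by simp
    qed
    have sm: "summable (\<lambda>j. sqrt S * (sqrt (1/2)) ^ j)"
    proof (intro summable_mult summable_geometric)
      have "0 \<le> sqrt (1/2 :: real)" "sqrt (1/2 :: real) < 1" by simp_all
      then show "norm (sqrt (1/2 :: real)) < 1" by (simp only: real_norm_def abs_of_nonneg)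
    qed
    have "summable (\<lambda>j. f (r (Suc j)) x - f (r j) x)"
      by (rule summable_comparison_test'[OF sm b])
    then have "convergent (\<lambda>n. \<Sum>j<n. f (r (Suc j)) x - f (r j) x)" by (simp add: summable_iff_convergent)
    moreover have "(\<Sum>j<n. f (r (Suc j)) x - f (r j) x) = f (r n) x - f (r 0) x" for n
      by (rule sum_lessThan_telescope[of "\<lambda>j. f (r j) x"])
    ultimately have "convergent (\<lambda>n. f (r n) x - f (r 0) x)" by simp
    then have "convergent (\<lambda>n. (f (r n) x - f (r 0) x) + f (r 0) x)" by (intro convergent_add convergent_const)
    then show ?case by simp
  qed
  \<comment> \<open>\<open>lim\<close> has an unspecified value where the sequence diverges, which
    happens on a null set.\<close>
  define g where "g x = lim (\<lambda>j. f (r j) x)" for x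
  have g[measurable]: "g \<in> borel_measurable lebesgue" unfolding g_def[abs_def] by (rule borel_measurable_lim_metric) simp
  \<comment> \<open>Fatou's lemma in the second index, with the Cauchy bound that holds from
    \<open>r k\<close> on.\<close>
  have bound: "L2_sq (\<lambda>x. f (r k) x - g x) \<le> ennreal ((1/4) ^ k)" for k
  proof -
    have "L2_sq (\<lambda>x. f (r k) x - g x) = (\<integral>\<^sup>+x. liminf (\<lambda>m. ennreal ((norm (f (r k) x - f (r m) x))\<^sup>2)) \<partial>lebesgue)"
      unfolding L2_sq_def
    proof (rule nn_integral_cong_AE, use conv in eventually_elim)
      case (elim x)
      then have "(\<lambda>m. f (r m) x) \<longlonglongrightarrow> g x" unfolding g_def by (simp add: convergent_LIMSEQ_iff)
      then have "(\<lambda>m. ennreal ((norm (f (r k) x - f (r m) x))\<^sup>2)) \<longlonglongrightarrow> ennreal ((norm (f (r k) x - g x))\<^sup>2)"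
        by (intro tendsto_intros)
      then show ?case by (intro lim_imp_Liminf[symmetric]) auto
    qed
    also have "\<dots> \<le> liminf (\<lambda>m. \<integral>\<^sup>+x. ennreal ((norm (f (r k) x - f (r m) x))\<^sup>2) \<partial>lebesgue)"
      by (rule nn_integral_liminf) measurable
    also have "\<dots> \<le> ennreal ((1/4) ^ k)"
    proof (rule Liminf_le)
      show "eventually (\<lambda>m. (\<integral>\<^sup>+x. ennreal ((norm (f (r k) x - f (r m) x))\<^sup>2) \<partial>lebesgue) \<le> ennreal ((1/4) ^ k)) sequentially"
        using eventually_ge_at_top[of k]
      proof eventually_elim
        case (elim m)
        have "L2_sq (\<lambda>x. f (r k) x - f (r m) x) < ennreal ((1/4) ^ k)"
          using rN[of k] mono[OF elim] by (intro N) auto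
        then show ?case by (simp add: L2_sq_def)
      qed
    qed simp
    finally show ?thesis .
  qed
  have lim4: "(\<lambda>k. ennreal ((1/4) ^ k)) \<longlonglongrightarrow> ennreal 0" by (intro tendsto_ennrealI LIMSEQ_power_zero) simp
  have lim: "(\<lambda>k. L2_sq (\<lambda>x. f (r k) x - g x)) \<longlonglongrightarrow> 0"
  proof (rule tendsto_sandwich[where f="\<lambda>_. 0" and h="\<lambda>k. ennreal ((1/4) ^ k)"])
    show "(\<lambda>k. ennreal ((1/4) ^ k)) \<longlonglongrightarrow> 0" using lim4 by simp
  qed (use bound in auto)
  have "L2_sq g = L2_sq (\<lambda>x. f (r 0) x + (g x - f (r 0) x))" by simp
  also have "\<dots> \<le> ennreal (1 + 1) * L2_sq (f (r 0)) + ennreal (1 + 1 / 1) * L2_sq (\<lambda>x. g x - f (r 0) x)"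
    by (rule L2_sq_add_le) auto
  also have "L2_sq (\<lambda>x. g x - f (r 0) x) = L2_sq (\<lambda>x. f (r 0) x - g x)" by (simp add: L2_sq_def norm_minus_commute)
  also have "ennreal (1 + 1) * L2_sq (f (r 0)) + ennreal (1 + 1 / 1) * L2_sq (\<lambda>x. f (r 0) x - g x) < \<infinity>"
    using fin[of "r 0"] le_less_trans[OF bound[of 0]] by (simp add: ennreal_mult_less_top)
  finally show thesis using that g r lim by blast
qed

text \<open>The quadratic form attains its minimum on the unit sphere. At a minimizer
  \<open>\<xi>\<close> the residual \<open>h\<close> of the eigenvalue equation must vanish, since
  otherwise moving from \<open>\<xi>\<close> against \<open>h\<close> would lower the Rayleigh
  quotient.\<close>

lemma symmetric_matrix_min_eigenvalue:
  fixes B :: "real^'n^'n"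
  assumes sym: "transpose B = B"
  obtains \<mu> \<xi> where "\<xi> \<noteq> 0" "B *v \<xi> = \<mu> *\<^sub>R \<xi>" "\<forall>\<zeta>. \<mu> * (norm \<zeta>)\<^sup>2 \<le> \<zeta> \<bullet> (B *v \<zeta>)"
proof -
  let ?q = "\<lambda>\<zeta>. \<zeta> \<bullet> (B *v \<zeta>)"
  have "continuous_on (sphere 0 1) ?q" by (intro continuous_intros)
  then obtain \<xi> where \<xi>: "norm \<xi> = 1" and min: "\<And>\<zeta>. norm \<zeta> = 1 \<Longrightarrow> ?q \<xi> \<le> ?q \<zeta>"
    using continuous_attains_inf[OF compact_sphere, of "0::real^'n" 1 ?q] by auto
  define \<mu> where "\<mu> = ?q \<xi>"
  have ge: "\<mu> * (norm \<zeta>)\<^sup>2 \<le> ?q \<zeta>" for \<zeta>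
  proof (cases "\<zeta> = 0")
    case False
    have "\<mu> \<le> ?q ((1 / norm \<zeta>) *\<^sub>R \<zeta>)" unfolding \<mu>_def using False by (intro min) simp
    also have "\<dots> = ?q \<zeta> / (norm \<zeta>)\<^sup>2"
      by (simp add: matrix_vector_mult_scaleR power2_eq_square)
    finally show ?thesis using False by (simp add: pos_le_divide_eq)
  qed simp
  define h where "h = B *v \<xi> - \<mu> *\<^sub>R \<xi>"
  have swap: "\<xi> \<bullet> (B *v \<zeta>) = \<zeta> \<bullet> (B *v \<xi>)" for \<zeta>
  proof -
    have "\<xi> \<bullet> (B *v \<zeta>) = (transpose B *v \<xi>) \<bullet> \<zeta>"
      unfolding transpose_matrix_vector by (rule dot_lmul_matrix[symmetric])
    then show ?thesis unfolding sym by (simp only: inner_commute)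
  qed
  \<comment> \<open>The bound \<open>ge\<close> at \<open>\<xi> + t *\<^sub>R h\<close>. Symmetry
    and the choice of \<open>h\<close> make the linear coefficient
    \<open>2 * (h \<bullet> h)\<close>.\<close>
  have quad: "0 \<le> 2 * t * (h \<bullet> h) + t\<^sup>2 * (?q h - \<mu> * (norm h)\<^sup>2)" for t
  proof -
    have "0 \<le> ?q (\<xi> + t *\<^sub>R h) - \<mu> * (norm (\<xi> + t *\<^sub>R h))\<^sup>2" using ge by simp
    also have "?q (\<xi> + t *\<^sub>R h) = \<mu> + 2 * t * (h \<bullet> (B *v \<xi>)) + t\<^sup>2 * ?q h"
      unfolding matrix_vector_right_distrib matrix_vector_mult_scaleR inner_add_left inner_add_right
        inner_scaleR_left inner_scaleR_right swap[of h] \<mu>_def[symmetric]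
      by (simp add: power2_eq_square algebra_simps)
    also have "(norm (\<xi> + t *\<^sub>R h))\<^sup>2 = 1 + 2 * t * (h \<bullet> \<xi>) + t\<^sup>2 * (norm h)\<^sup>2"
    proof -
      have "\<xi> \<bullet> \<xi> = 1" using \<xi> by (simp add: norm_eq_1)
      then show ?thesis
        unfolding power2_norm_eq_inner inner_add_left inner_add_right inner_scaleR_left inner_scaleR_right
          inner_commute[of \<xi> h]
        by (simp add: power2_eq_square algebra_simps)
    qed
    also have "h \<bullet> (B *v \<xi>) = h \<bullet> h + \<mu> * (h \<bullet> \<xi>)"
    proof -
      have "B *v \<xi> = h + \<mu> *\<^sub>R \<xi>" by (simp add: h_def)
      then show ?thesis by (simp only: inner_add_right inner_scaleR_right)
    qed
    finally show ?thesis by (simp add: algebra_simps)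
  qed
  have "h \<bullet> h = 0"
  proof (rule ccontr)
    assume "h \<bullet> h \<noteq> 0"
    then have hh: "h \<bullet> h > 0" by simp
    define c where "c = ?q h - \<mu> * (norm h)\<^sup>2"
    have c: "c \<ge> 0" using ge[of h] by (simp add: c_def)
    \<comment> \<open>With this \<open>t\<close> the linear term is
      \<open>- 2 * (h \<bullet> h)\<^sup>2 / (c + 1)\<close>, while the quadratic one is at most
      half of that in size. The 1 keeps the denominator positive when \<open>c = 0\<close>.\<close>
    define t where "t = - (h \<bullet> h) / (c + 1)"
    have "t * (h \<bullet> h) = - ((h \<bullet> h)\<^sup>2 / (c + 1))" by (simp add: t_def power2_eq_square)
    moreover have "t\<^sup>2 * c \<le> t\<^sup>2 * (c + 1)" by (intro mult_left_mono) auto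
    moreover have "t\<^sup>2 * (c + 1) = (h \<bullet> h)\<^sup>2 / (c + 1)" using c by (simp add: t_def power2_eq_square)
    moreover have "(h \<bullet> h)\<^sup>2 / (c + 1) > 0" using hh c by (intro divide_pos_pos) auto
    moreover have "0 \<le> 2 * (t * (h \<bullet> h)) + t\<^sup>2 * c" using quad[of t] by (simp add: c_def)
    ultimately show False by linarith
  qed
  then have "B *v \<xi> = \<mu> *\<^sub>R \<xi>" by (simp add: h_def)
  moreover have "\<xi> \<noteq> 0" using \<xi> by auto
  moreover have "\<forall>\<zeta>. \<mu> * (norm \<zeta>)\<^sup>2 \<le> ?q \<zeta>" using ge by (rule allI)
  ultimately show thesis by (intro that)
qed

text \<open>\<open>Inf\<close> over the reals is informative for a nonempty set with a lower bound:
  symmetry provides an eigenvalue at every point, and the lower ellipticity constant bounds all of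
  them. The infimum is at least this constant and at most the least eigenvalue of each single
  \<open>A x\<close>.\<close>

lemma elliptic_smallest_eigenvalue:
  fixes A :: "real^'n \<Rightarrow> real^'n^'n"
  assumes sym: "\<And>x. transpose (A x) = A x" and ell: "elliptic A"
  shows "smallest_eigenvalue A > 0" "smallest_eigenvalue A * (norm \<xi>)\<^sup>2 \<le> \<xi> \<bullet> (A x *v \<xi>)"
proof -
  obtain a b where a1: "0 < a" and ab: "\<forall>\<xi> x. a * (norm \<xi>)\<^sup>2 \<le> \<xi> \<bullet> (A x *v \<xi>) \<and> \<xi> \<bullet> (A x *v \<xi>) \<le> b * (norm \<xi>)\<^sup>2"
    using ell unfolding elliptic_def by (elim exE conjE) (rule that)
  have a2: "a * (norm \<xi>)\<^sup>2 \<le> \<xi> \<bullet> (A x *v \<xi>)" for \<xi> x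
    using spec[OF spec[OF ab, of \<xi>], of x] by (rule conjunct1)
  let ?S = "{\<mu>. \<exists>x \<xi>. \<xi> \<noteq> 0 \<and> A x *v \<xi> = \<mu> *\<^sub>R \<xi>}"
  have lb: "a \<le> \<mu>" if m: "\<mu> \<in> ?S" for \<mu>
  proof -
    obtain x \<xi> where \<xi>: "\<xi> \<noteq> 0" "A x *v \<xi> = \<mu> *\<^sub>R \<xi>" using m by blast
    then have "a * (norm \<xi>)\<^sup>2 \<le> \<mu> * (norm \<xi>)\<^sup>2" using a2[of \<xi> x] by (simp only: inner_scaleR_right power2_norm_eq_inner)
    moreover have "(norm \<xi>)\<^sup>2 > 0" using \<xi>(1) by simp
    ultimately show ?thesis by (simp only: mult_le_cancel_right_pos)
  qed
  then have bdd: "bdd_below ?S" by (rule bdd_belowI)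
  obtain \<mu> \<zeta> where \<mu>: "\<zeta> \<noteq> 0" "A x *v \<zeta> = \<mu> *\<^sub>R \<zeta>" "\<forall>\<xi>. \<mu> * (norm \<xi>)\<^sup>2 \<le> \<xi> \<bullet> (A x *v \<xi>)"
    by (rule symmetric_matrix_min_eigenvalue[OF sym[of x]])
  have in_S: "\<mu> \<in> ?S" using \<mu>(1,2) by blast
  then have ne: "?S \<noteq> {}" by (intro notI) (simp only: empty_iff)
  have "a \<le> smallest_eigenvalue A" unfolding smallest_eigenvalue_def by (rule cInf_greatest[OF ne lb])
  with a1 show "smallest_eigenvalue A > 0" by simp
  have "smallest_eigenvalue A \<le> \<mu>"
    unfolding smallest_eigenvalue_def by (rule cInf_lower[OF in_S bdd])
  then have "smallest_eigenvalue A * (norm \<xi>)\<^sup>2 \<le> \<mu> * (norm \<xi>)\<^sup>2" by (rule mult_right_mono) simp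
  with spec[OF \<mu>(3), of \<xi>] show "smallest_eigenvalue A * (norm \<xi>)\<^sup>2 \<le> \<xi> \<bullet> (A x *v \<xi>)" by simp
qed

section \<open>The advection term on the diagonal\<close>

lemma advection_pairing_self:
  assumes "solenoidal \<Omega> v" "\<phi> \<in> test_functions \<Omega>"
  shows "advection_pairing \<Omega> v \<phi> \<phi> = 0"
proof -
  have d: "(\<phi> has_derivative frechet_derivative \<phi> (at x)) (at x)" for x
    using test_functions_Ck[OF assms(2)] by (rule Ck_Suc_has_derivative[of 0])
  have "grad (\<lambda>x. \<phi> x * \<phi> x) x = 2 *\<^sub>R (\<phi> x *\<^sub>R grad \<phi> x)" for x
    unfolding grad_def frechet_derivative_at[OF has_derivative_mult[OF d d], symmetric]
    by (simp add: vec_eq_iff)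
  then have eq: "v x \<bullet> grad (\<lambda>x. \<phi> x * \<phi> x) x = 2 * ((v x \<bullet> grad \<phi> x) * \<phi> x)" for x by simp
  have "(LINT x|lebesgue_on \<Omega>. v x \<bullet> grad (\<lambda>x. \<phi> x * \<phi> x) x) = 2 * advection_pairing \<Omega> v \<phi> \<phi>"
    unfolding eq advection_pairing_def by (rule integral_mult_right_zero)
  moreover have "(LINT x|lebesgue_on \<Omega>. v x \<bullet> grad (\<lambda>x. \<phi> x * \<phi> x) x) = 0"
    using assms test_functions_mult[OF assms(2,2)] by (simp add: solenoidal_def)
  ultimately show ?thesis by simp
qed

text \<open>The convergence clause holds for every pair of approximating sequences, so both may be
  the same one, whose existence is the first clause; all pairings along it are 0.\<close>

lemma duality_extension_self:
  assumes "duality_extension s \<Omega> v adv" "solenoidal \<Omega> v" "u \<in> Hs_Omega s \<Omega>"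
  shows "adv u u = 0"
proof -
  obtain \<phi> where \<phi>: "Hs_approx s \<Omega> \<phi> u" using assms by (auto simp: duality_extension_def)
  then have "(\<lambda>k. advection_pairing \<Omega> v (\<phi> k) (\<phi> k)) \<longlonglongrightarrow> adv u u"
    using assms unfolding duality_extension_def by blast
  moreover have "advection_pairing \<Omega> v (\<phi> k) (\<phi> k) = 0" for k
    using \<phi> assms(2) by (intro advection_pairing_self) (auto simp: Hs_approx_def)
  ultimately show ?thesis by (simp add: LIMSEQ_const_iff)
qed

lemma Hs_approx_subseq:
  assumes "Hs_approx s \<Omega> \<phi> u" "strict_mono r"
  shows "Hs_approx s \<Omega> (\<lambda>k. \<phi> (r k)) u"
  using assms LIMSEQ_subseq_LIMSEQ[of _ _ r] by (auto simp: Hs_approx_def comp_def)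

section \<open>The nonlocal gradient of test functions and of their limits\<close>

context
  fixes s c :: real and \<omega> :: "'a::euclidean_space \<Rightarrow> 'a \<Rightarrow> real" and \<alpha> :: "'a \<Rightarrow> 'a \<Rightarrow> 'a"
  assumes s: "0 < s" "s < 1"
    and \<omega>: "\<And>x y. \<omega> x y = c * norm (x - y) powr (- (real DIM('a) + s))"
    and \<alpha>: "\<And>x y. \<alpha> x y = (y - x) /\<^sub>R norm (y - x)"
    and c: "c * riesz_const DIM('a) s = 1"
begin

lemma nl_grad_smooth_inner:
  assumes \<phi>: "\<phi> \<in> test_functions UNIV" and b: "b \<in> Basis"
  shows "nl_grad_smooth \<omega> \<alpha> \<phi> x \<bullet> b = c * riesz_grad s b \<phi> x"
proof -
  obtain L R where L: "continuous_on UNIV \<phi>" "\<forall>x. norm x > R \<longrightarrow> \<phi> x = 0" "\<forall>x y. \<bar>\<phi> x - \<phi> y\<bar> \<le> L * norm (x - y)"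
    by (rule test_functions_lipschitz[OF \<phi>])
  have [measurable]: "\<phi> \<in> borel_measurable borel" using L(1) by (rule borel_measurable_continuous_onI)
  obtain M where M: "\<And>x z. \<bar>\<phi> (x + z) - \<phi> x\<bar> \<le> M * min 1 (norm z)" "M \<ge> 0"
    using lipschitz_difference_bound[of \<phi> R L] L by blast
  define f where "f z = ((c * norm z powr (- (real DIM('a) + s))) * (\<phi> (x + z) - \<phi> x)) *\<^sub>R (z /\<^sub>R norm z)" for z
  have [measurable]: "f \<in> borel_measurable borel" unfolding f_def[abs_def] by measurable
  \<comment> \<open>Needed for taking the component \<open>b\<close> under the vector-valued
    integral.\<close>
  have int: "integrable lborel f"
  proof (rule Bochner_Integration.integrable_bound)
    show "integrable lborel (\<lambda>z::'a. (\<bar>c\<bar> * M) * (min 1 (norm z) * norm z powr (- (real DIM('a) + s))))"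
      by (rule integrable_mult_right) (rule integrable_min_norm_powr[OF s])
    have "norm (f z) \<le> (\<bar>c\<bar> * M) * (min 1 (norm z) * norm z powr (- (real DIM('a) + s)))" for z
    proof -
      have "norm (f z) \<le> (\<bar>c\<bar> * norm z powr (- (real DIM('a) + s))) * \<bar>\<phi> (x + z) - \<phi> x\<bar>"
      proof -
        have "norm (z /\<^sub>R norm z) \<le> 1" by (cases "z = 0") auto
        from mult_left_mono[OF this, of "\<bar>(c * norm z powr (- (real DIM('a) + s))) * (\<phi> (x + z) - \<phi> x)\<bar>"]
        show ?thesis unfolding f_def norm_scaleR[of "_ * _"] by (simp add: abs_mult)
      qed
      also have "\<dots> \<le> (\<bar>c\<bar> * norm z powr (- (real DIM('a) + s))) * (M * min 1 (norm z))"
        by (intro mult_left_mono M) auto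
      finally show ?thesis by (simp only: mult_ac)
    qed
    then show "AE z in lborel. norm (f z) \<le> norm ((\<bar>c\<bar> * M) * (min 1 (norm z) * norm z powr (- (real DIM('a) + s))))"
      by (intro AE_I2) (metis abs_ge_self order_trans real_norm_def)
  qed measurable
  have "nl_grad_smooth \<omega> \<alpha> \<phi> x = (LINT y|lebesgue. f (y + (- x)))"
    unfolding nl_grad_smooth_def f_def \<omega> \<alpha> by (simp add: norm_minus_commute)
  also have "\<dots> = (LINT y|lborel. f (y + (- x)))"
    by (rule integral_completion) measurable
  also have "\<dots> = (LINT z|lborel. f z)" by (rule integral_lborel_translate) measurable
  finally have "nl_grad_smooth \<omega> \<alpha> \<phi> x \<bullet> b = (LINT z|lborel. f z \<bullet> b)"
    using integral_inner_left[of b lborel f] int by simp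
  also have "\<dots> = (LINT z|lborel. c * (riesz_kernel s b z * (\<phi> (x + z) - \<phi> x)))"
    by (intro Bochner_Integration.integral_cong refl) (simp add: f_def riesz_kernel_def field_simps)
  finally show ?thesis unfolding riesz_grad_def by simp
qed

lemma nl_grad_smooth_measurable:
  assumes \<phi>: "\<phi> \<in> test_functions UNIV"
  shows "nl_grad_smooth \<omega> \<alpha> \<phi> \<in> borel_measurable lebesgue"
proof -
  obtain L R where L: "continuous_on UNIV \<phi>" "\<forall>x. norm x > R \<longrightarrow> \<phi> x = 0" "\<forall>x y. \<bar>\<phi> x - \<phi> y\<bar> \<le> L * norm (x - y)"
    by (rule test_functions_lipschitz[OF \<phi>])
  have [measurable]: "\<phi> \<in> borel_measurable borel" using L(1) by (rule borel_measurable_continuous_onI)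
  have [measurable]: "riesz_grad s b \<phi> \<in> borel_measurable borel" for b
    unfolding riesz_grad_def[abs_def] by measurable
  have "nl_grad_smooth \<omega> \<alpha> \<phi> \<in> borel_measurable borel"
    by (subst borel_measurable_euclidean_space) (simp add: nl_grad_smooth_inner[OF \<phi>])
  then show ?thesis by (intro measurable_completion) simp
qed

text \<open>With this the energy identity applies to differences of approximants and yields the
  Cauchy property of their gradients.\<close>

lemma nl_grad_smooth_diff:
  assumes \<phi>: "\<phi> \<in> test_functions UNIV" and \<psi>: "\<psi> \<in> test_functions UNIV"
  shows "nl_grad_smooth \<omega> \<alpha> (\<lambda>x. \<phi> x - \<psi> x) x = nl_grad_smooth \<omega> \<alpha> \<phi> x - nl_grad_smooth \<omega> \<alpha> \<psi> x"
proof (rule euclidean_eqI)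
  fix b :: 'a assume b: "b \<in> Basis"
  then have nb: "norm b = 1" by simp
  have int: "integrable lborel (\<lambda>z. riesz_kernel s b z * (f (x + z) - f x))" if f: "f \<in> test_functions UNIV" for f
  proof -
    obtain L R where "continuous_on UNIV f" "\<forall>x. norm x > R \<longrightarrow> f x = 0" "\<forall>x y. \<bar>f x - f y\<bar> \<le> L * norm (x - y)"
      by (rule test_functions_lipschitz[OF f])
    then show ?thesis by (intro riesz_grad_integrand[of f R L, OF _ _ _ s nb]) auto
  qed
  have "riesz_grad s b (\<lambda>x. \<phi> x - \<psi> x) x = riesz_grad s b \<phi> x - riesz_grad s b \<psi> x"
    unfolding riesz_grad_def by (subst Bochner_Integration.integral_diff[symmetric, OF int[OF \<phi>] int[OF \<psi>]]) (simp add: algebra_simps)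
  then show "nl_grad_smooth \<omega> \<alpha> (\<lambda>x. \<phi> x - \<psi> x) x \<bullet> b = (nl_grad_smooth \<omega> \<alpha> \<phi> x - nl_grad_smooth \<omega> \<alpha> \<psi> x) \<bullet> b"
    using b by (simp add: inner_diff_left nl_grad_smooth_inner \<phi> \<psi> test_functions_diff right_diff_distrib)
qed

text \<open>Since \<open>c * riesz_const = 1\<close>, the left side is the spectral energy divided
  by \<open>(2 * pi) ^ n\<close>. The Gagliardo seminorm has the additional factor
  \<open>2 / C_ns\<close>, and the ratio is \<open>C_ns / 2\<close>.\<close>

lemma nl_grad_smooth_energy:
  assumes \<phi>: "\<phi> \<in> test_functions UNIV"
  shows "L2_sq (nl_grad_smooth \<omega> \<alpha> \<phi>) = ennreal (C_ns DIM('a) s / 2) * gagliardo_sq s \<phi>"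
proof -
  obtain L R where L: "continuous_on UNIV \<phi>" "\<forall>x. norm x > R \<longrightarrow> \<phi> x = 0" "\<forall>x y. \<bar>\<phi> x - \<phi> y\<bar> \<le> L * norm (x - y)"
    by (rule test_functions_lipschitz[OF \<phi>])
  have m[measurable]: "\<phi> \<in> borel_measurable borel" using L(1) by (rule borel_measurable_continuous_onI)
  have [measurable]: "riesz_grad s b \<phi> \<in> borel_measurable borel" for b
    unfolding riesz_grad_def[abs_def] by measurable
  define P where "P = (2 * pi) ^ DIM('a)"
  have P: "P > 0" by (simp add: P_def)
  have C: "C_ns DIM('a) s > 0" by (rule C_ns_pos[OF s])
  have "L2_sq (nl_grad_smooth \<omega> \<alpha> \<phi>) = (\<integral>\<^sup>+x. (\<Sum>b\<in>Basis. ennreal (c\<^sup>2) * ennreal ((riesz_grad s b \<phi> x)\<^sup>2)) \<partial>lborel)"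
    unfolding L2_sq_def nn_integral_completion norm_sq_eq_sum_Basis
    by (intro nn_integral_cong) (simp add: nl_grad_smooth_inner[OF \<phi>] power_mult_distrib sum_ennreal ennreal_mult'[symmetric])
  also have "\<dots> = ennreal (c\<^sup>2) * (\<Sum>b\<in>Basis. \<integral>\<^sup>+x. ennreal ((riesz_grad s b \<phi> x)\<^sup>2) \<partial>lborel)"
    by (subst nn_integral_sum) (auto simp: nn_integral_cmult sum_distrib_left)
  finally have "ennreal P * L2_sq (nl_grad_smooth \<omega> \<alpha> \<phi>)
      = ennreal (c\<^sup>2) * (ennreal P * (\<Sum>b\<in>Basis. \<integral>\<^sup>+x. ennreal ((riesz_grad s b \<phi> x)\<^sup>2) \<partial>lborel))"
    by (simp only: mult_ac)
  also have "\<dots> = ennreal (c\<^sup>2) * (ennreal ((riesz_const DIM('a) s)\<^sup>2) * spectral_energy s (fourier \<phi>))"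
    unfolding P_def using riesz_grad_energy[of \<phi> R L, OF _ _ _ s] L by simp
  also have "\<dots> = spectral_energy s (fourier \<phi>)"
  proof -
    have "c\<^sup>2 * (riesz_const DIM('a) s)\<^sup>2 = 1" using c by (simp flip: power_mult_distrib)
    then have "ennreal (c\<^sup>2) * ennreal ((riesz_const DIM('a) s)\<^sup>2) = 1" by (simp add: ennreal_mult'[symmetric])
    then show ?thesis by (simp add: mult.assoc[symmetric])
  qed
  finally have e1: "ennreal P * L2_sq (nl_grad_smooth \<omega> \<alpha> \<phi>) = spectral_energy s (fourier \<phi>)" .
  have g: "gagliardo_sq s \<phi> = ennreal (2 / (C_ns DIM('a) s * P)) * spectral_energy s (fourier \<phi>)"
    unfolding P_def using L lipschitz_integrable[of \<phi> R L] by (intro gagliardo_sq_fourier[OF s m]) auto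
  have "ennreal (C_ns DIM('a) s / 2) * gagliardo_sq s \<phi>
      = (ennreal (C_ns DIM('a) s / 2) * ennreal (2 / (C_ns DIM('a) s * P)) * ennreal P) * L2_sq (nl_grad_smooth \<omega> \<alpha> \<phi>)"
    unfolding g e1[symmetric] by (simp only: mult_ac)
  also have "ennreal (C_ns DIM('a) s / 2) * ennreal (2 / (C_ns DIM('a) s * P)) * ennreal P = 1"
    using C P by (simp add: ennreal_mult'[symmetric] ennreal_mult''[symmetric])
  finally show ?thesis by simp
qed

text \<open>\<open>exG\<close> provides a witness for the \<open>SOME\<close> in
  \<open>nl_grad\<close>. The bound is then derived for the function actually chosen, from the
  approximating sequence that comes with it.\<close>

lemma nl_grad_props:
  assumes u: "u \<in> Hs_Omega s \<Omega>" and bdd: "bounded \<Omega>"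
  defines "g \<equiv> nl_grad s \<omega> \<alpha> u"
  shows "g \<in> borel_measurable lebesgue" "L2_sq g < \<infinity>" "ennreal (C_ns DIM('a) s / 2) * gagliardo_sq s u \<le> L2_sq g"
proof -
  let ?G = "nl_grad_smooth \<omega> \<alpha>"
  define K where "K = C_ns DIM('a) s / 2"
  have K: "K > 0" using C_ns_pos[OF s, of "DIM('a)"] by (simp add: K_def)
  have um: "u \<in> borel_measurable lebesgue" and uG: "gagliardo_sq s u < \<infinity>"
    using u by (auto simp: Hs_Omega_def Hs_def)
  obtain w where w[measurable]: "w \<in> borel_measurable borel" and uw: "AE x in lborel. u x = w x"
    using completion_ex_borel_measurable_real[OF um] by auto
  have gw: "gagliardo_sq s u = gagliardo_sq s w" by (rule gagliardo_sq_cong_AE[OF uw])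
  have approx: "\<And>k. \<phi> k \<in> test_functions UNIV" "(\<lambda>k. gagliardo_sq s (\<lambda>x. \<phi> k x - w x)) \<longlonglongrightarrow> 0"
    "\<And>k. \<phi> k \<in> borel_measurable borel"
    if "Hs_approx s UNIV \<phi> u" for \<phi>
  proof -
    show t: "\<phi> k \<in> test_functions UNIV" for k using that by (simp add: Hs_approx_def)
    have "continuous_on UNIV (\<phi> k)" for k using test_functions_Ck[OF t, of 0] by simp
    then show "\<phi> k \<in> borel_measurable borel" for k by (rule borel_measurable_continuous_onI)
    have "AE x in lborel. \<phi> k x - u x = \<phi> k x - w x" for k using uw by eventually_elim simp
    from gagliardo_sq_cong_AE[OF this]
    have le: "gagliardo_sq s (\<lambda>x. \<phi> k x - w x) \<le> L2_sq (\<lambda>x. \<phi> k x - u x) + gagliardo_sq s (\<lambda>x. \<phi> k x - u x)" for k by simp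
    show "(\<lambda>k. gagliardo_sq s (\<lambda>x. \<phi> k x - w x)) \<longlonglongrightarrow> 0"
    proof (rule tendsto_sandwich[where f="\<lambda>_. 0"])
      show "(\<lambda>k. L2_sq (\<lambda>x. \<phi> k x - u x) + gagliardo_sq s (\<lambda>x. \<phi> k x - u x)) \<longlonglongrightarrow> 0"
        using that by (simp add: Hs_approx_def)
    qed (use le in auto)
  qed
  have neg: "gagliardo_sq s (\<lambda>x. v x - f x) = gagliardo_sq s (\<lambda>x. f x - v x)" for f v :: "'a \<Rightarrow> real"
  proof -
    have "\<bar>v x - f x - (v y - f y)\<bar> = \<bar>f x - v x - (f y - v y)\<bar>" for x y by linarith
    then show ?thesis by (simp add: gagliardo_sq_def)
  qed
  \<comment> \<open>On test functions the gradient is an isometry up to the factor \<open>K\<close>,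
    so it maps an approximating sequence for \<open>u\<close> to a Cauchy sequence in L^2.\<close>
  have exG: "\<exists>g. g \<in> borel_measurable lebesgue \<and> L2_sq g < \<infinity> \<and>
     (\<exists>\<phi>. Hs_approx s UNIV \<phi> u \<and> (\<lambda>k. L2_sq (\<lambda>x. ?G (\<phi> k) x - g x)) \<longlonglongrightarrow> 0)"
  proof -
    obtain \<phi> where \<phi>: "Hs_approx s UNIV \<phi> u" by (rule Hs_approx_exists[OF s u bdd])
    note ap = approx[OF \<phi>]
    note [measurable] = ap(3)
    have diff: "L2_sq (\<lambda>x. ?G (\<phi> m) x - ?G (\<phi> n) x) = ennreal K * gagliardo_sq s (\<lambda>x. \<phi> m x - \<phi> n x)" for m n
    proof -
      have "?G (\<lambda>x. \<phi> m x - \<phi> n x) = (\<lambda>x. ?G (\<phi> m) x - ?G (\<phi> n) x)"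
        by (rule ext) (rule nl_grad_smooth_diff[OF ap(1) ap(1)])
      then show ?thesis
        using nl_grad_smooth_energy[OF test_functions_diff[OF ap(1)[of m] ap(1)[of n]]] by (simp only: K_def)
    qed
    have tri: "gagliardo_sq s (\<lambda>x. \<phi> m x - \<phi> n x) \<le> 2 * gagliardo_sq s (\<lambda>x. \<phi> m x - w x) + 2 * gagliardo_sq s (\<lambda>x. \<phi> n x - w x)" for m n
    proof -
      have "gagliardo_sq s (\<lambda>x. \<phi> m x - \<phi> n x) = gagliardo_sq s (\<lambda>x. (\<phi> m x - w x) + (w x - \<phi> n x))" by simp
      also have "\<dots> \<le> ennreal (1 + 1) * gagliardo_sq s (\<lambda>x. \<phi> m x - w x) + ennreal (1 + 1 / 1) * gagliardo_sq s (\<lambda>x. w x - \<phi> n x)"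
        by (rule gagliardo_sq_add_le) auto
      finally show ?thesis unfolding neg[of w] by simp
    qed
    obtain g r where g: "g \<in> borel_measurable lebesgue" "L2_sq g < \<infinity>" "strict_mono (r :: nat \<Rightarrow> nat)"
      "(\<lambda>k. L2_sq (\<lambda>x. ?G (\<phi> (r k)) x - g x)) \<longlonglongrightarrow> 0"
    proof (rule L2_sq_complete[of "\<lambda>k. ?G (\<phi> k)"])
      show "?G (\<phi> k) \<in> borel_measurable lebesgue" for k by (rule nl_grad_smooth_measurable[OF ap(1)])
      show "\<exists>N. \<forall>m\<ge>N. \<forall>n\<ge>N. L2_sq (\<lambda>x. ?G (\<phi> m) x - ?G (\<phi> n) x) < ennreal e" if e: "e > 0" for e
      proof -
        \<comment> \<open>The triangle inequality \<open>tri\<close> has the weights 2 and 2, and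
          the energy identity contributes \<open>K\<close>; together they turn
          \<open>e / (4 * K)\<close> into \<open>e\<close>.\<close>
        have "e / (4 * K) > 0" using e K by simp
        then have "eventually (\<lambda>k. gagliardo_sq s (\<lambda>x. \<phi> k x - w x) < ennreal (e / (4 * K))) sequentially"
          using ap(2) by (intro order_tendstoD) auto
        then obtain N where N: "\<And>k. k \<ge> N \<Longrightarrow> gagliardo_sq s (\<lambda>x. \<phi> k x - w x) < ennreal (e / (4 * K))"
          by (auto simp: eventually_sequentially)
        have "L2_sq (\<lambda>x. ?G (\<phi> m) x - ?G (\<phi> n) x) < ennreal e" if "m \<ge> N" "n \<ge> N" for m n
        proof -
          have "gagliardo_sq s (\<lambda>x. \<phi> m x - \<phi> n x) < 2 * ennreal (e / (4 * K)) + 2 * ennreal (e / (4 * K))"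
            using N[OF that(1)] N[OF that(2)]
            by (intro le_less_trans[OF tri] add_strict_mono ennreal_mult_strict_left_mono) auto
          also have "\<dots> = ennreal (e / K)"
          proof -
            have "2 * ennreal (e / (4 * K)) = ennreal (2 * (e / (4 * K)))" by (subst ennreal_mult') auto
            then show ?thesis using e K by (simp del: ennreal_plus flip: ennreal_plus)
          qed
          finally have "ennreal K * gagliardo_sq s (\<lambda>x. \<phi> m x - \<phi> n x) < ennreal K * ennreal (e / K)"
            using K by (intro ennreal_mult_strict_left_mono) auto
          also have "\<dots> = ennreal e" using K e by (simp add: ennreal_mult'[symmetric])
          finally show ?thesis unfolding diff .
        qed
        then show ?thesis by blast
      qed
      show "L2_sq (?G (\<phi> k)) < \<infinity>" for k
      proof -
        obtain L R where L: "continuous_on UNIV (\<phi> k)" "\<forall>x. norm x > R \<longrightarrow> \<phi> k x = 0" "\<forall>x y. \<bar>\<phi> k x - \<phi> k y\<bar> \<le> L * norm (x - y)"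
          by (rule test_functions_lipschitz[OF ap(1)])
        have "integrable lborel (\<lambda>x. (riesz_grad s b (\<phi> k) x)\<^sup>2)" if "b \<in> Basis" for b
          using L that by (intro riesz_grad_integrable(2)[of "\<phi> k" R L, OF _ _ _ s]) auto
        then have "integrable lborel (\<lambda>x. \<Sum>b\<in>Basis. c\<^sup>2 * (riesz_grad s b (\<phi> k) x)\<^sup>2)" by auto
        then have "integrable lborel (\<lambda>x. (norm (?G (\<phi> k) x))\<^sup>2)"
          unfolding norm_sq_eq_sum_Basis by (simp add: nl_grad_smooth_inner[OF ap(1)] power_mult_distrib)
        then show ?thesis by (simp add: L2_sq_def nn_integral_completion integrable_iff_bounded)
      qed
    qed
    then show ?thesis using Hs_approx_subseq[OF \<phi> g(3)] by blast
  qed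
  have gp: "g \<in> borel_measurable lebesgue \<and> L2_sq g < \<infinity> \<and>
     (\<exists>\<phi>. Hs_approx s UNIV \<phi> u \<and> (\<lambda>k. L2_sq (\<lambda>x. ?G (\<phi> k) x - g x)) \<longlonglongrightarrow> 0)"
    unfolding g_def nl_grad_def by (rule someI_ex[OF exG])
  show g[measurable]: "g \<in> borel_measurable lebesgue" and gfin: "L2_sq g < \<infinity>" using gp by auto
  obtain \<phi> where \<phi>: "Hs_approx s UNIV \<phi> u" and lim: "(\<lambda>k. L2_sq (\<lambda>x. ?G (\<phi> k) x - g x)) \<longlonglongrightarrow> 0"
    using gp by blast
  note ap = approx[OF \<phi>]
  note [measurable] = ap(3)
  have Gm[measurable]: "?G (\<phi> k) \<in> borel_measurable lebesgue" for k by (rule nl_grad_smooth_measurable[OF ap(1)])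
  \<comment> \<open>One triangle inequality passes from \<open>w\<close> to \<open>\<phi> k\<close>
    in the seminorm and one from the gradient of \<open>\<phi> k\<close> to \<open>g\<close> in L^2.
    Each costs a factor \<open>1 + e\<close> on the main term; the remainders \<open>a k\<close> and
    \<open>b k\<close> vanish in the limit.\<close>
  have main: "ennreal K * gagliardo_sq s w \<le> ennreal (1 + e) * (ennreal (1 + e) * L2_sq g)" if e: "e > 0" for e
  proof -
    define a where "a k = ennreal K * (ennreal (1 + 1 / e) * gagliardo_sq s (\<lambda>x. \<phi> k x - w x))" for k
    define b where "b k = ennreal (1 + e) * (ennreal (1 + 1 / e) * L2_sq (\<lambda>x. ?G (\<phi> k) x - g x))" for k
    have "ennreal K * gagliardo_sq s w \<le> ennreal (1 + e) * (ennreal (1 + e) * L2_sq g) + (b k + a k)" for k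
    proof -
      have "gagliardo_sq s w = gagliardo_sq s (\<lambda>x. \<phi> k x + (w x - \<phi> k x))" by simp
      also have "\<dots> \<le> ennreal (1 + e) * gagliardo_sq s (\<phi> k) + ennreal (1 + 1 / e) * gagliardo_sq s (\<lambda>x. w x - \<phi> k x)"
        by (rule gagliardo_sq_add_le[OF e]) auto
      finally have "ennreal K * gagliardo_sq s w \<le> ennreal K * (ennreal (1 + e) * gagliardo_sq s (\<phi> k) + ennreal (1 + 1 / e) * gagliardo_sq s (\<lambda>x. w x - \<phi> k x))"
        by (rule mult_left_mono) simp
      also have "\<dots> = ennreal (1 + e) * L2_sq (?G (\<phi> k)) + a k"
        unfolding nl_grad_smooth_energy[OF ap(1)] a_def K_def neg[of w] by (simp only: distrib_left mult_ac)
      also have "L2_sq (?G (\<phi> k)) \<le> ennreal (1 + e) * L2_sq g + ennreal (1 + 1 / e) * L2_sq (\<lambda>x. ?G (\<phi> k) x - g x)"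
        using L2_sq_add_le[OF e, of g "\<lambda>x. ?G (\<phi> k) x - g x"] by simp
      finally show ?thesis
        by (simp add: b_def distrib_left add.assoc add_right_mono mult_left_mono)
    qed
    moreover have "(\<lambda>k. ennreal (1 + e) * (ennreal (1 + e) * L2_sq g) + (b k + a k)) \<longlonglongrightarrow> ennreal (1 + e) * (ennreal (1 + e) * L2_sq g) + (ennreal (1 + e) * (ennreal (1 + 1 / e) * 0) + ennreal K * (ennreal (1 + 1 / e) * 0))"
      unfolding a_def b_def by (intro tendsto_add tendsto_const ennreal_tendsto_cmult ap(2) lim) auto
    ultimately show ?thesis
      by (intro LIMSEQ_le_const[where X="\<lambda>k. ennreal (1 + e) * (ennreal (1 + e) * L2_sq g) + (b k + a k)"]) auto
  qed
  obtain Y where Y: "Y \<ge> 0" "L2_sq g = ennreal Y" using gfin by (cases "L2_sq g") auto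
  \<comment> \<open>Now \<open>e = inverse (real (Suc k))\<close> tends to 0. Writing the finite
    energy as a real \<open>Y\<close> makes the factors converge by real limits.\<close>
  have "(\<lambda>k. ennreal ((1 + inverse (real (Suc k))) * ((1 + inverse (real (Suc k))) * Y))) \<longlonglongrightarrow> ennreal ((1 + 0) * ((1 + 0) * Y))"
    by (intro tendsto_ennrealI tendsto_mult tendsto_add tendsto_const LIMSEQ_inverse_real_of_nat)
  moreover have "ennreal K * gagliardo_sq s w \<le> ennreal ((1 + inverse (real (Suc k))) * ((1 + inverse (real (Suc k))) * Y))" for k
  proof -
    have i: "0 \<le> 1 + inverse (real (Suc k))" by (rule add_nonneg_nonneg) auto
    have "0 < inverse (real (Suc k))" by simp
    from main[OF this] show ?thesis
      unfolding Y(2) ennreal_mult[OF i mult_nonneg_nonneg[OF i Y(1)]] ennreal_mult[OF i Y(1)] .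
  qed
  ultimately have "ennreal K * gagliardo_sq s w \<le> ennreal ((1 + 0) * ((1 + 0) * Y))"
    by (intro LIMSEQ_le_const) auto
  then show "ennreal (C_ns DIM('a) s / 2) * gagliardo_sq s u \<le> L2_sq g"
    unfolding gw Y(2) K_def by simp
qed

end

text \<open>A Bochner integral that does not exist is 0, so integrability of the integrand has to be
  secured: the lower ellipticity bound makes it nonnegative, the upper one dominates it by a
  multiple of \<open>(norm (g x))\<^sup>2\<close>.\<close>

lemma diffusion_form_lower_bound:
  fixes A :: "real^'n \<Rightarrow> real^'n^'n" and \<omega> \<alpha> s u
  defines "g \<equiv> nl_grad s \<omega> \<alpha> u"
  assumes A: "A \<in> borel_measurable lebesgue" "\<And>x. transpose (A x) = A x" "elliptic A"
    and g: "g \<in> borel_measurable lebesgue" "L2_sq g < \<infinity>"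
  shows "diffusion_form s \<omega> \<alpha> A u u \<ge> smallest_eigenvalue A * enn2real (L2_sq g)"
proof -
  note [measurable] = A(1) g(1)
  have int2: "integrable lebesgue (\<lambda>x. (norm (g x))\<^sup>2)"
    using g(2) by (simp add: L2_sq_def integrable_iff_bounded)
  have "enn2real (L2_sq g) = (LINT x|lebesgue. (norm (g x))\<^sup>2)"
    unfolding L2_sq_def using int2 by (subst nn_integral_eq_integral) auto
  moreover have "smallest_eigenvalue A * (LINT x|lebesgue. (norm (g x))\<^sup>2) \<le> (LINT x|lebesgue. g x \<bullet> (A x *v g x))"
  proof -
    have cont: "(\<lambda>p::(real^'n^'n) \<times> (real^'n). snd p \<bullet> (fst p *v snd p)) \<in> borel_measurable borel"
      by (rule borel_measurable_continuous_onI)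
         (auto simp: matrix_vector_mult_def intro!: continuous_intros)
    have "(\<lambda>x. (A x, g x)) \<in> borel_measurable lebesgue" by (rule borel_measurable_Pair) measurable
    from measurable_compose[OF this cont] have m: "(\<lambda>x. g x \<bullet> (A x *v g x)) \<in> borel_measurable lebesgue"
      by (simp only: fst_conv snd_conv)
    obtain a b where "0 < a" and ab: "\<forall>\<xi> x. a * (norm \<xi>)\<^sup>2 \<le> \<xi> \<bullet> (A x *v \<xi>) \<and> \<xi> \<bullet> (A x *v \<xi>) \<le> b * (norm \<xi>)\<^sup>2"
      using A(3) unfolding elliptic_def by blast
    have le: "norm (g x \<bullet> (A x *v g x)) \<le> norm (b * (norm (g x))\<^sup>2)" for x
    proof -
      have "0 \<le> a * (norm (g x))\<^sup>2" using \<open>0 < a\<close> by simp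
      then show ?thesis using spec[OF spec[OF ab, of "g x"], of x] by simp
    qed
    have int: "integrable lebesgue (\<lambda>x. g x \<bullet> (A x *v g x))"
    proof (rule Bochner_Integration.integrable_bound)
      show "integrable lebesgue (\<lambda>x. b * (norm (g x))\<^sup>2)" using int2 by simp
      show "AE x in lebesgue. norm (g x \<bullet> (A x *v g x)) \<le> norm (b * (norm (g x))\<^sup>2)"
        using le by (rule AE_I2)
    qed (rule m)
    have "(LINT x|lebesgue. smallest_eigenvalue A * (norm (g x))\<^sup>2) \<le> (LINT x|lebesgue. g x \<bullet> (A x *v g x))"
      using int2 int elliptic_smallest_eigenvalue(2)[OF A(2,3)] by (intro integral_mono) auto
    then show ?thesis by simp
  qed
  ultimately show ?thesis unfolding diffusion_form_def g_def by simp
qed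

text \<open>The first conjunct makes no reference to \<open>adv\<close>, so the lower bound does not
  rest on the existence of a duality extension.\<close>

theorem lemma5p1:
  fixes s C\<^sub>v :: real
    and i\<^sub>1 :: "'n::finite"
    and \<Omega> :: "(real^'n) set"
    and A :: "real^'n \<Rightarrow> real^'n^'n"
    and \<omega> :: "real^'n \<Rightarrow> real^'n \<Rightarrow> real"
    and \<alpha> :: "real^'n \<Rightarrow> real^'n \<Rightarrow> real^'n"
    and v :: "real^'n \<Rightarrow> real^'n"
  assumes "CARD('n) \<in> {1, 2, 3}"
    and "1/2 \<le> s" and "s < 1"
    and "open \<Omega>" and "connected \<Omega>" and "\<Omega> \<noteq> {}" and "bounded \<Omega>"
    and "A \<in> borel_measurable lebesgue" and "bounded (range A)"
    and "\<And>x. transpose (A x) = A x" and "elliptic A"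
    and "\<And>x y. \<omega> x y = C_omega i\<^sub>1 s * norm (x - y) powr (- (real CARD('n) + s))"
    and "\<And>x y. \<alpha> x y = (y - x) /\<^sub>R norm (y - x)"
    and "v \<in> borel_measurable (lebesgue_on \<Omega>)"
    and "AE x in lebesgue_on \<Omega>. norm (v x) \<le> C\<^sub>v"
    and "solenoidal \<Omega> v"
  shows "(\<forall>u\<in>Hs_Omega s \<Omega>. diffusion_form s \<omega> \<alpha> A u u
            \<ge> C_ns (CARD('n)) s / 2 * smallest_eigenvalue A * (Hs_Omega_norm s u)\<^sup>2) \<and>
         (\<forall>adv. duality_extension s \<Omega> v adv \<longrightarrow>
            coercive_on (Hs_Omega s \<Omega>) (Hs_Omega_norm s)
              (\<lambda>u w. diffusion_form s \<omega> \<alpha> A u w + adv u w) \<and>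
            (\<forall>u\<in>Hs_Omega s \<Omega>.
              diffusion_form s \<omega> \<alpha> A u u + adv u u = diffusion_form s \<omega> \<alpha> A u u))"
proof -
  have s: "0 < s" "s < 1" using assms(2,3) by auto
  have C: "C_ns CARD('n) s > 0" by (rule C_ns_pos[OF s])
  have ev: "smallest_eigenvalue A > 0" by (rule elliptic_smallest_eigenvalue(1)[OF assms(10,11)])
  have \<omega>: "\<omega> x y = C_omega i\<^sub>1 s * norm (x - y) powr (- (real DIM(real^'n) + s))" for x y
    using assms(12) by simp
  have c: "C_omega i\<^sub>1 s * riesz_const DIM(real^'n) s = 1"
    using C_omega_riesz_const[OF s, of i\<^sub>1] by simp
  have bound: "diffusion_form s \<omega> \<alpha> A u u \<ge> C_ns CARD('n) s / 2 * smallest_eigenvalue A * (Hs_Omega_norm s u)\<^sup>2"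
    if u: "u \<in> Hs_Omega s \<Omega>" for u
  proof -
    note g = nl_grad_props[OF s \<omega> assms(13) c u assms(7)]
    have "ennreal (C_ns CARD('n) s / 2) * gagliardo_sq s u \<le> L2_sq (nl_grad s \<omega> \<alpha> u)" using g(3) by simp
    \<comment> \<open>\<open>enn2real\<close> sends infinity to 0, so monotonicity relies on the
      finite right side.\<close>
    then have "enn2real (ennreal (C_ns CARD('n) s / 2) * gagliardo_sq s u) \<le> enn2real (L2_sq (nl_grad s \<omega> \<alpha> u))"
      using g(2) by (intro enn2real_mono) auto
    then have "C_ns CARD('n) s / 2 * (Hs_Omega_norm s u)\<^sup>2 \<le> enn2real (L2_sq (nl_grad s \<omega> \<alpha> u))"
      using C by (simp add: enn2real_mult Hs_Omega_norm_def)
    then have "smallest_eigenvalue A * (C_ns CARD('n) s / 2 * (Hs_Omega_norm s u)\<^sup>2) \<le> smallest_eigenvalue A * enn2real (L2_sq (nl_grad s \<omega> \<alpha> u))"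
      using ev by (intro mult_left_mono) auto
    also have "\<dots> \<le> diffusion_form s \<omega> \<alpha> A u u"
      by (rule diffusion_form_lower_bound[OF assms(8,10,11) g(1,2)])
    finally show ?thesis by (simp only: mult_ac)
  qed
  have adv: "adv u u = 0" if "duality_extension s \<Omega> v adv" "u \<in> Hs_Omega s \<Omega>" for adv u
    using duality_extension_self[OF that(1) assms(16) that(2)] .
  have "coercive_on (Hs_Omega s \<Omega>) (Hs_Omega_norm s) (\<lambda>u w. diffusion_form s \<omega> \<alpha> A u w + adv u w)"
    if "duality_extension s \<Omega> v adv" for adv
    unfolding coercive_on_def
    using bound adv[OF that] C ev
    by (intro exI[of _ "C_ns CARD('n) s / 2 * smallest_eigenvalue A"]) auto
  then show ?thesis using bound adv by auto
qed

end
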